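(* Let $Q$ and $Q'$ be any two Dynkin quivers with the same underlying Dynkin diagram, of type $A_n$, $D_n$ or $E_{6,7,8}$, with vertex set $I_0$. For all $k,l\in I_0$, $$D^Q_{k,l}(z;-q)=D^{Q'}_{k,l}(z;-q).$$
   Context: Roots and orders. $\Phi^+$ is the set of positive roots of the Dynkin diagram, $\mathsf N=|\Phi^+|$. For a reduced expression $\widetilde w_0=s_{i_1}\cdots s_{i_{\mathsf N}}$ of the longest element put $\beta_k=s_{i_1}\cdots s_{i_{k-1}}(\alpha_{i_k})$, and $\beta_k<_{\widetilde w_0}\beta_l\iff k<l$. $\widetilde w_0$ is adapted to $Q$ if $i_k$ is a source of $s_{i_{k-1}}\cdots s_{i_1}Q$ for all $k$, where $s_iQ$ is $Q$ with all arrows at $i$ reversed. The set $[Q]$ of all reduced expressions of $w_0$ adapted to $Q$ is a single commutation class. $\alpha\prec_Q\beta$ iff $\alpha<_{\widetilde w_0}\beta$ for all $\widetilde w_0\in[Q]$. A sequence $\underline m\in\mathbb Z_{\ge0}^{\mathsf N}$ assigns multiplicity $m_k$ to $\beta_k$; it is viewed as a multiplicity function on $\Phi^+$ and relisted when $\widetilde w_0$ changes; $\mathrm{wt}(\underline m)=\sum m_k\beta_k$. $\underline m'<^{\mathtt b}_{\widetilde w_0}\underline m$ iff the weights agree and there are $k\le s$ with $m'_t=m_t$ for $t<k$, $m'_k<m_k$, $m'_t=m_t$ for $t>s$, $m'_s<m_s$. $\underline m'\prec^{\mathtt b}_Q\underline m$ iff $\underline m'<^{\mathtt b}_{\widetilde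 w_0}\underline m$ for all $\widetilde w_0\in[Q]$. A sequence is $[Q]$-simple if it is minimal for $\prec^{\mathtt b}_Q$. $\mathrm{gdist}_Q(\underline m)$ is the largest $k\ge0$ for which there is a chain of sequences $\underline m^{(0)}\prec^{\mathtt b}_Q\cdots\prec^{\mathtt b}_Q\underline m^{(k)}=\underline m$ with $\underline m^{(0)}$ $[Q]$-simple; for distinct roots $\alpha,\beta$, $\mathrm{gdist}_Q(\alpha,\beta)$ refers to the sequence with multiplicity one at $\alpha$ and $\beta$ and zero elsewhere. Coordinates. Fix a height function $\xi:I_0\to\mathbb Z$ with $\xi_j=\xi_i-1$ for every arrow $i\to j$ of $Q$. Let $\tau_Q$ be the Coxeter element having a reduced expression adapted to $Q$, and $\gamma_i^Q$ the sum of all $\alpha_j$ such that there is a path in $Q$ from $j$ to $i$ (including $j=i$). Every $\beta\in\Phi^+$ is uniquely $\beta=\tau_Q^m(\gamma_i^Q)$ with $m\ge0$ and $\tau_Q^{m'}(\gamma_i^Q)\in\Phi^+$ for $0\le m'\le m$; its coordinate is $(i,p)=(i,\xi_i-2m)$. Distance polynomial. For $k,l\in I_0$ and $t\ge1$ let $\Phi_Q(k,l)[t]$ be the set of $(\alpha,\beta)\in\Phi^+\times\Phi^+$ that are comparable under $\prec_Q$ and whose coordinates form the set $\{(k,a),(l,b)\}$ with $|a-b|=t$. The integer $o_t^Q(k,l)=\mathrm{gdist}_Q(\alpha,\beta)$ for any $(\alpha,\beta)\in\Phi_Q(k,l)[t]$ is independent of the choice; $o_t^Q(k,l)=0$ if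 $\Phi_Q(k,l)[t]=\emptyset$ or $t=0$. Let $Q^{\mathrm{rev}}$ be $Q$ with all arrows reversed and $\mathtt o^{\overline Q}_t(k,l)=\max(o_t^Q(k,l),o_t^{Q^{\mathrm{rev}}}(k,l))$. Then $$D^Q_{k,l}(z;-q)=\prod_{t\in\mathbb Z_{\ge0}}(z-(-q)^t)^{\mathtt o_t^{\overline Q}(k,l)}\in\mathbf k[z],$$ where $\mathbf k$ is the algebraic closure of $\mathbb C(q)$ in $\bigcup_{m>0}\mathbb C((q^{1/m}))$. *)

theory Defs
  imports
    Complex_Main
    "HOL-Computational_Algebra.Formal_Laurent_Series"
    "HOL-Library.Groups_Big_Fun"
begin

section \<open>The coefficient field\<close>

subsection \<open>The field of Puiseux series\<close>

text \<open>
  A pair (m, f) with m > 0 stands for the series f(q^(1/m)) in C((q^(1/m))).  Two such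
  series agree iff they agree after rewriting both in powers of q^(1/(mn)).  The quotient
  is the union of the fields C((q^(1/m))) over all m > 0.
\<close>

definition puiseux_rel :: "nat \<times> complex fls \<Rightarrow> nat \<times> complex fls \<Rightarrow> bool" where
  "puiseux_rel x y \<longleftrightarrow> fst x > 0 \<and> fst y > 0 \<and>
     fls_compose_power (snd x) (fst y) = fls_compose_power (snd y) (fst x)"

lemma fls_compose_power_compose:
  assumes "d > 0" "e > 0"
  shows "fls_compose_power (fls_compose_power f d) e = fls_compose_power f (d * e)"
proof (rule fls_eqI)
  fix n :: int
  have "int e dvd n \<and> int d dvd n div int e \<longleftrightarrow> int d * int e dvd n"
    using assms by (auto simp: dvd_def mult_ac)
  moreover have "n div int e div int d = n div (int d * int e)"
    by (metis mult.commute of_nat_0_le_iff zdiv_zmult2_eq)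
  ultimately show "fls_nth (fls_compose_power (fls_compose_power f d) e) n = fls_nth (fls_compose_power f (d * e)) n"
    using assms by (auto simp: fls_nth_compose_power)
qed

lemma fls_compose_power_inject:
  assumes "d > 0" "fls_compose_power f d = fls_compose_power g d"
  shows "f = g"
proof (rule fls_eqI)
  fix n :: int
  have "fls_nth (fls_compose_power f d) (int d * n) = fls_nth (fls_compose_power g d) (int d * n)"
    using assms(2) by simp
  then show "fls_nth f n = fls_nth g n"
    using assms(1) by (simp add: fls_nth_compose_power)
qed

lemma fls_compose_power_eq_0_iff: "d > 0 \<Longrightarrow> fls_compose_power f d = 0 \<longleftrightarrow> f = 0"
  using fls_compose_power_inject[of d f 0] by auto

lemma fls_compose_power_inverse:
  fixes f :: "complex fls"
  assumes "d > 0"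
  shows "fls_compose_power (inverse f) d = inverse (fls_compose_power f d)"
proof (cases "f = 0")
  case False
  have "fls_compose_power f d * fls_compose_power (inverse f) d = fls_compose_power (f * inverse f) d"
    by simp
  also have "\<dots> = 1" using False assms by simp
  finally show ?thesis by (simp add: inverse_unique)
qed simp

lemma puiseux_rel_part_equivp: "part_equivp puiseux_rel"
proof (rule part_equivpI)
  show "\<exists>x. puiseux_rel x x" by (rule exI[of _ "(1, 0)"]) (simp add: puiseux_rel_def)
  show "symp puiseux_rel" by (auto simp: symp_def puiseux_rel_def)
  show "transp puiseux_rel"
  proof (rule transpI)
    fix x y z assume xy: "puiseux_rel x y" and yz: "puiseux_rel y z"
    obtain m f n g p h where [simp]: "x = (m, f)" "y = (n, g)" "z = (p, h)"
      by (cases x; cases y; cases z)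
    have pos: "m > 0" "n > 0" "p > 0" using xy yz by (auto simp: puiseux_rel_def)
    have 1: "fls_compose_power f n = fls_compose_power g m"
      and 2: "fls_compose_power g p = fls_compose_power h n"
      using xy yz by (auto simp: puiseux_rel_def)
    have "fls_compose_power (fls_compose_power f p) n = fls_compose_power (fls_compose_power f n) p"
      using pos by (simp add: fls_compose_power_compose mult.commute)
    also have "\<dots> = fls_compose_power (fls_compose_power g p) m"
      using pos 1 by (simp add: fls_compose_power_compose mult.commute)
    also have "\<dots> = fls_compose_power (fls_compose_power h m) n"
      using pos 2 by (simp add: fls_compose_power_compose mult.commute)
    finally show "puiseux_rel x z"
      using pos fls_compose_power_inject by (auto simp: puiseux_rel_def)
  qed
qed

quotient_type puiseux = "nat \<times> complex fls" / partial: puiseux_rel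
  by (rule puiseux_rel_part_equivp)

instantiation puiseux :: field
begin

lift_definition zero_puiseux :: puiseux is "(1, 0)"
  by (simp add: puiseux_rel_def)

lift_definition one_puiseux :: puiseux is "(1, 1)"
  by (simp add: puiseux_rel_def)

lift_definition plus_puiseux :: "puiseux \<Rightarrow> puiseux \<Rightarrow> puiseux" is
  "\<lambda>(m, f) (n, g). (m * n, fls_compose_power f n + fls_compose_power g m)"
proof -
  fix x x' y y' assume h: "puiseux_rel x x'" "puiseux_rel y y'"
  obtain m f m' f' n g n' g' where
    [simp]: "x = (m, f)" "x' = (m', f')" "y = (n, g)" "y' = (n', g')"
    by (cases x; cases x'; cases y; cases y')
  have pos: "m > 0" "m' > 0" "n > 0" "n' > 0"
    and 1: "fls_compose_power f m' = fls_compose_power f' m"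
    and 2: "fls_compose_power g n' = fls_compose_power g' n"
    using h by (auto simp: puiseux_rel_def)
  have "fls_compose_power f (n * (m' * n')) = fls_compose_power (fls_compose_power f m') (n * n')"
    using pos by (simp add: fls_compose_power_compose mult_ac)
  also have "\<dots> = fls_compose_power f' (n' * (m * n))"
    using pos 1 by (simp add: fls_compose_power_compose mult_ac)
  finally have A: "fls_compose_power f (n * (m' * n')) = fls_compose_power f' (n' * (m * n))" .
  have "fls_compose_power g (m * (m' * n')) = fls_compose_power (fls_compose_power g n') (m * m')"
    using pos by (simp add: fls_compose_power_compose mult_ac)
  also have "\<dots> = fls_compose_power g' (m' * (m * n))"
    using pos 2 by (simp add: fls_compose_power_compose mult_ac)
  finally have B: "fls_compose_power g (m * (m' * n')) = fls_compose_power g' (m' * (m * n))" .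
  show "puiseux_rel
     ((\<lambda>(m, f) (n, g). (m * n, fls_compose_power f n + fls_compose_power g m)) x y)
     ((\<lambda>(m, f) (n, g). (m * n, fls_compose_power f n + fls_compose_power g m)) x' y')"
    using pos A B by (simp add: puiseux_rel_def fls_compose_power_compose)
qed

lift_definition times_puiseux :: "puiseux \<Rightarrow> puiseux \<Rightarrow> puiseux" is
  "\<lambda>(m, f) (n, g). (m * n, fls_compose_power f n * fls_compose_power g m)"
proof -
  fix x x' y y' assume h: "puiseux_rel x x'" "puiseux_rel y y'"
  obtain m f m' f' n g n' g' where
    [simp]: "x = (m, f)" "x' = (m', f')" "y = (n, g)" "y' = (n', g')"
    by (cases x; cases x'; cases y; cases y')
  have pos: "m > 0" "m' > 0" "n > 0" "n' > 0"
    and 1: "fls_compose_power f m' = fls_compose_power f' m"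
    and 2: "fls_compose_power g n' = fls_compose_power g' n"
    using h by (auto simp: puiseux_rel_def)
  have "fls_compose_power f (n * (m' * n')) = fls_compose_power (fls_compose_power f m') (n * n')"
    using pos by (simp add: fls_compose_power_compose mult_ac)
  also have "\<dots> = fls_compose_power f' (n' * (m * n))"
    using pos 1 by (simp add: fls_compose_power_compose mult_ac)
  finally have A: "fls_compose_power f (n * (m' * n')) = fls_compose_power f' (n' * (m * n))" .
  have "fls_compose_power g (m * (m' * n')) = fls_compose_power (fls_compose_power g n') (m * m')"
    using pos by (simp add: fls_compose_power_compose mult_ac)
  also have "\<dots> = fls_compose_power g' (m' * (m * n))"
    using pos 2 by (simp add: fls_compose_power_compose mult_ac)
  finally have B: "fls_compose_power g (m * (m' * n')) = fls_compose_power g' (m' * (m * n))" .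
  show "puiseux_rel
     ((\<lambda>(m, f) (n, g). (m * n, fls_compose_power f n * fls_compose_power g m)) x y)
     ((\<lambda>(m, f) (n, g). (m * n, fls_compose_power f n * fls_compose_power g m)) x' y')"
    using pos A B by (simp add: puiseux_rel_def fls_compose_power_compose)
qed

lift_definition uminus_puiseux :: "puiseux \<Rightarrow> puiseux" is "\<lambda>(m, f). (m, - f)"
  by (auto simp: puiseux_rel_def)

lift_definition inverse_puiseux :: "puiseux \<Rightarrow> puiseux" is "\<lambda>(m, f). (m, inverse f)"
  by (auto simp: puiseux_rel_def fls_compose_power_inverse)

definition minus_puiseux :: "puiseux \<Rightarrow> puiseux \<Rightarrow> puiseux" where
  "minus_puiseux x y = x + - y"

definition divide_puiseux :: "puiseux \<Rightarrow> puiseux \<Rightarrow> puiseux" where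
  "divide_puiseux x y = x * inverse y"

instance
proof
  fix a b c :: puiseux
  show "a + b + c = a + (b + c)"
    by transfer (auto simp: puiseux_rel_def fls_compose_power_compose algebra_simps)
  show "a + b = b + a"
    by transfer (auto simp: puiseux_rel_def fls_compose_power_compose algebra_simps)
  show "0 + a = a"
    by transfer (auto simp: puiseux_rel_def fls_compose_power_compose algebra_simps)
  show "- a + a = 0"
    by transfer (auto simp: puiseux_rel_def fls_compose_power_compose algebra_simps)
  show "a - b = a + - b" by (simp add: minus_puiseux_def)
  show "a * b * c = a * (b * c)"
    by transfer (auto simp: puiseux_rel_def fls_compose_power_compose algebra_simps)
  show "a * b = b * a"
    by transfer (auto simp: puiseux_rel_def fls_compose_power_compose algebra_simps)
  show "1 * a = a"
    by transfer (auto simp: puiseux_rel_def fls_compose_power_compose algebra_simps)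
  show "(a + b) * c = a * c + b * c"
    by transfer (auto simp: puiseux_rel_def fls_compose_power_compose algebra_simps)
  show "(0::puiseux) \<noteq> 1"
    by transfer (auto simp: puiseux_rel_def)
  show "a \<noteq> 0 \<Longrightarrow> inverse a * a = 1"
    by transfer (auto simp: puiseux_rel_def fls_compose_power_inverse fls_compose_power_compose
                           fls_compose_power_eq_0_iff)
  show "a div b = a * inverse b" by (simp add: divide_puiseux_def)
  show "inverse (0::puiseux) = 0"
    by transfer (auto simp: puiseux_rel_def)
qed

end

lift_definition puiseux_const :: "complex \<Rightarrow> puiseux" is "\<lambda>c. (1, fls_const c)"
  by (simp add: puiseux_rel_def)

lift_definition puiseux_q :: puiseux is "(1, fls_X)"
  by (simp add: puiseux_rel_def)

subsection \<open>The subfields C(q) and k\<close>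

inductive_set rational_in_q :: "puiseux set" where
  const: "puiseux_const c \<in> rational_in_q"
| q: "puiseux_q \<in> rational_in_q"
| diff: "x \<in> rational_in_q \<Longrightarrow> y \<in> rational_in_q \<Longrightarrow> x - y \<in> rational_in_q"
| mult: "x \<in> rational_in_q \<Longrightarrow> y \<in> rational_in_q \<Longrightarrow> x * y \<in> rational_in_q"
| inverse: "x \<in> rational_in_q \<Longrightarrow> inverse x \<in> rational_in_q"

definition base_field :: "puiseux set" where
  "base_field = {x. \<exists>p. p \<noteq> 0 \<and> (\<forall>i. coeff p i \<in> rational_in_q) \<and> poly p x = 0}"

lemma rational_in_q_zero: "0 \<in> rational_in_q"
  using rational_in_q.diff[OF rational_in_q.q rational_in_q.q] by simp

lemma rational_in_q_one: "1 \<in> rational_in_q"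
proof -
  have "puiseux_const 1 = 1" by transfer (simp add: puiseux_rel_def)
  then show ?thesis using rational_in_q.const[of 1] by simp
qed

lemma rational_in_q_uminus: "x \<in> rational_in_q \<Longrightarrow> - x \<in> rational_in_q"
  using rational_in_q.diff[OF rational_in_q_zero] by fastforce

lemma rational_in_q_add: "x \<in> rational_in_q \<Longrightarrow> y \<in> rational_in_q \<Longrightarrow> x + y \<in> rational_in_q"
  using rational_in_q.diff[OF _ rational_in_q_uminus] by fastforce

lemma rational_in_q_subset_base_field: "rational_in_q \<subseteq> base_field"
proof
  fix x assume "x \<in> rational_in_q"
  then have "\<forall>i. coeff [:- x, 1:] i \<in> rational_in_q"
    by (auto simp: coeff_pCons rational_in_q_uminus rational_in_q_one rational_in_q_zero
             split: nat.split)
  then show "x \<in> base_field"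
    unfolding base_field_def by (intro CollectI exI[of _ "[:- x, 1:]"]) auto
qed


section \<open>Dynkin diagrams, roots and the Weyl group\<close>

datatype dynkin = TypeA nat | TypeD nat | TypeE nat

fun dynkin_type :: "dynkin \<Rightarrow> bool" where
  "dynkin_type (TypeA n) \<longleftrightarrow> n \<ge> 1"
| "dynkin_type (TypeD n) \<longleftrightarrow> n \<ge> 4"
| "dynkin_type (TypeE n) \<longleftrightarrow> n \<in> {6, 7, 8}"

fun vertices :: "dynkin \<Rightarrow> nat set" where
  "vertices (TypeA n) = {1..n}"
| "vertices (TypeD n) = {1..n}"
| "vertices (TypeE n) = {1..n}"

text \<open>Bourbaki labelling.\<close>

fun dynkin_edges :: "dynkin \<Rightarrow> nat set set" where
  "dynkin_edges (TypeA n) = {{i, i + 1} | i. 1 \<le> i \<and> i + 1 \<le> n}"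
| "dynkin_edges (TypeD n) = {{i, i + 1} | i. 1 \<le> i \<and> i + 1 \<le> n - 1} \<union> {{n - 2, n}}"
| "dynkin_edges (TypeE n) = {{1, 3}, {2, 4}} \<union> {{i, i + 1} | i. 3 \<le> i \<and> i + 1 \<le> n}"

definition cartan :: "dynkin \<Rightarrow> nat \<Rightarrow> nat \<Rightarrow> int" where
  "cartan T i j = (if i = j then 2 else if {i, j} \<in> dynkin_edges T then - 1 else 0)"

text \<open>An element of the root lattice is given by its coefficients on the simple roots.\<close>

type_synonym lattice = "nat \<Rightarrow> int"

definition simple_root :: "nat \<Rightarrow> lattice" where
  "simple_root i = (\<lambda>j. if j = i then 1 else 0)"

definition simple_reflection :: "dynkin \<Rightarrow> nat \<Rightarrow> lattice \<Rightarrow> lattice" where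
  "simple_reflection T i v = v(i := v i - (\<Sum>j\<in>vertices T. cartan T i j * v j))"

definition word_action :: "dynkin \<Rightarrow> nat list \<Rightarrow> lattice \<Rightarrow> lattice" where
  "word_action T ws = foldr (\<lambda>i w. simple_reflection T i \<circ> w) ws id"

definition weyl_group :: "dynkin \<Rightarrow> (lattice \<Rightarrow> lattice) set" where
  "weyl_group T = {word_action T ws | ws. set ws \<subseteq> vertices T}"

definition weyl_length :: "dynkin \<Rightarrow> (lattice \<Rightarrow> lattice) \<Rightarrow> nat" where
  "weyl_length T w =
     (LEAST n. \<exists>ws. set ws \<subseteq> vertices T \<and> length ws = n \<and> word_action T ws = w)"

definition reduced_expression :: "dynkin \<Rightarrow> (lattice \<Rightarrow> lattice) \<Rightarrow> nat list \<Rightarrow> bool" where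
  "reduced_expression T w ws \<longleftrightarrow>
     set ws \<subseteq> vertices T \<and> word_action T ws = w \<and> length ws = weyl_length T w"

definition longest_element :: "dynkin \<Rightarrow> lattice \<Rightarrow> lattice" where
  "longest_element T =
     (THE w. w \<in> weyl_group T \<and> (\<forall>v\<in>weyl_group T. weyl_length T v \<le> weyl_length T w))"

definition roots :: "dynkin \<Rightarrow> lattice set" where
  "roots T = {w (simple_root i) | w i. w \<in> weyl_group T \<and> i \<in> vertices T}"

definition positive_roots :: "dynkin \<Rightarrow> lattice set" where
  "positive_roots T = {\<beta> \<in> roots T. \<forall>i. \<beta> i \<ge> 0}"

text \<open>Indices are shifted to start at 0.\<close>

definition root_of_word :: "dynkin \<Rightarrow> nat list \<Rightarrow> nat \<Rightarrow> lattice" where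
  "root_of_word T ws k = word_action T (take k ws) (simple_root (ws ! k))"


section \<open>Dynkin quivers and orders\<close>

text \<open>A quiver is given by its set of arrows; the pair (i, j) is the arrow from i to j.\<close>

type_synonym quiver = "(nat \<times> nat) set"

definition dynkin_quiver :: "dynkin \<Rightarrow> quiver \<Rightarrow> bool" where
  "dynkin_quiver T Q \<longleftrightarrow>
     (\<forall>(i, j)\<in>Q. {i, j} \<in> dynkin_edges T) \<and>
     (\<forall>i j. {i, j} \<in> dynkin_edges T \<longrightarrow> ((i, j) \<in> Q \<longleftrightarrow> (j, i) \<notin> Q))"

definition is_source :: "quiver \<Rightarrow> nat \<Rightarrow> bool" where
  "is_source Q i \<longleftrightarrow> (\<forall>j. (j, i) \<notin> Q)"

definition reverse_at :: "nat \<Rightarrow> quiver \<Rightarrow> quiver" where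
  "reverse_at i Q = {(a, b). if a = i \<or> b = i then (b, a) \<in> Q else (a, b) \<in> Q}"

fun adapted :: "quiver \<Rightarrow> nat list \<Rightarrow> bool" where
  "adapted Q [] \<longleftrightarrow> True"
| "adapted Q (i # ws) \<longleftrightarrow> is_source Q i \<and> adapted (reverse_at i Q) ws"

definition adapted_class :: "dynkin \<Rightarrow> quiver \<Rightarrow> nat list set" where
  "adapted_class T Q = {ws. reduced_expression T (longest_element T) ws \<and> adapted Q ws}"

definition root_less_word :: "dynkin \<Rightarrow> nat list \<Rightarrow> lattice \<Rightarrow> lattice \<Rightarrow> bool" where
  "root_less_word T ws \<alpha> \<beta> \<longleftrightarrow>
     (\<exists>k l. k < l \<and> l < length ws \<and> root_of_word T ws k = \<alpha> \<and> root_of_word T ws l = \<beta>)"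

definition root_less :: "dynkin \<Rightarrow> quiver \<Rightarrow> lattice \<Rightarrow> lattice \<Rightarrow> bool" where
  "root_less T Q \<alpha> \<beta> \<longleftrightarrow> (\<forall>ws\<in>adapted_class T Q. root_less_word T ws \<alpha> \<beta>)"

type_synonym multiplicity = "lattice \<Rightarrow> nat"

definition sequences :: "dynkin \<Rightarrow> multiplicity set" where
  "sequences T = {m. \<forall>\<beta>. \<beta> \<notin> positive_roots T \<longrightarrow> m \<beta> = 0}"

definition weight :: "dynkin \<Rightarrow> multiplicity \<Rightarrow> lattice" where
  "weight T m = (\<lambda>i. \<Sum>\<beta>\<in>positive_roots T. int (m \<beta>) * \<beta> i)"

definition seq_less_word ::
    "dynkin \<Rightarrow> nat list \<Rightarrow> multiplicity \<Rightarrow> multiplicity \<Rightarrow> bool" where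
  "seq_less_word T ws m' m \<longleftrightarrow>
     weight T m' = weight T m \<and>
     (let \<beta> = root_of_word T ws in
      \<exists>k s. k \<le> s \<and> s < length ws \<and>
        (\<forall>t<k. m' (\<beta> t) = m (\<beta> t)) \<and> m' (\<beta> k) < m (\<beta> k) \<and>
        (\<forall>t. s < t \<and> t < length ws \<longrightarrow> m' (\<beta> t) = m (\<beta> t)) \<and> m' (\<beta> s) < m (\<beta> s))"

definition seq_less :: "dynkin \<Rightarrow> quiver \<Rightarrow> multiplicity \<Rightarrow> multiplicity \<Rightarrow> bool" where
  "seq_less T Q m' m \<longleftrightarrow> (\<forall>ws\<in>adapted_class T Q. seq_less_word T ws m' m)"

definition simple_seq :: "dynkin \<Rightarrow> quiver \<Rightarrow> multiplicity \<Rightarrow> bool" where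
  "simple_seq T Q m \<longleftrightarrow> m \<in> sequences T \<and> \<not> (\<exists>m'\<in>sequences T. seq_less T Q m' m)"

definition gdist :: "dynkin \<Rightarrow> quiver \<Rightarrow> multiplicity \<Rightarrow> nat" where
  "gdist T Q m = (GREATEST k. \<exists>c :: nat \<Rightarrow> multiplicity.
     (\<forall>j\<le>k. c j \<in> sequences T) \<and> simple_seq T Q (c 0) \<and> c k = m \<and>
     (\<forall>j<k. seq_less T Q (c j) (c (Suc j))))"

text \<open>Only used for two distinct roots.\<close>

definition pair_seq :: "lattice \<Rightarrow> lattice \<Rightarrow> multiplicity" where
  "pair_seq \<alpha> \<beta> = (\<lambda>\<gamma>. if \<gamma> = \<alpha> \<or> \<gamma> = \<beta> then 1 else 0)"


section \<open>Coordinates\<close>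

definition height_function :: "quiver \<Rightarrow> (nat \<Rightarrow> int) \<Rightarrow> bool" where
  "height_function Q \<xi> \<longleftrightarrow> (\<forall>(i, j)\<in>Q. \<xi> j = \<xi> i - 1)"

definition coxeter_element :: "dynkin \<Rightarrow> (lattice \<Rightarrow> lattice) \<Rightarrow> bool" where
  "coxeter_element T w \<longleftrightarrow> (\<exists>ws. distinct ws \<and> set ws = vertices T \<and> word_action T ws = w)"

definition coxeter_of_quiver :: "dynkin \<Rightarrow> quiver \<Rightarrow> lattice \<Rightarrow> lattice" where
  "coxeter_of_quiver T Q =
     (THE w. coxeter_element T w \<and> (\<exists>ws. reduced_expression T w ws \<and> adapted Q ws))"

text \<open>The coefficient at vertex j is 1 iff there is a path from j to i.\<close>

definition path_root :: "quiver \<Rightarrow> nat \<Rightarrow> lattice" where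
  "path_root Q i = (\<lambda>j. if (j, i) \<in> Q\<^sup>* then 1 else 0)"

definition coordinate ::
    "dynkin \<Rightarrow> quiver \<Rightarrow> (nat \<Rightarrow> int) \<Rightarrow> lattice \<Rightarrow> nat \<times> int" where
  "coordinate T Q \<xi> \<beta> = (THE c. \<exists>i\<in>vertices T. \<exists>m.
     \<beta> = (coxeter_of_quiver T Q ^^ m) (path_root Q i) \<and>
     (\<forall>m'\<le>m. (coxeter_of_quiver T Q ^^ m') (path_root Q i) \<in> positive_roots T) \<and>
     c = (i, \<xi> i - 2 * int m))"


section \<open>Distance polynomials\<close>

text \<open>
  From here on, the parameter \<open>\<xi>\<close> is a choice of one height function \<open>\<xi> Q\<close> for each quiver.
\<close>

definition root_pairs ::
    "dynkin \<Rightarrow> (quiver \<Rightarrow> nat \<Rightarrow> int) \<Rightarrow> quiver \<Rightarrow> nat \<Rightarrow> nat \<Rightarrow> nat \<Rightarrow> (lattice \<times> lattice) set" where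
  "root_pairs T \<xi> Q k l t = {(\<alpha>, \<beta>).
     \<alpha> \<in> positive_roots T \<and> \<beta> \<in> positive_roots T \<and>
     (root_less T Q \<alpha> \<beta> \<or> root_less T Q \<beta> \<alpha>) \<and>
     (\<exists>a b. {coordinate T Q (\<xi> Q) \<alpha>, coordinate T Q (\<xi> Q) \<beta>} = {(k, a), (l, b)} \<and>
        \<bar>a - b\<bar> = int t)}"

definition dist_exponent ::
    "dynkin \<Rightarrow> (quiver \<Rightarrow> nat \<Rightarrow> int) \<Rightarrow> quiver \<Rightarrow> nat \<Rightarrow> nat \<Rightarrow> nat \<Rightarrow> nat" where
  "dist_exponent T \<xi> Q k l t =
     (if t = 0 \<or> root_pairs T \<xi> Q k l t = {} then 0
      else THE d. \<forall>(\<alpha>, \<beta>)\<in>root_pairs T \<xi> Q k l t. gdist T Q (pair_seq \<alpha> \<beta>) = d)"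

text \<open>The reversed quiver is the converse relation.\<close>

definition dist_exponent_sym ::
    "dynkin \<Rightarrow> (quiver \<Rightarrow> nat \<Rightarrow> int) \<Rightarrow> quiver \<Rightarrow> nat \<Rightarrow> nat \<Rightarrow> nat \<Rightarrow> nat" where
  "dist_exponent_sym T \<xi> Q k l t =
     max (dist_exponent T \<xi> Q k l t) (dist_exponent T \<xi> (Q\<inverse>) k l t)"

text \<open>
  The product over all \<open>t\<close> is \<^const>\<open>Prod_any\<close>, i.e. it runs over the factors different from 1.
  The polynomial has coefficients in the subfield \<^const>\<open>base_field\<close>, see below.
\<close>

definition distance_poly ::
    "dynkin \<Rightarrow> (quiver \<Rightarrow> nat \<Rightarrow> int) \<Rightarrow> quiver \<Rightarrow> nat \<Rightarrow> nat \<Rightarrow> puiseux poly" where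
  "distance_poly T \<xi> Q k l =
     (\<Prod>t. [:- ((- puiseux_q) ^ t), 1:] ^ dist_exponent_sym T \<xi> Q k l t)"

lemma rational_in_q_power: "x \<in> rational_in_q \<Longrightarrow> x ^ n \<in> rational_in_q"
  by (induction n) (auto intro: rational_in_q.mult rational_in_q_one)

lemma coeff_mult_rational_in_q:
  assumes "\<forall>i. coeff p i \<in> rational_in_q" "\<forall>i. coeff r i \<in> rational_in_q"
  shows "\<forall>i. coeff (p * r) i \<in> rational_in_q"
proof
  fix i
  have "(\<Sum>j\<in>A. coeff p j * coeff r (i - j)) \<in> rational_in_q" if "finite A" for A
    using that assms
    by (induction A rule: finite_induct)
       (auto intro: rational_in_q_zero rational_in_q_add rational_in_q.mult)
  then show "coeff (p * r) i \<in> rational_in_q" by (simp add: coeff_mult)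
qed

lemma coeff_one_rational_in_q: "\<forall>i. coeff (1 :: puiseux poly) i \<in> rational_in_q"
  by (simp add: rational_in_q_zero rational_in_q_one)

lemma coeff_distance_poly_in_base_field: "coeff (distance_poly T \<xi> Q k l) i \<in> base_field"
proof -
  define g where "g t = [:- ((- puiseux_q) ^ t), 1:] ^ dist_exponent_sym T \<xi> Q k l t" for t
  have factor: "\<forall>i. coeff (g t) i \<in> rational_in_q" for t
  proof -
    have "\<forall>i. coeff [:- ((- puiseux_q) ^ t), 1:] i \<in> rational_in_q"
      by (auto simp: coeff_pCons rational_in_q_one rational_in_q_zero split: nat.split
               intro!: rational_in_q_uminus rational_in_q_power rational_in_q.q)
    then have "\<forall>i. coeff ([:- ((- puiseux_q) ^ t), 1:] ^ n) i \<in> rational_in_q" for n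
      by (induction n) (auto simp del: mult_pCons_left
          intro: coeff_mult_rational_in_q[rule_format] simp: rational_in_q_zero rational_in_q_one)
    then show ?thesis by (simp add: g_def)
  qed
  have "\<forall>i. coeff (prod g A) i \<in> rational_in_q" for A
  proof (induction A rule: infinite_finite_induct)
    case (insert x F)
    then show ?case using coeff_mult_rational_in_q[OF factor insert.IH] by simp
  qed (use coeff_one_rational_in_q in simp_all)
  then have "coeff (distance_poly T \<xi> Q k l) i \<in> rational_in_q"
    by (simp add: distance_poly_def Prod_any.expand_set g_def[abs_def])
  then show ?thesis using rational_in_q_subset_base_field by blast
qed

end

theory Submission
  imports Defs
begin

text \<open>
  Write \<open>\<xi>\<close> for a height function of \<open>Q\<close> and picture a positive root with coordinate \<open>(i, p)\<close> as the point \<open>p\<close>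
  of row \<open>i\<close>.  The points of row \<open>i\<close> start at \<open>\<xi> i\<close> and go down in steps of two.  Reflecting \<open>Q\<close> at a
  source \<open>i\<close> lowers \<open>\<xi> i\<close> by two.  It removes the top point of row \<open>i\<close>, whose root is \<open>\<alpha>\<^sub>i\<close>, appends one point
  below the row of the opposite vertex, and moves every other root by the simple reflection without changing its coordinate
  (\<open>move_transport\<close>, \<open>pos_lower\<close>).  Some adapted word starts with \<open>i\<close>, so a sequence below one that
  avoids \<open>\<alpha>\<^sub>i\<close> avoids \<open>\<alpha>\<^sub>i\<close> too.  Hence the reflection preserves the distance and the comparability
  of every pair of roots different from \<open>\<alpha>\<^sub>i\<close>.

  Two height functions with values of equal parity both descend, by reflections at sources, to their pointwise
  minimum.  A pair of points that belongs to both survives on the way, so the distance of a pair depends only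
  on its two rows \<open>k\<close>, \<open>l\<close> and on the difference \<open>a - b\<close> of its second coordinates.  Reading adapted
  words backwards turns the picture upside down, which replaces \<open>a - b\<close> by its negative
  (\<open>dual_transport\<close>, \<open>pos_dual\<close>).  So the distance depends only on \<open>k\<close>, \<open>l\<close> and \<open>\<bar>a - b\<bar>\<close>, whatever the
  quiver is (\<open>pair_data_invariant\<close>); in particular every exponent is well defined.

  It remains to see that a distance \<open>d > 0\<close> that occurs for some quiver occurs for \<open>Q'\<close> or for its reverse
  (\<open>comparable_pair_transfer\<close>).  Let \<open>a > b\<close>.  Lowering as much as possible, comparability forces a height
  function \<open>\<mu>\<close> with \<open>k\<close> as its only source and \<open>\<mu> k = a\<close>.  It is the least height function with the value \<open>a\<close>
  at \<open>k\<close>, so it lies below the shifts of \<open>\<xi>\<close> for \<open>Q'\<close> and of \<open>-\<xi>\<close> for the reverse that have this value.  The point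
  \<open>(l, b)\<close> can be missing there only at the bottom of row \<open>l\<close>.  That bottom is a constant \<open>h\<close> below the
  height at the vertex opposite to \<open>l\<close> under \<open>- w\<^sub>0\<close> (\<open>opposite_bottom_const\<close>).  The two shifted functions
  have the mean value \<open>a\<close>, so if both miss the point then \<open>a - b \<ge> h\<close>.  In this case some height function
  turns the two roots into simple roots of nonadjacent vertices (\<open>distant_pair\<close>).  By the Euler form
  such a pair is simple (\<open>nonadjacent_simple_pair\<close>), so \<open>d = 0\<close>, a contradiction.

  The foundations are proved for any connected tree whose Cartan form bounds the coefficients of integral
  vectors.  Roots are the vectors of norm two, reduced words are the words with positive roots, and the Euler
  form, which a reflection at a source preserves, shows that adapted words of the longest element exist and
  computes coordinates along them (\<open>adapted_extend_one\<close>, \<open>occurrence_root\<close>, \<open>coordinate_eq\<close>).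
\<close>


section \<open>Integral forms on the root lattice\<close>

definition root_lattice :: "dynkin \<Rightarrow> lattice set" where
  "root_lattice T = {v. \<forall>i. i \<notin> vertices T \<longrightarrow> v i = 0}"

definition coroot_pairing :: "dynkin \<Rightarrow> nat \<Rightarrow> lattice \<Rightarrow> int" where
  "coroot_pairing T i v = (\<Sum>j\<in>vertices T. cartan T i j * v j)"

definition cartan_form :: "dynkin \<Rightarrow> lattice \<Rightarrow> lattice \<Rightarrow> int" where
  "cartan_form T x y = (\<Sum>i\<in>vertices T. x i * coroot_pairing T i y)"

definition linear_map :: "(lattice \<Rightarrow> lattice) \<Rightarrow> bool" where
  "linear_map f \<longleftrightarrow> (\<forall>a b x y. f (\<lambda>j. a * x j + b * y j) = (\<lambda>j. a * f x j + b * f y j))"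

definition negate :: "lattice \<Rightarrow> lattice" where
  "negate v = (\<lambda>j. - v j)"

lemma negate_negate [simp]: "negate (negate v) = v"
  by (simp add: negate_def)

lemma linear_mapD:
  "linear_map f \<Longrightarrow> f (\<lambda>j. a * x j + b * y j) = (\<lambda>j. a * f x j + b * f y j)"
  by (simp add: linear_map_def)

lemma linear_map_zero: "linear_map f \<Longrightarrow> f (\<lambda>_. 0) = (\<lambda>_. 0)"
  using linear_mapD[of f 0 "\<lambda>_. 0" 0 "\<lambda>_. 0"] by simp

lemma linear_map_negate: "linear_map f \<Longrightarrow> f (negate x) = negate (f x)"
  using linear_mapD[of f "-1" x 0 x] by (simp add: negate_def)

lemma linear_map_compose: "linear_map f \<Longrightarrow> linear_map g \<Longrightarrow> linear_map (f \<circ> g)"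
  by (simp add: linear_map_def)

lemma linear_map_negate_self: "linear_map negate"
  by (auto simp: linear_map_def negate_def)

lemma linear_map_sum:
  assumes "linear_map f" "finite A"
  shows "f (\<lambda>j. \<Sum>b\<in>A. c b * x b j) = (\<lambda>j. \<Sum>b\<in>A. c b * f (x b) j)"
  using assms(2)
proof (induction A rule: finite_induct)
  case empty
  then show ?case using linear_map_zero[OF assms(1)] by simp
next
  case (insert b A)
  have "f (\<lambda>j. \<Sum>b\<in>insert b A. c b * x b j) = f (\<lambda>j. c b * x b j + 1 * (\<Sum>b\<in>A. c b * x b j))"
    using insert by simp
  also have "\<dots> = (\<lambda>j. c b * f (x b) j + 1 * (\<Sum>b\<in>A. c b * f (x b) j))"
    using linear_mapD[OF assms(1), of "c b" "x b" 1] insert.IH by simp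
  finally show ?case using insert by simp
qed

lemma finite_vertices [simp]: "finite (vertices T)"
  by (cases T) auto

lemma root_latticeD: "v \<in> root_lattice T \<Longrightarrow> i \<notin> vertices T \<Longrightarrow> v i = 0"
  by (simp add: root_lattice_def)

lemma simple_root_in_lattice: "i \<in> vertices T \<Longrightarrow> simple_root i \<in> root_lattice T"
  by (auto simp: root_lattice_def simple_root_def)

lemma simple_root_self [simp]: "simple_root i i = 1"
  by (simp add: simple_root_def)

lemma simple_root_inject [simp]: "simple_root i = simple_root j \<longleftrightarrow> i = j"
  unfolding simple_root_def by (metis zero_neq_one)

lemma root_lattice_expansion:
  assumes "v \<in> root_lattice T"
  shows "v = (\<lambda>j. \<Sum>i\<in>vertices T. v i * simple_root i j)"
proof
  fix j
  have "(\<Sum>i\<in>vertices T. v i * simple_root i j) = (\<Sum>i\<in>vertices T. if j = i then v i else 0)"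
    by (intro sum.cong) (auto simp: simple_root_def)
  then show "v j = (\<Sum>i\<in>vertices T. v i * simple_root i j)"
    using assms by (auto simp: sum.delta' root_lattice_def)
qed

lemma simple_reflection_eq:
  "simple_reflection T i v = v(i := v i - coroot_pairing T i v)"
  by (simp add: simple_reflection_def coroot_pairing_def)

lemma coroot_pairing_linear:
  "coroot_pairing T i (\<lambda>j. a * x j + b * y j) = a * coroot_pairing T i x + b * coroot_pairing T i y"
  by (simp add: coroot_pairing_def sum.distrib sum_distrib_left algebra_simps)

lemma coroot_pairing_simple_root:
  "j \<in> vertices T \<Longrightarrow> coroot_pairing T i (simple_root j) = cartan T i j"
proof -
  assume j: "j \<in> vertices T"
  have "coroot_pairing T i (simple_root j) = (\<Sum>l\<in>vertices T. if j = l then cartan T i l else 0)"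
    unfolding coroot_pairing_def by (intro sum.cong) (auto simp: simple_root_def)
  then show ?thesis using j by simp
qed

lemma simple_reflection_linear: "linear_map (simple_reflection T i)"
  by (auto simp: linear_map_def simple_reflection_eq coroot_pairing_linear algebra_simps fun_eq_iff)

lemma simple_reflection_other: "j \<noteq> i \<Longrightarrow> simple_reflection T i v j = v j"
  by (simp add: simple_reflection_eq)

lemma simple_reflection_in_lattice:
  "i \<in> vertices T \<Longrightarrow> v \<in> root_lattice T \<Longrightarrow> simple_reflection T i v \<in> root_lattice T"
  by (auto simp: root_lattice_def simple_reflection_eq)

lemma simple_reflection_sub:
  "simple_reflection T i v = (\<lambda>j. 1 * v j + (- coroot_pairing T i v) * simple_root i j)"
  by (auto simp: simple_reflection_eq simple_root_def)

lemma cartan_sym: "cartan T i j = cartan T j i"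
  by (simp add: cartan_def insert_commute)

lemma cartan_form_sym: "cartan_form T x y = cartan_form T y x"
proof -
  have "cartan_form T x y = (\<Sum>i\<in>vertices T. \<Sum>j\<in>vertices T. x i * (cartan T i j * y j))"
    by (simp add: cartan_form_def coroot_pairing_def sum_distrib_left)
  also have "\<dots> = (\<Sum>j\<in>vertices T. \<Sum>i\<in>vertices T. x i * (cartan T i j * y j))"
    by (rule sum.swap)
  also have "\<dots> = cartan_form T y x"
    unfolding cartan_form_def coroot_pairing_def sum_distrib_left
    by (intro sum.cong refl) (subst cartan_sym, simp add: mult_ac)
  finally show ?thesis .
qed

lemma cartan_form_linear_right:
  "cartan_form T z (\<lambda>j. a * x j + b * y j) = a * cartan_form T z x + b * cartan_form T z y"
  by (simp add: cartan_form_def coroot_pairing_linear sum.distrib sum_distrib_left algebra_simps)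

lemma cartan_form_linear_left:
  "cartan_form T (\<lambda>j. a * x j + b * y j) z = a * cartan_form T x z + b * cartan_form T y z"
  using cartan_form_linear_right[of T z a x b y] by (simp add: cartan_form_sym)

lemma cartan_form_square:
  "cartan_form T (\<lambda>j. a * x j + b * y j) (\<lambda>j. a * x j + b * y j) =
     a * (a * cartan_form T x x) + b * (b * cartan_form T y y) + 2 * a * b * cartan_form T x y"
  using cartan_form_linear_left[of T a x b y "\<lambda>j. a * x j + b * y j"]
    cartan_form_linear_right[of T x a x b y] cartan_form_linear_right[of T y a x b y]
    cartan_form_sym[of T y x]
  by (simp add: algebra_simps)

lemma cartan_form_negate: "cartan_form T (negate v) (negate v) = cartan_form T v v"
  using cartan_form_square[of T "-1" v 0 v] by (simp add: negate_def)

lemma cartan_form_simple_root: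
  "i \<in> vertices T \<Longrightarrow> cartan_form T (simple_root i) y = coroot_pairing T i y"
proof -
  assume i: "i \<in> vertices T"
  have "cartan_form T (simple_root i) y = (\<Sum>l\<in>vertices T. if i = l then coroot_pairing T l y else 0)"
    unfolding cartan_form_def by (intro sum.cong) (auto simp: simple_root_def)
  then show ?thesis using i by simp
qed

lemma coroot_pairing_self: "i \<in> vertices T \<Longrightarrow> coroot_pairing T i (simple_root i) = 2"
  by (simp add: coroot_pairing_simple_root cartan_def)

lemma simple_reflection_simple_root:
  "i \<in> vertices T \<Longrightarrow> simple_reflection T i (simple_root i) = negate (simple_root i)"
  unfolding simple_reflection_eq by (auto simp: fun_eq_iff coroot_pairing_self negate_def)
    (auto simp: simple_root_def)

lemma simple_reflection_invol [simp]:
  assumes "i \<in> vertices T"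
  shows "simple_reflection T i (simple_reflection T i v) = v"
proof -
  have "coroot_pairing T i (simple_reflection T i v) = - coroot_pairing T i v"
    using coroot_pairing_linear[of T i 1 v "- coroot_pairing T i v" "simple_root i"] coroot_pairing_self[OF assms]
    unfolding simple_reflection_sub[symmetric] by simp
  then show ?thesis
    by (simp add: simple_reflection_eq)
qed

lemma cartan_form_simple_reflection:
  assumes "i \<in> vertices T"
  shows "cartan_form T (simple_reflection T i x) (simple_reflection T i y) = cartan_form T x y"
proof -
  have "cartan_form T x (simple_root i) = coroot_pairing T i x"
    using assms cartan_form_simple_root cartan_form_sym by metis
  then show ?thesis
    using cartan_form_linear_left[of T 1 x "- coroot_pairing T i x" "simple_root i" "simple_reflection T i y"]
      cartan_form_linear_right[of T x 1 y "- coroot_pairing T i y" "simple_root i"]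
      cartan_form_linear_right[of T "simple_root i" 1 y "- coroot_pairing T i y" "simple_root i"] assms
    unfolding simple_reflection_sub[symmetric]
    by (simp add: cartan_form_simple_root coroot_pairing_self)
qed

text \<open>
  The form \<open>\<Sum>\<^sub>i x\<^sub>i y\<^sub>i - \<Sum> x\<^sub>i y\<^sub>j\<close> with the second sum over the arrows \<open>i \<rightarrow> j\<close>, which on dimension vectors is
  \<open>dim Hom - dim Ext\<^sup>1\<close>.  Grouping by \<open>i\<close> makes it easy to recognize vectors \<open>y\<close> by the functional \<open>x \<mapsto> \<langle>x, y\<rangle>\<close>.
\<close>

definition euler_form :: "dynkin \<Rightarrow> quiver \<Rightarrow> lattice \<Rightarrow> lattice \<Rightarrow> int" where
  "euler_form T Q x y =
     (\<Sum>i\<in>vertices T. x i * (y i - (\<Sum>j\<in>vertices T. if (i, j) \<in> Q then y j else 0)))"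

lemma euler_form_linear_right:
  "euler_form T Q z (\<lambda>j. a * x j + b * y j) = a * euler_form T Q z x + b * euler_form T Q z y"
proof -
  have *: "(\<Sum>j\<in>vertices T. if (i, j) \<in> Q then a * x j + b * y j else 0) =
      a * (\<Sum>j\<in>vertices T. if (i, j) \<in> Q then x j else 0) + b * (\<Sum>j\<in>vertices T. if (i, j) \<in> Q then y j else 0)" for i
    unfolding sum_distrib_left sum.distrib[symmetric] by (intro sum.cong) auto
  show ?thesis
    unfolding euler_form_def *
    by (simp add: sum.distrib sum_distrib_left sum_subtractf algebra_simps)
qed

lemma euler_form_linear_left:
  "euler_form T Q (\<lambda>j. a * x j + b * y j) z = a * euler_form T Q x z + b * euler_form T Q y z"
  unfolding euler_form_def sum_distrib_left[of a] sum_distrib_left[of b] sum.distrib[symmetric]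
  by (intro sum.cong refl) (simp add: distrib_right mult.assoc)

lemma euler_form_sum_right:
  assumes "finite A"
  shows "euler_form T Q z (\<lambda>j. \<Sum>b\<in>A. c b * x b j) = (\<Sum>b\<in>A. c b * euler_form T Q z (x b))"
  using assms
proof (induction A rule: finite_induct)
  case empty
  then show ?case by (simp add: euler_form_def)
next
  case (insert b A)
  have "euler_form T Q z (\<lambda>j. \<Sum>b\<in>insert b A. c b * x b j) =
      euler_form T Q z (\<lambda>j. c b * x b j + 1 * (\<Sum>b\<in>A. c b * x b j))"
    using insert by simp
  also have "\<dots> = c b * euler_form T Q z (x b) + 1 * euler_form T Q z (\<lambda>j. \<Sum>b\<in>A. c b * x b j)"
    by (rule euler_form_linear_right)
  finally show ?case using insert by simp
qed

text \<open>
  The bound expresses positive definiteness and, at the same time, that only finitely many integral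
  vectors have a given norm.  The cuts say that every edge of the graph is a bridge, so that a
  connected graph is a tree; connectedness is stated as an induction principle along edges.
\<close>

locale finite_type =
  fixes T :: dynkin
  assumes edge_vertices:
      "\<And>i j. {i, j} \<in> dynkin_edges T \<Longrightarrow> i \<in> vertices T \<and> j \<in> vertices T \<and> i \<noteq> j"
    and form_bound:
      "\<exists>D. \<forall>v\<in>root_lattice T. \<forall>i. \<bar>v i\<bar> \<le> D * cartan_form T v v"
    and edge_cut:
      "\<And>i j. {i, j} \<in> dynkin_edges T \<Longrightarrow>
         \<exists>S. j \<in> S \<and> i \<notin> S \<and> (\<forall>a b. {a, b} \<in> dynkin_edges T \<and> a \<in> S \<and> b \<notin> S \<longrightarrow> a = j \<and> b = i)"
    and connected:
      "\<And>S i. i \<in> vertices T \<Longrightarrow> i \<in> S \<Longrightarrow>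
         (\<And>a b. {a, b} \<in> dynkin_edges T \<Longrightarrow> a \<in> S \<Longrightarrow> b \<in> S) \<Longrightarrow> vertices T \<subseteq> S"
begin

abbreviation V where "V \<equiv> vertices T"
abbreviation s where "s \<equiv> simple_reflection T"
abbreviation P where "P \<equiv> positive_roots T"

lemma dynkin_quiver_edge:
  assumes "dynkin_quiver T Q"
  shows "{i, j} \<in> dynkin_edges T \<longleftrightarrow> (i, j) \<in> Q \<or> (j, i) \<in> Q" "(i, j) \<in> Q \<Longrightarrow> (j, i) \<notin> Q"
proof -
  have "(a, b) \<in> Q \<Longrightarrow> {a, b} \<in> dynkin_edges T" for a b
    using assms unfolding dynkin_quiver_def by blast
  moreover have "{j, i} = {i, j}" by blast
  moreover have "{a, b} \<in> dynkin_edges T \<Longrightarrow> (a, b) \<in> Q \<longleftrightarrow> (b, a) \<notin> Q" for a b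
    using assms unfolding dynkin_quiver_def by blast
  ultimately show "{i, j} \<in> dynkin_edges T \<longleftrightarrow> (i, j) \<in> Q \<or> (j, i) \<in> Q"
    and "(i, j) \<in> Q \<Longrightarrow> (j, i) \<notin> Q" by metis+
qed

lemma euler_form_symmetrize:
  assumes "dynkin_quiver T Q"
  shows "euler_form T Q x y + euler_form T Q y x = cartan_form T x y"
proof -
  have E: "euler_form T Q x y = (\<Sum>i\<in>V. x i * y i) - (\<Sum>i\<in>V. \<Sum>j\<in>V. if (i, j) \<in> Q then x i * y j else 0)" for x y
    unfolding euler_form_def right_diff_distrib sum_subtractf sum_distrib_left
    by (intro arg_cong2[of _ _ _ _ "(-)"] sum.cong refl) auto
  have "(\<Sum>i\<in>V. \<Sum>j\<in>V. if (i, j) \<in> Q then y i * x j else 0) = (\<Sum>i\<in>V. \<Sum>j\<in>V. if (j, i) \<in> Q then y j * x i else 0)"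
    by (rule sum.swap)
  then have "euler_form T Q x y + euler_form T Q y x = 2 * (\<Sum>i\<in>V. x i * y i)
     - (\<Sum>i\<in>V. \<Sum>j\<in>V. (if (i, j) \<in> Q then x i * y j else 0) + (if (j, i) \<in> Q then y j * x i else 0))"
    unfolding E by (simp add: sum.distrib mult.commute)
  also have "(\<Sum>i\<in>V. \<Sum>j\<in>V. (if (i, j) \<in> Q then x i * y j else 0) + (if (j, i) \<in> Q then y j * x i else 0))
     = (\<Sum>i\<in>V. \<Sum>j\<in>V. if {i, j} \<in> dynkin_edges T then x i * y j else 0)"
    using dynkin_quiver_edge[OF assms] by (intro sum.cong refl) (simp add: mult.commute)
  also have "2 * (\<Sum>i\<in>V. x i * y i) = (\<Sum>i\<in>V. \<Sum>j\<in>V. if i = j then 2 * (x i * y j) else 0)"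
    by (simp add: sum_distrib_left)
  finally have "euler_form T Q x y + euler_form T Q y x =
     (\<Sum>i\<in>V. \<Sum>j\<in>V. (if i = j then 2 * (x i * y j) else 0) - (if {i, j} \<in> dynkin_edges T then x i * y j else 0))"
    by (simp add: sum_subtractf)
  also have "\<dots> = cartan_form T x y"
    unfolding cartan_form_def coroot_pairing_def sum_distrib_left
    using edge_vertices by (intro sum.cong refl) (auto simp: cartan_def)
  finally show ?thesis .
qed

lemma dynkin_quiver_ex: "dynkin_quiver T {(i, j). {i, j} \<in> dynkin_edges T \<and> i < j}"
proof -
  have "{j, i} = {i, j}" for i j :: nat by blast
  moreover have "i < j \<or> j < i" if "{i, j} \<in> dynkin_edges T" for i j
    using edge_vertices[OF that] by auto
  ultimately show ?thesis
    unfolding dynkin_quiver_def by (metis (mono_tags, lifting) case_prodD case_prodI case_prodI2 mem_Collect_eq not_less_iff_gr_or_eq)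
qed

text \<open>
  By the Euler form of any orientation the norm is even, so positivity improves to a lower bound of two.
\<close>

lemma cartan_form_pos:
  assumes "v \<in> root_lattice T" "v \<noteq> (\<lambda>_. 0)"
  shows "cartan_form T v v \<ge> 2"
proof -
  let ?Q = "{(i, j). {i, j} \<in> dynkin_edges T \<and> i < j}"
  have even: "cartan_form T v v = 2 * euler_form T ?Q v v"
    using euler_form_symmetrize[OF dynkin_quiver_ex, of v v] by simp
  obtain D where D: "\<forall>v\<in>root_lattice T. \<forall>i. \<bar>v i\<bar> \<le> D * cartan_form T v v"
    using form_bound by blast
  obtain i where i: "v i \<noteq> 0" using assms(2) by auto
  let ?c = "cartan_form T v v"
  have "D * cartan_form T v v > 0" using D assms(1) i by (metis order_less_le_trans zero_less_abs_iff)
  moreover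
  \<comment> \<open>The bound for twice the vector excludes that the form and the constant are both negative.\<close>
  have "D > 0"
  proof -
    have "V \<noteq> {}" using assms i root_latticeD by blast
    then obtain k where k: "k \<in> V" by blast
    have "cartan_form T (simple_root k) (simple_root k) = 2"
      using k by (simp add: cartan_form_simple_root coroot_pairing_self)
    then have "\<bar>simple_root k k\<bar> \<le> D * 2"
      using D simple_root_in_lattice[OF k] by metis
    then show ?thesis by simp
  qed
  ultimately have "?c > 0" using zero_less_mult_pos by blast
  then show ?thesis using even by simp
qed

section \<open>Roots as vectors of norm two\<close>

text \<open>
  These are all the roots: see \<open>positive_roots_eq\<close>.  Described by the form, they are visibly stable
  under reflections, and their signs can be controlled.
\<close>

definition norm_two_roots :: "lattice set" where
  "norm_two_roots = {v \<in> root_lattice T. cartan_form T v v = 2}"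

lemma simple_root_in_R: "i \<in> V \<Longrightarrow> simple_root i \<in> norm_two_roots"
  by (simp add: norm_two_roots_def simple_root_in_lattice cartan_form_simple_root coroot_pairing_self)

lemma reflection_in_R: "i \<in> V \<Longrightarrow> v \<in> norm_two_roots \<Longrightarrow> s i v \<in> norm_two_roots"
  by (simp add: norm_two_roots_def simple_reflection_in_lattice cartan_form_simple_reflection)

lemma negate_in_R: "v \<in> norm_two_roots \<Longrightarrow> negate v \<in> norm_two_roots"
  by (auto simp: norm_two_roots_def cartan_form_negate) (simp add: negate_def root_lattice_def)

lemma R_nonzero: "v \<in> norm_two_roots \<Longrightarrow> v \<noteq> (\<lambda>_. 0)"
  by (auto simp: norm_two_roots_def cartan_form_def)

lemma finite_R: "finite norm_two_roots"
proof -
  obtain D where D: "\<forall>v\<in>root_lattice T. \<forall>i. \<bar>v i\<bar> \<le> D * cartan_form T v v"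
    using form_bound by blast
  have "norm_two_roots \<subseteq> {f. \<forall>i. (i \<in> V \<longrightarrow> f i \<in> {- (2 * D)..2 * D}) \<and> (i \<notin> V \<longrightarrow> f i = 0)}"
  proof
    fix v assume v: "v \<in> norm_two_roots"
    then have "\<bar>v i\<bar> \<le> D * 2" for i using D by (auto simp: norm_two_roots_def)
    then have "v i \<in> {- (2 * D)..2 * D}" for i by (smt (verit) atLeastAtMost_iff)
    moreover have "i \<notin> V \<longrightarrow> v i = 0" for i using v by (simp add: norm_two_roots_def root_lattice_def)
    ultimately show "v \<in> {f. \<forall>i. (i \<in> V \<longrightarrow> f i \<in> {- (2 * D)..2 * D}) \<and> (i \<notin> V \<longrightarrow> f i = 0)}"
      by blast
  qed
  then show ?thesis
    using finite_set_of_finite_funs[of V "{- (2 * D)..2 * D}" 0] finite_subset by fastforce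
qed

text \<open>
  Otherwise the positive and the negative part are nonzero vectors of norm at least two each, and they pair
  nonpositively because off-diagonal Cartan entries are nonpositive; so the norm would be at least four.
\<close>

lemma R_sign_coherent:
  assumes "v \<in> norm_two_roots"
  shows "(\<forall>i. v i \<ge> 0) \<or> (\<forall>i. v i \<le> 0)"
proof (rule ccontr)
  assume contra: "\<not> ?thesis"
  define p where "p = (\<lambda>i. max (v i) 0)"
  define n where "n = (\<lambda>i. max (- v i) 0)"
  have lat: "p \<in> root_lattice T" "n \<in> root_lattice T"
    using assms by (auto simp: norm_two_roots_def root_lattice_def p_def n_def)
  have nz: "p \<noteq> (\<lambda>_. 0)" "n \<noteq> (\<lambda>_. 0)"
    using contra by (auto simp: p_def n_def fun_eq_iff not_le max_def split: if_splits)
  have v: "v = (\<lambda>i. 1 * p i + (-1) * n i)"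
    by (auto simp: p_def n_def max_def)
  have "cartan_form T v v = cartan_form T p p + cartan_form T n n - 2 * cartan_form T p n"
    using cartan_form_square[of T 1 p "-1" n] unfolding v[symmetric] by simp
  moreover have "cartan_form T p n \<le> 0"
    unfolding cartan_form_def coroot_pairing_def sum_distrib_left
  proof (intro sum_nonpos)
    fix i j
    show "p i * (cartan T i j * n j) \<le> 0"
    proof (cases "i = j")
      case True
      then show ?thesis by (auto simp: p_def n_def max_def)
    next
      case False
      then have "cartan T i j \<le> 0" by (simp add: cartan_def)
      moreover have "p i \<ge> 0" "n j \<ge> 0" by (auto simp: p_def n_def)
      ultimately show ?thesis by (simp add: mult_nonneg_nonpos mult_nonpos_nonneg)
    qed
  qed
  ultimately have "cartan_form T v v \<ge> 4"
    using cartan_form_pos[OF lat(1) nz(1)] cartan_form_pos[OF lat(2) nz(2)] by linarith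
  then show False using assms by (simp add: norm_two_roots_def)
qed

definition nonneg_roots :: "lattice set" where
  "nonneg_roots = {v \<in> norm_two_roots. \<forall>i. v i \<ge> 0}"

lemma R_cases: "v \<in> norm_two_roots \<Longrightarrow> v \<in> nonneg_roots \<or> negate v \<in> nonneg_roots"
  using R_sign_coherent[of v] negate_in_R[of v] by (auto simp: nonneg_roots_def negate_def)

lemma not_both_PR: "v \<in> nonneg_roots \<Longrightarrow> negate v \<notin> nonneg_roots"
proof
  assume "v \<in> nonneg_roots" "negate v \<in> nonneg_roots"
  then have "v = (\<lambda>_. 0)" by (auto simp: nonneg_roots_def negate_def fun_eq_iff intro: antisym)
  then show False using \<open>v \<in> nonneg_roots\<close> R_nonzero by (auto simp: nonneg_roots_def)
qed

lemma PR_if_pos_coeff: "v \<in> norm_two_roots \<Longrightarrow> v i > 0 \<Longrightarrow> v \<in> nonneg_roots"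
  using R_sign_coherent[of v] by (auto simp: nonneg_roots_def) (metis not_le)

lemma simple_root_in_PR: "i \<in> V \<Longrightarrow> simple_root i \<in> nonneg_roots"
  using simple_root_in_R[of i] by (auto simp: nonneg_roots_def simple_root_def)

lemma PR_only_simple:
  assumes "v \<in> nonneg_roots" "\<And>j. j \<noteq> i \<Longrightarrow> v j \<le> 0" "i \<in> V"
  shows "v = simple_root i"
proof -
  have v: "v = (\<lambda>j. v i * simple_root i j + 0 * v j)"
    using assms by (auto simp: nonneg_roots_def simple_root_def fun_eq_iff intro: antisym)
  have "cartan_form T v v = v i * (v i * 2)"
    using cartan_form_square[of T "v i" "simple_root i" 0 v] assms(3) unfolding v[symmetric]
    by (simp add: cartan_form_simple_root coroot_pairing_self)
  moreover have "cartan_form T v v = 2" using assms(1) by (simp add: nonneg_roots_def norm_two_roots_def)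
  ultimately have "v i * v i = 1" by simp
  moreover have "v i \<ge> 0" using assms(1) by (simp add: nonneg_roots_def)
  ultimately have "v i = 1" by (simp add: zmult_eq_1_iff)
  then show ?thesis using v by (auto simp: fun_eq_iff)
qed

text \<open>
  A simple reflection changes one coefficient only, so another positive coefficient survives, and
  sign coherence does the rest.
\<close>

lemma reflection_in_PR:
  assumes "i \<in> V" "v \<in> nonneg_roots" "v \<noteq> simple_root i"
  shows "s i v \<in> nonneg_roots"
proof -
  obtain j where "j \<noteq> i" "v j > 0" using PR_only_simple assms by (metis not_le)
  moreover have "s i v \<in> norm_two_roots" using assms reflection_in_R by (simp add: nonneg_roots_def)
  ultimately show ?thesis using PR_if_pos_coeff[of "s i v" j] by (simp add: simple_reflection_other)
qed

lemma word_action_Nil [simp]: "word_action T [] = id"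
  by (simp add: word_action_def)

lemma word_action_Cons [simp]: "word_action T (i # ws) = s i \<circ> word_action T ws"
  by (simp add: word_action_def)

lemma word_action_append [simp]: "word_action T (us @ ws) = word_action T us \<circ> word_action T ws"
  by (induction us) (auto simp: comp_assoc)

lemma word_action_linear: "linear_map (word_action T ws)"
proof (induction ws)
  case Nil
  then show ?case by (simp add: linear_map_def)
next
  case (Cons i ws)
  then show ?case unfolding word_action_Cons by (intro linear_map_compose simple_reflection_linear)
qed

lemma word_action_in_R: "set ws \<subseteq> V \<Longrightarrow> v \<in> norm_two_roots \<Longrightarrow> word_action T ws v \<in> norm_two_roots"
  by (induction ws) (auto simp: reflection_in_R)

text \<open>
  The norm is the sum of the products of the coefficient at \<open>i\<close> and the pairing with the coroot of \<open>i\<close>, so one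
  of these products is positive.
\<close>

lemma height_descent:
  assumes "v \<in> nonneg_roots" "\<forall>i\<in>V. v \<noteq> simple_root i"
  shows "\<exists>i\<in>V. s i v \<in> nonneg_roots \<and> (\<Sum>j\<in>V. s i v j) < (\<Sum>j\<in>V. v j)"
proof -
  have "cartan_form T v v = 2" using assms by (simp add: nonneg_roots_def norm_two_roots_def)
  then have "\<not> (\<forall>i\<in>V. v i * coroot_pairing T i v \<le> 0)"
    unfolding cartan_form_def using sum_nonpos[of V "\<lambda>i. v i * coroot_pairing T i v"] by force
  then obtain i where i: "i \<in> V" "v i * coroot_pairing T i v > 0" by force
  then have pos: "coroot_pairing T i v > 0"
    using assms(1) by (metis (no_types, lifting) nonneg_roots_def mem_Collect_eq mult_nonneg_nonpos not_le)
  have "(\<Sum>j\<in>V. s i v j) = (\<Sum>j\<in>V. v j) + (- coroot_pairing T i v) * (\<Sum>j\<in>V. simple_root i j)"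
    unfolding simple_reflection_sub by (simp add: sum.distrib sum_distrib_left sum_negf sum_subtractf)
  also have "(\<Sum>j\<in>V. simple_root i j) = 1"
    using i(1) by (simp add: simple_root_def)
  finally show ?thesis
    using pos i(1) reflection_in_PR[OF i(1) assms(1)] assms(2) by auto
qed

lemma weyl_groupE:
  assumes "w \<in> weyl_group T" obtains ws where "set ws \<subseteq> V" "w = word_action T ws"
  using assms by (auto simp: weyl_group_def)

text \<open>
  Descending in height by simple reflections ends at a simple root.
\<close>

lemma PR_subset_roots: "v \<in> nonneg_roots \<Longrightarrow> v \<in> roots T"
proof (induction "nat (\<Sum>j\<in>V. v j)" arbitrary: v rule: less_induct)
  case less
  show ?case
  proof (cases "\<exists>i\<in>V. v = simple_root i")
    case True
    then show ?thesis
      unfolding roots_def weyl_group_def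
      by (auto intro!: exI[of _ "[]"] exI[of _ id])
  next
    case False
    then obtain i where i: "i \<in> V" "s i v \<in> nonneg_roots" "(\<Sum>j\<in>V. s i v j) < (\<Sum>j\<in>V. v j)"
      using height_descent[OF less.prems] by blast
    have "(\<Sum>j\<in>V. s i v j) \<ge> 0" using i(2) by (auto simp: nonneg_roots_def intro: sum_nonneg)
    then have "s i v \<in> roots T" using less.hyps[OF _ i(2)] i(3) by simp
    then obtain ws j where ws: "set ws \<subseteq> V" "j \<in> V" "s i v = word_action T ws (simple_root j)"
      by (auto simp: roots_def weyl_group_def)
    then have "v = word_action T (i # ws) (simple_root j)"
      using i(1) by (metis comp_apply simple_reflection_invol word_action_Cons)
    moreover have "set (i # ws) \<subseteq> V" using i ws by simp
    ultimately show ?thesis using ws(2) unfolding roots_def weyl_group_def by blast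
  qed
qed

lemma positive_roots_eq: "P = nonneg_roots"
proof
  show "P \<subseteq> nonneg_roots"
    unfolding positive_roots_def roots_def nonneg_roots_def weyl_group_def
    using word_action_in_R simple_root_in_R by auto
  show "nonneg_roots \<subseteq> P"
    unfolding positive_roots_def using PR_subset_roots by (auto simp: nonneg_roots_def)
qed

lemma positive_root_in_R: "v \<in> P \<Longrightarrow> v \<in> norm_two_roots"
  by (simp add: positive_roots_eq nonneg_roots_def)

lemma positive_root_in_lattice: "v \<in> P \<Longrightarrow> v \<in> root_lattice T"
  by (simp add: positive_roots_eq nonneg_roots_def norm_two_roots_def)

lemma positive_root_nonneg: "v \<in> P \<Longrightarrow> v i \<ge> 0"
  by (simp add: positive_roots_eq nonneg_roots_def)

lemmas root_cases = R_cases[folded positive_roots_eq]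
lemmas not_both_positive = not_both_PR[folded positive_roots_eq]
lemmas positive_if_pos_coeff = PR_if_pos_coeff[folded positive_roots_eq]
lemmas simple_root_positive = simple_root_in_PR[folded positive_roots_eq]
lemmas reflection_positive = reflection_in_PR[folded positive_roots_eq]

lemma finite_P [simp]: "finite P"
  using finite_R by (auto simp: positive_roots_eq nonneg_roots_def)

end

section \<open>Words, inversions and the longest element\<close>

text \<open>
  The roots \<open>\<beta>\<^sub>k\<close> of a word in their order, by recursion on the first letter; see \<open>root_list_nth\<close>.
\<close>

primrec root_list :: "dynkin \<Rightarrow> nat list \<Rightarrow> lattice list" where
  "root_list T [] = []"
| "root_list T (i # ws) = simple_root i # map (simple_reflection T i) (root_list T ws)"

lemma length_root_list [simp]: "length (root_list T ws) = length ws"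
  by (induction ws) auto

context finite_type
begin

abbreviation W where "W \<equiv> word_action T"
abbreviation rl where "rl \<equiv> root_list T"

lemma root_list_append: "rl (us @ ws) = rl us @ map (W us) (rl ws)"
  by (induction us) auto

lemma root_list_nth: "n < length ws \<Longrightarrow> rl ws ! n = root_of_word T ws n"
proof (induction ws arbitrary: n)
  case (Cons i ws)
  then show ?case by (cases n) (auto simp: root_of_word_def)
qed simp

lemma word_action_rev: "set ws \<subseteq> V \<Longrightarrow> W (rev ws) (W ws v) = v"
  by (induction ws arbitrary: v) auto

lemma word_action_rev': "set ws \<subseteq> V \<Longrightarrow> W ws (W (rev ws) v) = v"
  using word_action_rev[of "rev ws" v] by simp

lemma word_action_inject: "set ws \<subseteq> V \<Longrightarrow> W ws u = W ws v \<longleftrightarrow> u = v"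
  using word_action_rev by metis

lemma word_action_negate: "W ws (negate v) = negate (W ws v)"
  by (rule linear_map_negate[OF word_action_linear])

lemma word_action_other: "i \<notin> set ws \<Longrightarrow> W ws v i = v i"
  by (induction ws arbitrary: v) (auto simp: simple_reflection_other)

lemma word_action_in_lattice: "set ws \<subseteq> V \<Longrightarrow> v \<in> root_lattice T \<Longrightarrow> W ws v \<in> root_lattice T"
  by (induction ws) (auto simp: simple_reflection_in_lattice)

lemma negate_root_cases:
  assumes "set ws \<subseteq> V" "v \<in> P"
  shows "W ws v \<in> P \<longleftrightarrow> negate (W ws v) \<notin> P"
  using assms word_action_in_R[OF assms(1) positive_root_in_R[OF assms(2)]] root_cases not_both_positive
  by blast

text \<open>
  These are the reduced words: see \<open>reduced_expression_iff\<close>.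
\<close>

definition positive_word :: "nat list \<Rightarrow> bool" where
  "positive_word ws \<longleftrightarrow> set ws \<subseteq> V \<and> set (rl ws) \<subseteq> P"

lemma positive_word_vertices: "positive_word ws \<Longrightarrow> set ws \<subseteq> V"
  by (simp add: positive_word_def)

lemma positive_word_append: "positive_word (us @ ws) \<Longrightarrow> positive_word us"
  by (auto simp: positive_word_def root_list_append)

lemma positive_word_snoc:
  "positive_word (us @ [i]) \<longleftrightarrow> positive_word us \<and> i \<in> V \<and> W us (simple_root i) \<in> P"
  by (auto simp: positive_word_def root_list_append)

text \<open>
  Appending the letter \<open>i\<close> applies \<open>s\<^sub>i\<close> to the pulled back roots, and among positive roots it changes
  the sign of \<open>\<alpha>\<^sub>i\<close> only.  So each letter adds its own root, and no other, to the set of inversions.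
\<close>

lemma positive_word_inversions:
  assumes "positive_word ws"
  shows "distinct (rl ws) \<and> (\<forall>v\<in>P. W (rev ws) v \<in> P \<longleftrightarrow> v \<notin> set (rl ws))"
  using assms
proof (induction ws rule: rev_induct)
  case (snoc i us)
  then have us: "positive_word us" and i: "i \<in> V" "W us (simple_root i) \<in> P"
    by (auto simp: positive_word_snoc)
  note IH = snoc.IH[OF us]
  have usV: "set us \<subseteq> V" using us by (rule positive_word_vertices)
  let ?b = "W us (simple_root i)"
  have b: "W (rev us) ?b = simple_root i" using word_action_rev usV by simp
  then have bn: "?b \<notin> set (rl us)" using IH i simple_root_positive by auto
  have "W (rev (us @ [i])) v \<in> P \<longleftrightarrow> v \<notin> set (rl (us @ [i]))" if v: "v \<in> P" for v
  proof -
    let ?y = "W (rev us) v"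
    have yR: "?y \<in> norm_two_roots" using word_action_in_R usV positive_root_in_R[OF v] by simp
    have vy: "W us ?y = v" using usV word_action_rev' by simp
    have act: "W (rev (us @ [i])) v = s i ?y" by simp
    show ?thesis
    proof (cases "v \<in> set (rl us)")
      case True
      then have "?y \<notin> P" using IH v by auto
      then have ny: "negate ?y \<in> P" using yR root_cases by blast
      have "negate ?y \<noteq> simple_root i"
      proof
        assume "negate ?y = simple_root i"
        then have "?b = negate v" using vy word_action_negate[of us ?y] by simp
        then show False using i(2) v not_both_positive by simp
      qed
      then have "s i (negate ?y) \<in> P" using reflection_positive[OF i(1) ny] by simp
      then have "negate (s i ?y) \<in> P" using linear_map_negate[OF simple_reflection_linear] by simp
      then show ?thesis using True act not_both_positive[of "s i ?y"] by (auto simp: root_list_append)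
    next
      case False
      then have y: "?y \<in> P" using IH v by auto
      have "s i ?y \<in> P \<longleftrightarrow> ?y \<noteq> simple_root i"
        using reflection_positive[OF i(1) y] simple_reflection_simple_root[OF i(1)]
          not_both_positive[OF simple_root_positive[OF i(1)]] by auto
      also have "\<dots> \<longleftrightarrow> v \<noteq> ?b" using vy b by auto
      finally show ?thesis using act False by (simp add: root_list_append)
    qed
  qed
  then show ?case using IH bn by (simp add: root_list_append)
qed simp

lemma positive_word_distinct: "positive_word ws \<Longrightarrow> distinct (rl ws)"
  using positive_word_inversions by blast

lemma positive_word_set: "positive_word ws \<Longrightarrow> set (rl ws) = {v \<in> P. W (rev ws) v \<notin> P}"
  using positive_word_inversions by (auto simp: positive_word_def)

lemma positive_word_length: "positive_word ws \<Longrightarrow> length ws = card {v \<in> P. W (rev ws) v \<notin> P}"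
  using distinct_card[OF positive_word_distinct, of ws] by (simp add: positive_word_set)

lemma positive_word_length_le: "positive_word ws \<Longrightarrow> length ws \<le> card P"
  by (simp add: positive_word_length card_mono)

lemma positive_word_length_cong:
  assumes "positive_word us" "positive_word ws" "W us = W ws"
  shows "set (rl us) = set (rl ws)" "length us = length ws"
proof -
  have V: "set us \<subseteq> V" "set ws \<subseteq> V" using assms positive_word_vertices by auto
  have "W (rev us) = W (rev ws)"
  proof
    fix x show "W (rev us) x = W (rev ws) x"
      using word_action_rev[OF V(1), of "W (rev ws) x"] assms(3) word_action_rev'[OF V(2)] by simp
  qed
  then show "set (rl us) = set (rl ws)" "length us = length ws"
    using assms positive_word_set positive_word_length by simp_all
qed

text \<open>
  If the next root is not positive, its negative is an inversion and hence the root of an earlier letter.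
  This letter and the new one then cancel.
\<close>

lemma deletion:
  assumes "positive_word us" "i \<in> V" "W us (simple_root i) \<notin> P"
  shows "\<exists>vs. set vs \<subseteq> V \<and> length vs < length us \<and> W vs = W (us @ [i])"
proof -
  have usV: "set us \<subseteq> V" using assms(1) by (rule positive_word_vertices)
  let ?b = "W us (simple_root i)"
  have nb: "negate ?b \<in> P"
    using negate_root_cases[OF usV simple_root_positive[OF assms(2)]] assms(3) by blast
  have "W (rev us) (negate ?b) = negate (simple_root i)"
    using word_action_rev[OF usV] word_action_negate by simp
  then have "negate ?b \<in> set (rl us)"
    using positive_word_inversions[OF assms(1)] nb not_both_positive simple_root_positive[OF assms(2)] by auto
  then obtain n where n: "n < length us" "rl us ! n = negate ?b" by (auto simp: in_set_conv_nth)
  define u1 u2 j where "u1 = take n us" and "u2 = drop (Suc n) us" and "j = us ! n"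
  have us: "us = u1 @ [j] @ u2" using n(1) id_take_nth_drop by (simp add: u1_def u2_def j_def)
  have V: "set u1 \<subseteq> V" "j \<in> V" "set u2 \<subseteq> V" using usV us by auto
  have "W u1 (simple_root j) = negate ?b"
    using n root_list_nth by (simp add: root_of_word_def u1_def j_def)
  also have "\<dots> = W u1 (negate (s j (W u2 (simple_root i))))"
    by (simp add: us word_action_negate)
  finally have "simple_root j = s j (negate (W u2 (simple_root i)))"
    using word_action_inject V(1) linear_map_negate[OF simple_reflection_linear] by metis
  then have "s j (simple_root j) = negate (W u2 (simple_root i))" using V(2) by simp
  then have ji: "W u2 (simple_root i) = simple_root j"
    using simple_reflection_simple_root V(2) by (metis negate_negate)
  \<comment> \<open>The reflections in two roots that correspond under an element are conjugate by it.\<close>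
  have conj: "W u2 (s i v) = s j (W u2 v)" for v
  proof -
    have form: "cartan_form T (W u2 x) (W u2 y) = cartan_form T x y" for x y
      using V(3) by (induction u2 arbitrary: x y) (auto simp: cartan_form_simple_reflection)
    have "coroot_pairing T j (W u2 v) = coroot_pairing T i v"
      using form[of "simple_root i" v] ji V(2) assms(2) by (simp add: cartan_form_simple_root)
    then show ?thesis
      unfolding simple_reflection_sub[of T i v] simple_reflection_sub[of T j "W u2 v"]
        linear_mapD[OF word_action_linear] ji by simp
  qed
  have "W (us @ [i]) = W (u1 @ u2)"
  proof
    fix v
    have "W (us @ [i]) v = W u1 (s j (W u2 (s i v)))" by (simp add: us)
    also have "\<dots> = W (u1 @ u2) v" using V(2) by (simp add: conj)
    finally show "W (us @ [i]) v = W (u1 @ u2) v" .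
  qed
  then show ?thesis using V us by (intro exI[of _ "u1 @ u2"]) auto
qed

text \<open>
  Words can be shortened by deletions until all their roots are positive.
\<close>

lemma positive_word_exists:
  assumes "set ws \<subseteq> V"
  shows "\<exists>us. positive_word us \<and> W us = W ws \<and> (positive_word ws \<or> length us < length ws)"
  using assms
proof (induction "length ws" arbitrary: ws rule: less_induct)
  case less
  show ?case
  proof (cases ws rule: rev_exhaust)
    case Nil
    then show ?thesis by (intro exI[of _ "[]"]) (simp add: positive_word_def)
  next
    case (snoc vs i)
    have vs: "set vs \<subseteq> V" "i \<in> V" using less.prems snoc by auto
    obtain us where us: "positive_word us" "W us = W vs" "positive_word vs \<or> length us < length vs"
      using less.hyps[of vs] vs snoc by auto
    have usV: "set us \<subseteq> V" using us(1) positive_word_vertices by blast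
    have act: "W (us @ [i]) = W ws" using us(2) snoc by simp
    show ?thesis
    proof (cases "W us (simple_root i) \<in> P")
      case True
      show ?thesis
      proof (cases "positive_word vs")
        case True
        then have "positive_word ws" using \<open>W us (simple_root i) \<in> P\<close> us(2) vs snoc by (simp add: positive_word_snoc)
        then show ?thesis by blast
      next
        case False
        have "positive_word (us @ [i])" using us(1) vs(2) \<open>W us (simple_root i) \<in> P\<close> by (simp add: positive_word_snoc)
        moreover have "length (us @ [i]) < length ws" using False us(3) snoc by simp
        ultimately show ?thesis using act by blast
      qed
    next
      case False
      then obtain v' where v': "set v' \<subseteq> V" "length v' < length us" "W v' = W (us @ [i])"
        using deletion[OF us(1) vs(2)] by blast
      have "length us \<le> length vs"
        using us(3) positive_word_length_cong(2)[OF us(1) _ us(2)] by auto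
      then have l: "length v' < length ws" using v'(2) snoc by simp
      obtain u' where "positive_word u'" "W u' = W v'" "positive_word v' \<or> length u' < length v'"
        using less.hyps[OF l v'(1)] by blast
      then show ?thesis using l v'(3) act by (cases "positive_word v'") auto
    qed
  qed
qed

lemma weyl_length_positive_word:
  assumes "positive_word ws"
  shows "weyl_length T (W ws) = length ws"
  unfolding weyl_length_def
proof (rule Least_equality)
  show "\<exists>us. set us \<subseteq> V \<and> length us = length ws \<and> W us = W ws"
    using assms positive_word_vertices by blast
next
  fix n assume "\<exists>us. set us \<subseteq> V \<and> length us = n \<and> W us = W ws"
  then obtain us where us: "set us \<subseteq> V" "length us = n" "W us = W ws" by blast
  obtain vs where vs: "positive_word vs" "W vs = W us" "positive_word us \<or> length vs < length us"
    using positive_word_exists[OF us(1)] by blast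
  then show "length ws \<le> n"
    using positive_word_length_cong[OF assms, of vs] positive_word_length_cong[OF assms, of us] us by auto
qed

lemma reduced_expression_iff: "reduced_expression T w ws \<longleftrightarrow> positive_word ws \<and> W ws = w"
proof
  assume r: "reduced_expression T w ws"
  then have ws: "set ws \<subseteq> V" "W ws = w" "length ws = weyl_length T w"
    by (auto simp: reduced_expression_def)
  obtain us where us: "positive_word us" "W us = W ws" "positive_word ws \<or> length us < length ws"
    using positive_word_exists[OF ws(1)] by blast
  have "length us = weyl_length T w" using weyl_length_positive_word[OF us(1)] us(2) ws(2) by simp
  then show "positive_word ws \<and> W ws = w" using us(3) ws by auto
qed (auto simp: reduced_expression_def positive_word_vertices weyl_length_positive_word)

text \<open>
  These are the reduced words of the longest element: see \<open>reduced_longest_iff\<close>.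
\<close>

definition full_word :: "nat list \<Rightarrow> bool" where
  "full_word ws \<longleftrightarrow> positive_word ws \<and> set (rl ws) = P"

lemma full_word_positive: "full_word ws \<Longrightarrow> positive_word ws"
  by (simp add: full_word_def)

lemma full_word_vertices: "full_word ws \<Longrightarrow> set ws \<subseteq> V"
  by (simp add: full_word_def positive_word_def)

lemma full_word_iff: "full_word ws \<longleftrightarrow> positive_word ws \<and> length ws = card P"
proof (cases "positive_word ws")
  case True
  then have "set (rl ws) \<subseteq> P" "card (set (rl ws)) = length ws"
    using distinct_card[OF positive_word_distinct] by (auto simp: positive_word_def)
  then show ?thesis using True card_subset_eq[OF finite_P, of "set (rl ws)"]
    by (metis full_word_def)
qed (simp add: full_word_def)

lemma full_word_rev_negative:
  assumes "full_word ws" "v \<in> P"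
  shows "negate (W (rev ws) v) \<in> P"
proof -
  have "W (rev ws) v \<notin> P"
    using positive_word_set[of ws] assms by (auto simp: full_word_def)
  then show ?thesis using negate_root_cases[of "rev ws" v] full_word_vertices[OF assms(1)] assms(2) by simp
qed

lemma full_word_rev_image:
  assumes "full_word ws"
  shows "(\<lambda>v. negate (W (rev ws) v)) ` P = P"
proof (rule card_subset_eq[OF finite_P])
  show "(\<lambda>v. negate (W (rev ws) v)) ` P \<subseteq> P" using full_word_rev_negative[OF assms] by blast
  have "inj_on (\<lambda>v. negate (W (rev ws) v)) P"
    using word_action_inject[of "rev ws"] full_word_vertices[OF assms]
    by (intro inj_onI) (metis negate_negate set_rev)
  then show "card ((\<lambda>v. negate (W (rev ws) v)) ` P) = card P" by (rule card_image)
qed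

lemma full_word_negative:
  assumes "full_word ws" "v \<in> P"
  shows "negate (W ws v) \<in> P"
proof -
  obtain u where u: "u \<in> P" "v = negate (W (rev ws) u)"
    using full_word_rev_image[OF assms(1)] assms(2) by blast
  have "W ws v = negate u"
    using u(2) word_action_negate word_action_rev'[OF full_word_vertices[OF assms(1)]] by simp
  then show ?thesis using u by simp
qed

text \<open>
  Both elements exchange the positive and the negative roots, so the quotient has no inversions, and
  a positive word that represents it is empty.
\<close>

lemma full_word_action_cong:
  assumes "full_word us" "full_word ws"
  shows "W us = W ws"
proof -
  have V: "set us \<subseteq> V" "set ws \<subseteq> V" using assms full_word_vertices by auto
  define g where "g = rev us @ ws"
  obtain vs where vs: "positive_word vs" "W vs = W g"
    using positive_word_exists[of g] V by (auto simp: g_def)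
  have vsV: "set vs \<subseteq> V" using vs(1) positive_word_vertices by blast
  have "W (rev vs) v \<in> P" if v: "v \<in> P" for v
  proof -
    have "W (rev vs) v = W (rev ws) (W us v)"
      using word_action_rev[OF vsV, of "W (rev ws) (W us v)"] vs(2)
        word_action_rev'[OF V(2)] word_action_rev[OF V(1)] by (simp add: g_def)
    moreover have "W (rev ws) (W us v) = negate (W (rev ws) (negate (W us v)))"
      by (simp add: word_action_negate)
    ultimately show ?thesis
      using full_word_rev_negative[OF assms(2) full_word_negative[OF assms(1) v]] by simp
  qed
  then have "set (rl vs) = {}" using positive_word_set[OF vs(1)] by auto
  then have "vs = []" by (cases vs) auto
  then have "W g = id" using vs(2) by simp
  then have "W (rev us) (W ws x) = x" for x by (simp add: g_def fun_eq_iff)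
  then have "W ws x = W us x" for x using word_action_rev'[OF V(1), of "W ws x"] by simp
  then show ?thesis by (simp add: fun_eq_iff)
qed

text \<open>
  A positive root is a nonnegative combination of simple roots, so the element makes all positive
  roots negative.
\<close>

lemma all_simple_negative_imp_full:
  assumes "positive_word ws" "\<And>i. i \<in> V \<Longrightarrow> W ws (simple_root i) \<notin> P"
  shows "full_word ws"
proof -
  have V: "set ws \<subseteq> V" using assms(1) positive_word_vertices by blast
  have neg: "W ws v \<notin> P" if v: "v \<in> P" for v
  proof -
    have "W ws v j \<le> 0" for j
    proof -
      have "W ws v j = (\<Sum>i\<in>V. v i * W ws (simple_root i) j)"
        using linear_map_sum[OF word_action_linear, of V ws v simple_root]
          root_lattice_expansion[OF positive_root_in_lattice[OF v]] by simp
      also have "\<dots> \<le> 0"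
      proof (intro sum_nonpos)
        fix i assume i: "i \<in> V"
        have "negate (W ws (simple_root i)) \<in> P"
          using negate_root_cases[OF V simple_root_positive[OF i]] assms(2)[OF i] by blast
        from positive_root_nonneg[OF this, of j] positive_root_nonneg[OF v, of i]
        show "v i * W ws (simple_root i) j \<le> 0" by (simp add: negate_def mult_nonneg_nonpos)
      qed
      finally show ?thesis .
    qed
    then show ?thesis
      using not_both_positive root_cases[OF word_action_in_R[OF V positive_root_in_R[OF v]]]
        positive_root_nonneg[of "W ws v"] R_nonzero[OF word_action_in_R[OF V positive_root_in_R[OF v]]]
      by (auto simp: fun_eq_iff intro: antisym)
  qed
  have "negate ` (W ws ` P) \<subseteq> P"
    using neg negate_root_cases[OF V] by blast
  moreover have "card (negate ` (W ws ` P)) = card P"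
    unfolding image_image using word_action_inject[OF V]
    by (intro card_image inj_onI) (metis negate_negate)
  ultimately have im: "negate ` (W ws ` P) = P" by (metis card_subset_eq finite_P)
  have "v \<in> set (rl ws)" if v: "v \<in> P" for v
  proof -
    obtain u where "u \<in> P" "v = negate (W ws u)" using im v by blast
    then have "W (rev ws) v = negate u" using word_action_rev[OF V] word_action_negate by simp
    then have "W (rev ws) v \<notin> P" using \<open>u \<in> P\<close> not_both_positive by simp
    then show ?thesis using positive_word_set[OF assms(1)] v by blast
  qed
  then show ?thesis using assms(1) by (auto simp: full_word_def positive_word_def)
qed

lemma positive_word_extend:
  assumes "positive_word ws"
  shows "\<exists>us. full_word (ws @ us)"
  using assms
proof (induction "card P - length ws" arbitrary: ws rule: less_induct)
  case less
  show ?case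
  proof (cases "full_word ws")
    case True
    then show ?thesis by (intro exI[of _ "[]"]) simp
  next
    case False
    then obtain i where i: "i \<in> V" "W ws (simple_root i) \<in> P"
      using all_simple_negative_imp_full[OF less.prems] by blast
    then have pos: "positive_word (ws @ [i])" using less.prems by (simp add: positive_word_snoc)
    have "length (ws @ [i]) \<le> card P" using positive_word_length_le[OF pos] .
    then have "card P - length (ws @ [i]) < card P - length ws" by simp
    then obtain us where "full_word ((ws @ [i]) @ us)" using less.hyps[OF _ pos] by blast
    then show ?thesis by (intro exI[of _ "i # us"]) simp
  qed
qed

lemma longest_element_eq:
  assumes "full_word ws"
  shows "longest_element T = W ws"
  unfolding longest_element_def
proof (rule the_equality)
  have len: "weyl_length T (W ws) = card P"
    using weyl_length_positive_word assms by (simp add: full_word_iff)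
  have le: "weyl_length T w \<le> card P" if "w \<in> weyl_group T" for w
    using that positive_word_exists weyl_length_positive_word positive_word_length_le
    by (metis weyl_groupE)
  show "W ws \<in> weyl_group T \<and> (\<forall>v\<in>weyl_group T. weyl_length T v \<le> weyl_length T (W ws))"
    using len le full_word_vertices[OF assms] by (auto simp: weyl_group_def)
  fix w assume w: "w \<in> weyl_group T \<and> (\<forall>v\<in>weyl_group T. weyl_length T v \<le> weyl_length T w)"
  moreover have "W ws \<in> weyl_group T" using full_word_vertices[OF assms] by (auto simp: weyl_group_def)
  ultimately have "card P \<le> weyl_length T w" using len by metis
  then have lw: "weyl_length T w = card P" using le w by (simp add: antisym)
  obtain us where us: "positive_word us" "W us = w"
    using w positive_word_exists by (metis weyl_groupE)
  then have "full_word us" using lw weyl_length_positive_word[OF us(1)] by (simp add: full_word_iff)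
  then show "w = W ws" using us full_word_action_cong assms by blast
qed

lemma full_word_exists: "\<exists>ws. full_word ws"
  using positive_word_extend[of "[]"] by (auto simp: positive_word_def)

lemma reduced_longest_iff: "reduced_expression T (longest_element T) ws \<longleftrightarrow> full_word ws"
proof
  assume r: "reduced_expression T (longest_element T) ws"
  obtain us where us: "full_word us" using full_word_exists by blast
  then have "positive_word ws" "W ws = W us"
    using r longest_element_eq by (auto simp: reduced_expression_iff)
  then show "full_word ws"
    using us positive_word_length_cong(2)[OF _ full_word_positive[OF us]] by (simp add: full_word_iff)
qed (auto simp: reduced_expression_iff longest_element_eq full_word_positive)

lemma adapted_class_iff: "ws \<in> adapted_class T Q \<longleftrightarrow> full_word ws \<and> adapted Q ws"
  by (simp add: adapted_class_def reduced_longest_iff)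

text \<open>
  With \<open>w = s\<^sub>1\<cdots>s\<^sub>N\<close>, the root \<open>s\<^sub>N\<cdots>s\<^sub>k\<^sub>+\<^sub>1(\<alpha>\<^sub>k)\<close> of the reversed word equals
  \<open>- w\<^sup>-\<^sup>1(s\<^sub>1\<cdots>s\<^sub>k\<^sub>-\<^sub>1(\<alpha>\<^sub>k))\<close>.
\<close>

lemma root_list_rev:
  "set ws \<subseteq> V \<Longrightarrow> rl (rev ws) = rev (map (\<lambda>v. negate (W (rev ws) v)) (rl ws))"
proof (induction ws)
  case (Cons i ws)
  have "negate (W (rev (i # ws)) (simple_root i)) = W (rev ws) (simple_root i)"
    using Cons.prems by (simp add: simple_reflection_simple_root word_action_negate)
  moreover have "map (\<lambda>v. negate (W (rev (i # ws)) v)) (map (s i) (rl ws)) =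
      map (\<lambda>v. negate (W (rev ws) v)) (rl ws)"
    using Cons.prems by simp
  ultimately have "rev (map (\<lambda>v. negate (W (rev (i # ws)) v)) (rl (i # ws))) =
      rev (map (\<lambda>v. negate (W (rev ws) v)) (rl ws)) @ [W (rev ws) (simple_root i)]"
    by simp
  then show ?case using Cons by (simp add: root_list_append)
qed simp

lemma full_word_rev: 
  assumes "full_word ws"
  shows "full_word (rev ws)"
proof -
  have V: "set ws \<subseteq> V" using full_word_vertices assms by blast
  have "set (rl (rev ws)) = (\<lambda>v. negate (W (rev ws) v)) ` P"
    using root_list_rev[OF V] assms by (simp add: full_word_def)
  then have "set (rl (rev ws)) = P" using full_word_rev_image[OF assms] by simp
  then show ?thesis using V by (simp add: full_word_def positive_word_def)
qed

text \<open>
  A word without the letter \<open>i\<close> fixes all coefficients at \<open>i\<close>, whereas the longest element makes that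
  of \<open>\<alpha>\<^sub>i\<close> nonpositive.
\<close>

lemma mem_full_word:
  assumes "full_word ws" "i \<in> V"
  shows "i \<in> set ws"
proof (rule ccontr)
  assume "i \<notin> set ws"
  then have "W ws (simple_root i) i = 1" using word_action_other by simp
  moreover have "negate (W ws (simple_root i)) i \<ge> 0"
    using positive_root_nonneg full_word_negative[OF assms(1) simple_root_positive[OF assms(2)]] by blast
  ultimately show False by (simp add: negate_def)
qed

lemma positive_word_tl:
  assumes "positive_word (i # us)"
  shows "positive_word us"
proof -
  have i: "i \<in> V" "set us \<subseteq> V" using assms by (auto simp: positive_word_def)
  have "v \<in> P" if v: "v \<in> set (rl us)" for v
  proof -
    have sv: "s i v \<in> P" using assms v by (auto simp: positive_word_def)
    have "s i v \<noteq> simple_root i"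
      using positive_word_distinct[OF assms] image_eqI[OF _ v, of "simple_root i" "s i"] by auto
    then show ?thesis using reflection_positive[OF i(1) sv] i(1) by simp
  qed
  then show ?thesis using i by (auto simp: positive_word_def)
qed

end

section \<open>Height functions\<close>

definition lower :: "nat \<Rightarrow> (nat \<Rightarrow> int) \<Rightarrow> nat \<Rightarrow> int" where
  "lower i \<eta> = \<eta>(i := \<eta> i - 2)"

text \<open>
  The height function of the quiver after reflecting at the letters of a word adapted to \<open>\<eta>\<close>.
\<close>

definition final_height :: "(nat \<Rightarrow> int) \<Rightarrow> nat list \<Rightarrow> nat \<Rightarrow> int" where
  "final_height \<eta> ws = (\<lambda>i. \<eta> i - 2 * int (count_list ws i))"

lemma final_height_Nil [simp]: "final_height \<eta> [] = \<eta>"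
  by (simp add: final_height_def)

lemma final_height_Cons [simp]: "final_height \<eta> (i # ws) = final_height (lower i \<eta>) ws"
  by (auto simp: final_height_def lower_def)

lemma final_height_append: "final_height \<eta> (us @ ws) = final_height (final_height \<eta> us) ws"
  by (auto simp: final_height_def)

lemma lower_commute: "lower i (lower j \<eta>) = lower j (lower i \<eta>)"
  by (auto simp: lower_def)

context finite_type
begin

text \<open>
  Orientations are encoded by functions on the vertices, so that a reflection at a source becomes a
  subtraction and quivers connected by reflections can be compared pointwise.
\<close>

definition height :: "(nat \<Rightarrow> int) \<Rightarrow> bool" where
  "height \<eta> \<longleftrightarrow> (\<forall>i j. {i, j} \<in> dynkin_edges T \<longrightarrow> \<bar>\<eta> i - \<eta> j\<bar> = 1)"

definition quiver_of :: "(nat \<Rightarrow> int) \<Rightarrow> quiver" where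
  "quiver_of \<eta> = {(i, j). {i, j} \<in> dynkin_edges T \<and> \<eta> i = \<eta> j + 1}"

abbreviation adp where "adp \<eta> ws \<equiv> adapted (quiver_of \<eta>) ws"
abbreviation source where "source \<eta> i \<equiv> is_source (quiver_of \<eta>) i"
abbreviation E where "E \<eta> \<equiv> euler_form T (quiver_of \<eta>)"

lemma height_edge: "height \<eta> \<Longrightarrow> {i, j} \<in> dynkin_edges T \<Longrightarrow> \<bar>\<eta> i - \<eta> j\<bar> = 1"
  by (simp add: height_def)

lemma edge_sym: "{i, j} \<in> dynkin_edges T \<longleftrightarrow> {j, i} \<in> dynkin_edges T"
  by (simp add: insert_commute)

lemma dynkin_quiver_of: "height \<eta> \<Longrightarrow> dynkin_quiver T (quiver_of \<eta>)"
  unfolding dynkin_quiver_def quiver_of_def height_def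
  by (auto simp: insert_commute) fastforce

lemma quiver_of_height_function:
  assumes "dynkin_quiver T Q" "height_function Q \<xi>"
  shows "height \<xi>" "Q = quiver_of \<xi>"
proof -
  have h: "(i, j) \<in> Q \<Longrightarrow> \<xi> j = \<xi> i - 1" for i j
    using assms(2) by (auto simp: height_function_def)
  show "height \<xi>"
    unfolding height_def using dynkin_quiver_edge[OF assms(1)] h by fastforce
  show "Q = quiver_of \<xi>"
    unfolding quiver_of_def using dynkin_quiver_edge[OF assms(1)] h by fastforce
qed

lemma source_iff:
  assumes "height \<eta>"
  shows "source \<eta> i \<longleftrightarrow> (\<forall>j. {i, j} \<in> dynkin_edges T \<longrightarrow> \<eta> j = \<eta> i - 1)"
proof
  assume src: "source \<eta> i"
  show "\<forall>j. {i, j} \<in> dynkin_edges T \<longrightarrow> \<eta> j = \<eta> i - 1"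
  proof (intro allI impI)
    fix j assume e: "{i, j} \<in> dynkin_edges T"
    then have "\<eta> j \<noteq> \<eta> i + 1" using src edge_sym[of i j] by (auto simp: is_source_def quiver_of_def)
    then show "\<eta> j = \<eta> i - 1" using assms e unfolding height_def by (smt (verit))
  qed
next
  assume "\<forall>j. {i, j} \<in> dynkin_edges T \<longrightarrow> \<eta> j = \<eta> i - 1"
  then show "source \<eta> i" using edge_sym[of i] by (force simp: is_source_def quiver_of_def)
qed

lemma height_lower:
  assumes "height \<eta>" "source \<eta> i"
  shows "height (lower i \<eta>)"
  unfolding height_def
proof (intro allI impI)
  fix a b assume e: "{a, b} \<in> dynkin_edges T"
  then have "a \<noteq> b" "\<bar>\<eta> a - \<eta> b\<bar> = 1" using edge_vertices assms(1) unfolding height_def by blast+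
  moreover have "a = i \<Longrightarrow> \<eta> b = \<eta> a - 1" "b = i \<Longrightarrow> \<eta> a = \<eta> b - 1"
    using assms source_iff e edge_sym[of a b] by auto
  ultimately show "\<bar>lower i \<eta> a - lower i \<eta> b\<bar> = 1" by (auto simp: lower_def)
qed

lemma reverse_at_quiver_of:
  assumes "height \<eta>" "source \<eta> i"
  shows "reverse_at i (quiver_of \<eta>) = quiver_of (lower i \<eta>)"
proof -
  have "(a, b) \<in> reverse_at i (quiver_of \<eta>) \<longleftrightarrow> (a, b) \<in> quiver_of (lower i \<eta>)" for a b
  proof (cases "{a, b} \<in> dynkin_edges T")
    case True
    then have "a \<noteq> b" "\<bar>\<eta> a - \<eta> b\<bar> = 1" using edge_vertices assms(1) unfolding height_def by blast+
    moreover have "a = i \<Longrightarrow> \<eta> b = \<eta> a - 1" "b = i \<Longrightarrow> \<eta> a = \<eta> b - 1"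
      using assms source_iff True edge_sym[of a b] by auto
    ultimately show ?thesis
      using True edge_sym[of a b] by (auto simp: lower_def reverse_at_def quiver_of_def)
  next
    case False
    then show ?thesis using edge_sym[of a b] by (auto simp: reverse_at_def quiver_of_def)
  qed
  then show ?thesis by auto
qed

lemma adp_Cons:
  "height \<eta> \<Longrightarrow> adp \<eta> (i # ws) \<longleftrightarrow> source \<eta> i \<and> adp (lower i \<eta>) ws"
  using reverse_at_quiver_of by auto

lemma height_final: "height \<eta> \<Longrightarrow> adp \<eta> ws \<Longrightarrow> height (final_height \<eta> ws)"
proof (induction ws arbitrary: \<eta>)
  case (Cons i ws)
  have "source \<eta> i" "adp (lower i \<eta>) ws" using Cons.prems adp_Cons by blast+
  then show ?case using Cons.IH[of "lower i \<eta>"] Cons.prems height_lower by simp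
qed simp

lemma adp_append:
  "height \<eta> \<Longrightarrow> adp \<eta> (us @ ws) \<longleftrightarrow> adp \<eta> us \<and> adp (final_height \<eta> us) ws"
proof (induction us arbitrary: \<eta>)
  case (Cons i us)
  show ?case
  proof (cases "source \<eta> i")
    case True
    then show ?thesis
      using Cons.IH[OF height_lower[OF Cons.prems True]] reverse_at_quiver_of[OF Cons.prems True] by simp
  qed simp
qed simp

lemma quiver_of_cong: "(\<And>i. i \<in> V \<Longrightarrow> \<eta> i = \<zeta> i) \<Longrightarrow> quiver_of \<eta> = quiver_of \<zeta>"
  unfolding quiver_of_def using edge_vertices by fastforce

lemma quiver_of_shift: "quiver_of (\<lambda>i. \<eta> i + c) = quiver_of \<eta>"
  by (simp add: quiver_of_def)

lemma quiver_of_minus: "(quiver_of \<eta>)\<inverse> = quiver_of (\<lambda>i. - \<eta> i)"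
  using edge_sym by (auto simp: quiver_of_def) 

lemma height_minus: "height \<eta> \<Longrightarrow> height (\<lambda>i. - \<eta> i)"
  unfolding height_def by (simp add: abs_minus_commute)

lemma height_shift: "height \<eta> \<Longrightarrow> height (\<lambda>i. \<eta> i + c)"
  unfolding height_def by simp

section \<open>The Euler form along adapted words\<close>

lemma euler_simple_right:
  assumes "is_source Q i" "i \<in> V"
  shows "euler_form T Q x (simple_root i) = x i"
proof -
  have "(\<Sum>j\<in>V. if (a, j) \<in> Q then simple_root i j else 0) = 0" for a
    using assms(1) by (intro sum.neutral) (auto simp: is_source_def simple_root_def)
  then have "euler_form T Q x (simple_root i) = (\<Sum>a\<in>V. if i = a then x a else 0)"
    unfolding euler_form_def by (intro sum.cong) (auto simp: simple_root_def)
  then show ?thesis using assms(2) by simp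
qed

lemma euler_simple_left:
  assumes "i \<in> V"
  shows "euler_form T Q (simple_root i) y = y i - (\<Sum>j\<in>V. if (i, j) \<in> Q then y j else 0)"
proof -
  have "euler_form T Q (simple_root i) y =
      (\<Sum>a\<in>V. if i = a then y a - (\<Sum>j\<in>V. if (a, j) \<in> Q then y j else 0) else 0)"
    unfolding euler_form_def by (intro sum.cong) (auto simp: simple_root_def)
  then show ?thesis using assms by simp
qed

lemma euler_simple_simple:
  assumes "i \<in> V" "j \<in> V" "i \<noteq> j"
  shows "euler_form T Q (simple_root i) (simple_root j) = (if (i, j) \<in> Q then - 1 else 0)"
proof -
  have "(\<Sum>l\<in>V. if (i, l) \<in> Q then simple_root j l else 0) = (\<Sum>l\<in>V. if j = l then (if (i, j) \<in> Q then 1 else 0) else 0)"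
    by (intro sum.cong) (auto simp: simple_root_def)
  then show ?thesis using assms euler_simple_left[of i Q "simple_root j"] by (simp add: simple_root_def)
qed

lemma coroot_pairing_edges:
  assumes "i \<in> V"
  shows "coroot_pairing T i x = 2 * x i - (\<Sum>j\<in>V. if {i, j} \<in> dynkin_edges T then x j else 0)"
proof -
  have "coroot_pairing T i x =
     (\<Sum>j\<in>V. (if i = j then 2 * x j else 0) - (if {i, j} \<in> dynkin_edges T then x j else 0))"
    unfolding coroot_pairing_def using edge_vertices[of i i] by (intro sum.cong) (auto simp: cartan_def)
  then show ?thesis using assms by (simp add: sum_subtractf)
qed

text \<open>
  Only the products with the coefficient at \<open>i\<close> change.  With \<open>X\<close> and \<open>Y\<close> the sums over the neighbours of \<open>i\<close>,
  both sides contain \<open>x\<^sub>i y\<^sub>i - x\<^sub>i Y\<close>: on the left it appears as \<open>(X - x\<^sub>i)(Y - y\<^sub>i) - X (Y - y\<^sub>i)\<close>.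
\<close>

lemma euler_form_reflection:
  assumes h: "height \<eta>" and src: "source \<eta> i" and i: "i \<in> V"
  shows "E (lower i \<eta>) (s i x) (s i y) = E \<eta> x y"
proof -
  let ?V = "V - {i}" and ?Q = "quiver_of \<eta>" and ?Q' = "quiver_of (lower i \<eta>)"
  have h': "height (lower i \<eta>)" using height_lower h src by blast
  note e = dynkin_quiver_edge[OF dynkin_quiver_of[OF h]] and e' = dynkin_quiver_edge[OF dynkin_quiver_of[OF h']]
  have split: "(\<Sum>j\<in>V. f j) = f i + (\<Sum>j\<in>?V. f j)" for f :: "nat \<Rightarrow> int"
    using i by (simp add: sum.remove)
  have mem: "(i, j) \<in> ?Q \<longleftrightarrow> {i, j} \<in> dynkin_edges T" "(j, i) \<notin> ?Q"
    "(j, i) \<in> ?Q' \<longleftrightarrow> {i, j} \<in> dynkin_edges T" "(i, j) \<notin> ?Q'" for j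
    using src e[of i j] reverse_at_quiver_of[OF h src, symmetric] by (auto simp: is_source_def reverse_at_def)
  have same: "(a, b) \<in> ?Q' \<longleftrightarrow> (a, b) \<in> ?Q" if "a \<noteq> i" "b \<noteq> i" for a b
    using that by (simp add: quiver_of_def lower_def)
  define X where "X = (\<Sum>j\<in>?V. if {i, j} \<in> dynkin_edges T then x j else 0)"
  define Y where "Y = (\<Sum>j\<in>?V. if {i, j} \<in> dynkin_edges T then y j else 0)"
  define C where "C = (\<Sum>a\<in>?V. x a * (y a - (\<Sum>j\<in>?V. if (a, j) \<in> ?Q then y j else 0)))"
  have ii: "{i, i} \<notin> dynkin_edges T" using edge_vertices by blast
  have sx: "s i x i = X - x i" and sy: "s i y i = Y - y i"
    using coroot_pairing_edges[OF i] ii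
    by (simp_all add: simple_reflection_eq X_def Y_def split[of "\<lambda>j. if {i, j} \<in> dynkin_edges T then _ j else 0"])
  have "E \<eta> x y = x i * (y i - Y) + C"
    unfolding euler_form_def split using ii by (simp add: mem Y_def C_def)
  moreover have "E (lower i \<eta>) (s i x) (s i y) = (X - x i) * (Y - y i) + (C - X * (Y - y i))"
  proof -
    have inner: "s i x a * (s i y a - ((if (a, i) \<in> ?Q' then s i y i else 0) + (\<Sum>j\<in>?V. if (a, j) \<in> ?Q' then s i y j else 0)))
       = x a * (y a - (\<Sum>j\<in>?V. if (a, j) \<in> ?Q then y j else 0)) - (if {i, a} \<in> dynkin_edges T then x a else 0) * (Y - y i)"
      if a: "a \<in> ?V" for a
    proof -
      have "(\<Sum>j\<in>?V. if (a, j) \<in> ?Q' then s i y j else 0) = (\<Sum>j\<in>?V. if (a, j) \<in> ?Q then y j else 0)"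
        using a same by (intro sum.cong) (auto simp: simple_reflection_other)
      then show ?thesis using a mem(3)[of a] sy by (auto simp: simple_reflection_other algebra_simps)
    qed
    have "E (lower i \<eta>) (s i x) (s i y) = s i x i * s i y i +
       (\<Sum>a\<in>?V. s i x a * (s i y a - ((if (a, i) \<in> ?Q' then s i y i else 0) + (\<Sum>j\<in>?V. if (a, j) \<in> ?Q' then s i y j else 0))))"
      unfolding euler_form_def split by (simp add: mem(4))
    also have "\<dots> = (X - x i) * (Y - y i) + (C - X * (Y - y i))"
      using inner by (simp add: sx sy C_def X_def sum_subtractf sum_distrib_right)
    finally show ?thesis .
  qed
  ultimately show ?thesis by (simp add: algebra_simps)
qed

lemma euler_form_word:
  "height \<eta> \<Longrightarrow> adp \<eta> ws \<Longrightarrow> set ws \<subseteq> V \<Longrightarrow>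
     E (final_height \<eta> ws) (W (rev ws) x) (W (rev ws) y) = E \<eta> x y"
proof (induction ws arbitrary: \<eta> x y)
  case (Cons i ws)
  have src: "source \<eta> i" "adp (lower i \<eta>) ws" using Cons.prems adp_Cons by blast+
  have "E (final_height \<eta> (i # ws)) (W (rev (i # ws)) x) (W (rev (i # ws)) y) = E (lower i \<eta>) (s i x) (s i y)"
    using Cons.IH[OF height_lower[OF Cons.prems(1) src(1)] src(2)] Cons.prems by simp
  then show ?case using euler_form_reflection[OF Cons.prems(1) src(1)] Cons.prems by simp
qed simp

text \<open>
  At a source \<open>i\<close>, pairing with \<open>\<alpha>\<^sub>i\<close> on the right reads off the coefficient at \<open>i\<close>.  Pulling back to the time
  when the letter is used reduces the general root to this case.
\<close>

lemma euler_form_root: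
  assumes "height \<eta>" "adp \<eta> (us @ [i])" "set us \<subseteq> V" "i \<in> V"
  shows "E \<eta> x (W us (simple_root i)) = W (rev us) x i"
proof -
  have a: "adp \<eta> us" "adp (final_height \<eta> us) [i]" using assms(1,2) adp_append by blast+
  then have "source (final_height \<eta> us) i" by simp
  then show ?thesis
    using euler_form_word[OF assms(1) a(1) assms(3), of x "W us (simple_root i)"]
      word_action_rev[OF assms(3)] euler_simple_right[OF _ assms(4)] by simp
qed

text \<open>
  The value of the Euler form on the difference, taken twice, is half its norm.
\<close>

lemma euler_form_nondegenerate:
  assumes "height \<eta>" "u \<in> root_lattice T" "v \<in> root_lattice T"
    and eq: "\<And>x. E \<eta> x u = E \<eta> x v"
  shows "u = v"
proof (rule ccontr)
  assume ne: "u \<noteq> v"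
  define d where "d = (\<lambda>j. 1 * u j + (-1) * v j)"
  have d: "d \<in> root_lattice T" "d \<noteq> (\<lambda>_. 0)"
    using assms(2,3) ne by (auto simp: d_def root_lattice_def fun_eq_iff)
  have "E \<eta> d d = 1 * E \<eta> d u + (-1) * E \<eta> d v"
    unfolding d_def by (rule euler_form_linear_right)
  then have "E \<eta> d d = 0" using eq[of d] by simp
  then have "cartan_form T d d = 0"
    using euler_form_symmetrize[OF dynkin_quiver_of[OF assms(1)], of d d] by simp
  then show False using cartan_form_pos[OF d] by simp
qed

text \<open>
  Pulled back to the time of the letter \<open>i\<close> of \<open>x\<close>, the first argument becomes \<open>\<alpha>\<^sub>i\<close> and the second a positive
  root \<open>y'\<close> different from it.  The value is minus the coefficient of \<open>s\<^sub>i y'\<close> at \<open>i\<close>, and \<open>s\<^sub>i y'\<close> is still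
  positive.  For representations this says that there are no maps from \<open>x\<close> to \<open>y\<close>.
\<close>

lemma euler_form_order:
  assumes "height \<eta>" "adp \<eta> us" "positive_word us" "x \<in> set (rl us)" "y \<in> P" "y \<notin> set (rl us)"
  shows "E \<eta> x y \<le> 0"
proof -
  obtain n where n: "n < length us" "rl us ! n = x" using assms(4) by (auto simp: in_set_conv_nth)
  define u1 u2 i where "u1 = take n us" and "u2 = drop (Suc n) us" and "i = us ! n"
  have us: "us = (u1 @ [i]) @ u2" using n(1) id_take_nth_drop by (simp add: u1_def u2_def i_def)
  have pos: "positive_word (u1 @ [i])" using assms(3) us positive_word_append by metis
  then have p1: "positive_word u1" and i: "i \<in> V" by (auto simp: positive_word_snoc)
  have V: "set u1 \<subseteq> V" using p1 positive_word_vertices by blast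
  have x: "x = W u1 (simple_root i)" using n root_list_nth by (simp add: root_of_word_def u1_def i_def)
  have ad: "adp \<eta> u1" "source (final_height \<eta> u1) i"
    using assms(1,2) us adp_append[OF assms(1), of "u1 @ [i]" u2] adp_append[OF assms(1), of u1 "[i]"] by auto
  let ?\<zeta> = "final_height \<eta> u1" and ?y = "W (rev u1) y"
  have "set (rl u1) \<subseteq> set (rl us)" unfolding us by (auto simp: root_list_append)
  then have y: "?y \<in> P" using positive_word_inversions[OF p1] assms(5,6) by blast
  have "?y \<noteq> simple_root i"
    using x assms(4,6) word_action_rev'[OF V, of y] by auto
  then have "s i ?y \<in> P" using reflection_positive i y by blast
  then have "s i ?y i \<ge> 0" by (rule positive_root_nonneg)
  have h: "height ?\<zeta>" using height_final assms(1) ad by blast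
  have "E \<eta> x y = E ?\<zeta> (simple_root i) ?y"
    using euler_form_word[OF assms(1) ad(1) V, of x y] word_action_rev[OF V] x by simp
  also have "\<dots> = coroot_pairing T i ?y - ?y i"
    using euler_form_symmetrize[OF dynkin_quiver_of[OF h], of "simple_root i" ?y]
      euler_simple_right[OF ad(2) i] cartan_form_simple_root[OF i] by simp
  also have "\<dots> = - s i ?y i" by (simp add: simple_reflection_eq)
  finally show ?thesis using \<open>s i ?y i \<ge> 0\<close> by simp
qed

text \<open>
  Suppose that the roots that the current sources would add are all negative.  If all simple roots were sent to
  negative roots, the word would be full.  So take a vertex \<open>j\<close> of greatest height whose simple root
  goes to a positive root \<open>y\<close>; it is not a source, and for an arrow \<open>i \<rightarrow> j\<close> the simple root \<open>\<alpha>\<^sub>i\<close> goes to a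
  negative root \<open>- x\<close>.  Then \<open>x\<close> is used and \<open>y\<close> is not, but \<open>\<langle>x, y\<rangle> = - \<langle>\<alpha>\<^sub>i, \<alpha>\<^sub>j\<rangle> = 1\<close>.
\<close>

lemma adapted_extend_one:
  assumes "height \<eta>" "adp \<eta> us" "positive_word us" "\<not> full_word us"
  shows "\<exists>i. positive_word (us @ [i]) \<and> adp \<eta> (us @ [i])"
proof (rule ccontr)
  assume contra: "\<not> ?thesis"
  let ?\<zeta> = "final_height \<eta> us"
  have V: "set us \<subseteq> V" using assms(3) positive_word_vertices by blast
  define B where "B = {j \<in> V. W us (simple_root j) \<in> P}"
  have B: "finite B" "B \<noteq> {}"
    using all_simple_negative_imp_full[OF assms(3)] assms(4) by (auto simp: B_def)
  define m where "m = Max (?\<zeta> ` B)"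
  have "m \<in> ?\<zeta> ` B" unfolding m_def using B by (intro Max_in) auto
  then obtain j where j: "j \<in> B" "?\<zeta> j = m" by auto
  have max: "?\<zeta> i \<le> m" if "i \<in> B" for i unfolding m_def using B that by simp
  have jV: "j \<in> V" "W us (simple_root j) \<in> P" using j by (auto simp: B_def)
  have "\<not> source ?\<zeta> j"
    using contra assms jV by (auto simp: positive_word_snoc adp_append)
  then obtain i where i: "(i, j) \<in> quiver_of ?\<zeta>" by (auto simp: is_source_def)
  then have iV: "i \<in> V" "i \<noteq> j" "?\<zeta> i = m + 1" using edge_vertices j by (auto simp: quiver_of_def)
  then have "i \<notin> B" using max by fastforce
  let ?x = "negate (W us (simple_root i))" and ?y = "W us (simple_root j)"
  have x: "?x \<in> P" using negate_root_cases[OF V simple_root_positive] iV \<open>i \<notin> B\<close> by (auto simp: B_def)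
  have rx: "W (rev us) ?x = negate (simple_root i)" using word_action_negate word_action_rev[OF V] by simp
  have "?x \<in> set (rl us)"
    using positive_word_inversions[OF assms(3)] x rx not_both_positive[OF simple_root_positive[OF iV(1)]] by auto
  moreover have "?y \<notin> set (rl us)"
    using positive_word_inversions[OF assms(3)] jV word_action_rev[OF V] simple_root_positive by auto
  ultimately have "E \<eta> ?x ?y \<le> 0" using euler_form_order[OF assms(1-3)] jV by blast
  moreover have "E \<eta> ?x ?y = E ?\<zeta> (negate (simple_root i)) (simple_root j)"
    using euler_form_word[OF assms(1,2) V, of ?x ?y] rx word_action_rev[OF V] by simp
  moreover have "E ?\<zeta> (negate (simple_root i)) (simple_root j) = 1"
    using euler_form_linear_left[of T "quiver_of ?\<zeta>" "-1" "simple_root i" 0 "simple_root i" "simple_root j"]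
      euler_simple_simple[OF iV(1) jV(1) iV(2)] i by (simp add: negate_def)
  ultimately show False by simp
qed

lemma adapted_extend:
  assumes "height \<eta>" "adp \<eta> us" "positive_word us"
  shows "\<exists>ws. full_word (us @ ws) \<and> adp \<eta> (us @ ws)"
  using assms(2,3)
proof (induction "card P - length us" arbitrary: us rule: less_induct)
  case less
  show ?case
  proof (cases "full_word us")
    case True
    then show ?thesis using less.prems by (intro exI[of _ "[]"]) simp
  next
    case False
    then obtain i where i: "positive_word (us @ [i])" "adp \<eta> (us @ [i])"
      using adapted_extend_one[OF assms(1) less.prems] by blast
    have "length (us @ [i]) \<le> card P" using positive_word_length_le[OF i(1)] .
    then have "card P - length (us @ [i]) < card P - length us" by simp
    then obtain ws where "full_word ((us @ [i]) @ ws)" "adp \<eta> ((us @ [i]) @ ws)"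
      using less.hyps[OF _ i(2,1)] by blast
    then show ?thesis by (intro exI[of _ "i # ws"]) simp
  qed
qed

lemma adapted_full_from_source:
  assumes "height \<eta>" "source \<eta> i" "i \<in> V"
  shows "\<exists>us. full_word (i # us) \<and> adp \<eta> (i # us)"
proof -
  have "positive_word [i]" using assms(3) simple_root_positive by (simp add: positive_word_def)
  then show ?thesis using adapted_extend[OF assms(1), of "[i]"] assms(2) by simp
qed

lemma adapted_full_exists: "height \<eta> \<Longrightarrow> \<exists>ws. full_word ws \<and> adp \<eta> ws"
  using adapted_extend[of \<eta> "[]"] by (simp add: positive_word_def)

section \<open>Descending between height functions\<close>

text \<open>
  Among the vertices where \<open>\<eta>\<close> exceeds \<open>\<zeta>\<close>, take one with the greatest value of \<open>\<eta>\<close>: a higher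
  neighbour would also exceed \<open>\<zeta>\<close>, since heights of neighbours differ by one.
\<close>

lemma descend_step:
  assumes "height \<eta>" "height \<zeta>" "\<And>i. i \<in> V \<Longrightarrow> \<zeta> i \<le> \<eta> i" "\<And>i. i \<in> V \<Longrightarrow> even (\<eta> i - \<zeta> i)"
    and ex: "\<exists>i\<in>V. \<zeta> i < \<eta> i"
  shows "\<exists>i\<in>V. source \<eta> i \<and> \<zeta> i \<le> \<eta> i - 2 \<and> (\<forall>j\<in>V. \<zeta> j < \<eta> j \<longrightarrow> \<eta> j \<le> \<eta> i)"
proof -
  define B where "B = {j \<in> V. \<zeta> j < \<eta> j}"
  have B: "finite B" "B \<noteq> {}" using ex by (auto simp: B_def)
  define m where "m = Max (\<eta> ` B)"
  have "m \<in> \<eta> ` B" unfolding m_def using B by (intro Max_in) auto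
  then obtain i where i: "i \<in> B" "\<eta> i = m" by auto
  have max: "\<eta> j \<le> \<eta> i" if "j \<in> B" for j unfolding i(2) m_def using B that by simp
  have iV: "i \<in> V" "\<zeta> i < \<eta> i" using i by (auto simp: B_def)
  then have le: "\<zeta> i \<le> \<eta> i - 2" using assms(4)[OF iV(1)] by presburger
  have "source \<eta> i"
    unfolding source_iff[OF assms(1)]
  proof (intro allI impI)
    fix j assume e: "{i, j} \<in> dynkin_edges T"
    then have j: "j \<in> V" using edge_vertices by blast
    have "\<bar>\<eta> i - \<eta> j\<bar> = 1" "\<bar>\<zeta> i - \<zeta> j\<bar> = 1" using e assms(1,2) unfolding height_def by blast+
    moreover have "\<eta> j \<noteq> \<eta> i + 1"
    proof
      assume "\<eta> j = \<eta> i + 1"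
      then have "\<zeta> j < \<eta> j" using \<open>\<bar>\<zeta> i - \<zeta> j\<bar> = 1\<close> le by linarith
      then have "j \<in> B" using j by (simp add: B_def)
      then show False using max \<open>\<eta> j = \<eta> i + 1\<close> by fastforce
    qed
    ultimately show "\<eta> j = \<eta> i - 1" by linarith
  qed
  then show ?thesis using iV le max by (auto simp: B_def)
qed

lemma descend:
  assumes "height \<eta>" "height \<zeta>" "\<And>i. i \<in> V \<Longrightarrow> \<zeta> i \<le> \<eta> i" "\<And>i. i \<in> V \<Longrightarrow> even (\<eta> i - \<zeta> i)"
  shows "\<exists>ws. set ws \<subseteq> V \<and> adp \<eta> ws \<and> (\<forall>i\<in>V. final_height \<eta> ws i = \<zeta> i)"
  using assms
proof (induction "nat (\<Sum>i\<in>V. \<eta> i - \<zeta> i)" arbitrary: \<eta> rule: less_induct)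
  case less
  show ?case
  proof (cases "\<exists>i\<in>V. \<zeta> i < \<eta> i")
    case False
    then show ?thesis using less.prems(3) by (intro exI[of _ "[]"]) (force simp: antisym)
  next
    case True
    then obtain i where i: "i \<in> V" "source \<eta> i" "\<zeta> i \<le> \<eta> i - 2"
      using descend_step[OF less.prems] by blast
    have h: "height (lower i \<eta>)" using height_lower less.prems(1) i(2) by blast
    have le: "\<zeta> j \<le> lower i \<eta> j" if "j \<in> V" for j
      using that less.prems(3) i(3) by (simp add: lower_def)
    have ev: "even (lower i \<eta> j - \<zeta> j)" if "j \<in> V" for j
      using that less.prems(4)[OF that] by (auto simp: lower_def)
    have "(\<Sum>j\<in>V. lower i \<eta> j - \<zeta> j) < (\<Sum>j\<in>V. \<eta> j - \<zeta> j)"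
      using i(1) by (intro sum_strict_mono_ex1) (auto simp: lower_def)
    moreover have "(\<Sum>j\<in>V. lower i \<eta> j - \<zeta> j) \<ge> 0" using le by (intro sum_nonneg) simp
    ultimately obtain ws where ws: "set ws \<subseteq> V" "adp (lower i \<eta>) ws" "\<forall>j\<in>V. final_height (lower i \<eta>) ws j = \<zeta> j"
      using less.hyps[OF _ h less.prems(2) le ev] by (auto simp: nat_less_iff)
    have "adp \<eta> (i # ws)" using adp_Cons[OF less.prems(1)] i(2) ws(2) by blast
    then show ?thesis using i(1) ws by (intro exI[of _ "i # ws"]) auto
  qed
qed

end

section \<open>Commuting a source to the front\<close>

lemma count_list_distinct: "distinct xs \<Longrightarrow> count_list xs x = (if x \<in> set xs then 1 else 0)"
  by (induction xs) auto

context finite_type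
begin

text \<open>
  As long as \<open>i\<close> is a source that has not been used, its neighbours are not sources.  So the letters before
  \<open>i\<close> commute with \<open>i\<close>, and moving \<open>i\<close> to the front keeps the order of all the other roots.
\<close>

lemma move_source_to_front:
  assumes "height \<eta>" "source \<eta> i" "i \<in> V" "i \<notin> set us" "set us \<subseteq> V" "adp \<eta> (us @ i # ws)"
  shows "adp \<eta> (i # us @ ws) \<and> W (us @ i # ws) = W (i # us @ ws) \<and>
     filter (\<lambda>v. v \<noteq> simple_root i) (rl (us @ i # ws)) = filter (\<lambda>v. v \<noteq> simple_root i) (rl (i # us @ ws))"
  using assms
proof (induction us arbitrary: \<eta>)
  case (Cons a us)
  let ?ne = "\<lambda>v. v \<noteq> simple_root i"
  have a: "source \<eta> a" "adp (lower a \<eta>) (us @ i # ws)" "a \<noteq> i" "a \<in> V"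
    using Cons.prems adp_Cons[OF Cons.prems(1)] by auto
  have no_edge: "{i, a} \<notin> dynkin_edges T"
  proof
    assume e: "{i, a} \<in> dynkin_edges T"
    then have "{a, i} \<in> dynkin_edges T" using edge_sym by blast
    then have "\<eta> a = \<eta> i - 1" "\<eta> i = \<eta> a - 1"
      using e source_iff[OF Cons.prems(1)] a(1) Cons.prems(2) by blast+
    then show False by simp
  qed
  have h: "height (lower a \<eta>)" using height_lower Cons.prems(1) a(1) by blast
  have hi: "height (lower i \<eta>)" using height_lower Cons.prems(1,2) by blast
  have src: "source (lower a \<eta>) i"
    unfolding source_iff[OF h]
  proof (intro allI impI)
    fix j assume e: "{i, j} \<in> dynkin_edges T"
    then have "j \<noteq> a" using no_edge by blast
    then show "lower a \<eta> j = lower a \<eta> i - 1"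
      using e Cons.prems(1,2) source_iff a(3) by (auto simp: lower_def)
  qed
  have srca: "source (lower i \<eta>) a"
    unfolding source_iff[OF hi]
  proof (intro allI impI)
    fix j assume e: "{a, j} \<in> dynkin_edges T"
    then have "j \<noteq> i" using no_edge edge_sym by blast
    then show "lower i \<eta> j = lower i \<eta> a - 1"
      using e Cons.prems(1) source_iff a(1,3) by (auto simp: lower_def)
  qed
  have IH: "adp (lower a \<eta>) (i # us @ ws)" "W (us @ i # ws) = W (i # us @ ws)"
    "filter ?ne (rl (us @ i # ws)) = filter ?ne (rl (i # us @ ws))"
    using Cons.IH[OF h src Cons.prems(3) _ _ a(2)] Cons.prems(4,5) by (simp_all del: adapted.simps word_action_append word_action_Cons)
  have "adp (lower i (lower a \<eta>)) (us @ ws)" using IH(1) adp_Cons[OF h] by blast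
  then have ad: "adp \<eta> (i # (a # us) @ ws)"
    unfolding append_Cons adp_Cons[OF Cons.prems(1)] adp_Cons[OF hi] lower_commute[of a i \<eta>]
    using Cons.prems(2) srca by blast
  have c: "cartan T a i = 0" "cartan T i a = 0"
    using no_edge edge_sym a(3) by (auto simp: cartan_def insert_commute)
  have comm: "s a (s i v) = s i (s a v)" for v
  proof -
    have "coroot_pairing T a (s i v) = coroot_pairing T a v"
      by (subst simple_reflection_sub, subst coroot_pairing_linear)
         (simp add: c coroot_pairing_simple_root[OF Cons.prems(3)])
    moreover have "coroot_pairing T i (s a v) = coroot_pairing T i v"
      by (subst simple_reflection_sub, subst coroot_pairing_linear)
         (simp add: c coroot_pairing_simple_root[OF a(4)])
    ultimately show ?thesis using a(3) by (auto simp: simple_reflection_eq fun_eq_iff)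
  qed
  have fixed: "s a (simple_root i) = simple_root i" "s i (simple_root a) = simple_root a"
    using c coroot_pairing_simple_root Cons.prems(3) a(4) by (auto simp: simple_reflection_eq)
  have iff: "s a v = simple_root i \<longleftrightarrow> v = simple_root i" for v
    using fixed(1) a(4) by (metis simple_reflection_invol)
  have act: "W ((a # us) @ i # ws) = W (i # (a # us) @ ws)"
  proof
    fix v
    show "W ((a # us) @ i # ws) v = W (i # (a # us) @ ws) v"
      using fun_cong[OF IH(2), of v] comm by simp
  qed
  have "filter ?ne (rl ((a # us) @ i # ws)) = simple_root a # map (s a) (filter ?ne (rl (us @ i # ws)))"
    using a(3) by (simp add: filter_map comp_def iff)
  also have "\<dots> = simple_root a # map (s a) (filter ?ne (rl (i # us @ ws)))"
    using IH(3) by simp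
  also have "\<dots> = filter ?ne (rl (a # i # us @ ws))"
    using a(3) by (simp add: filter_map comp_def iff)
  also have "\<dots> = filter ?ne (rl (i # a # us @ ws))"
    using comm fixed a(3) by (simp add: comp_def)
  finally show ?case using ad act by simp
qed simp

text \<open>
  The first letter of one word is a source and can be moved to the front of the other.
\<close>

lemma adapted_action_cong:
  assumes "height \<eta>" "adp \<eta> us" "adp \<eta> ws" "set us \<subseteq> V" "set ws \<subseteq> V"
    "\<And>i. count_list us i = count_list ws i"
  shows "W us = W ws"
  using assms
proof (induction us arbitrary: \<eta> ws)
  case Nil
  then have "set ws = {}" by (metis count_list_0_iff equals0I empty_iff list.set(1))
  then show ?case by simp
next
  case (Cons i us)
  have src: "source \<eta> i" "adp (lower i \<eta>) us" using Cons.prems adp_Cons by blast+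
  have iV: "i \<in> V" using Cons.prems by simp
  have "i \<in> set ws" using Cons.prems(6)[of i] by (metis count_list_0_iff list.set_intros(1))
  then obtain xs ys where ws: "ws = xs @ i # ys" "i \<notin> set xs" by (meson split_list_first)
  have mv: "adp \<eta> (i # xs @ ys)" "W ws = W (i # xs @ ys)"
    using move_source_to_front[OF Cons.prems(1) src(1) iV ws(2), of ys] Cons.prems(3,5) ws by auto
  have "count_list us j = count_list (xs @ ys) j" for j
    using Cons.prems(6)[of j] ws(1) by (auto split: if_splits)
  moreover have "adp (lower i \<eta>) (xs @ ys)" using mv(1) adp_Cons[OF Cons.prems(1)] by blast
  ultimately have "W us = W (xs @ ys)"
    using Cons.IH[OF height_lower[OF Cons.prems(1) src(1)] src(2)] Cons.prems(4,5) ws(1) by auto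
  then show ?case using mv(2) by simp
qed

section \<open>Path roots\<close>

lemma path_height: "(a, b) \<in> (quiver_of \<eta>)\<^sup>* \<Longrightarrow> \<eta> b \<le> \<eta> a"
  by (induction rule: rtrancl_induct) (auto simp: quiver_of_def)

lemma path_vertices: "(a, b) \<in> (quiver_of \<eta>)\<^sup>* \<Longrightarrow> b \<in> V \<Longrightarrow> a \<in> V"
  by (induction rule: converse_rtrancl_induct) (use edge_vertices in \<open>auto simp: quiver_of_def\<close>)

lemma path_crossing:
  assumes "(x, y) \<in> Q\<^sup>*" "x \<notin> S" "y \<in> S"
  shows "\<exists>a b. (x, a) \<in> Q\<^sup>* \<and> (a, b) \<in> Q \<and> a \<notin> S \<and> b \<in> S"
  using assms by (induction rule: rtrancl_induct) blast+

text \<open>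
  Cut the tree at the edge from \<open>j\<close> to \<open>l\<close>.  Depending on the side of \<open>i\<close>, the path from \<open>l\<close> would cross this
  edge against its orientation, or the path from \<open>l'\<close> would climb back to \<open>j\<close> in order to cross it.
\<close>

lemma path_unique_start:
  assumes "height \<eta>" "(j, l) \<in> quiver_of \<eta>" "(j, l') \<in> quiver_of \<eta>"
    "(l, i) \<in> (quiver_of \<eta>)\<^sup>*" "(l', i) \<in> (quiver_of \<eta>)\<^sup>*"
  shows "l = l'"
proof (rule ccontr)
  let ?Q = "quiver_of \<eta>"
  assume ne: "l \<noteq> l'"
  have e: "{j, l} \<in> dynkin_edges T" "{j, l'} \<in> dynkin_edges T" and \<eta>: "\<eta> j = \<eta> l + 1" "\<eta> j = \<eta> l' + 1"
    using assms by (auto simp: quiver_of_def)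
  obtain S where S: "l \<in> S" "j \<notin> S"
    and cut: "\<And>a b. {a, b} \<in> dynkin_edges T \<Longrightarrow> a \<in> S \<Longrightarrow> b \<notin> S \<Longrightarrow> a = l \<and> b = j"
    using edge_cut[OF e(1)] by blast
  have l': "l' \<notin> S" using cut[of l' j] e(2) edge_sym ne S(2) by blast
  show False
  proof (cases "i \<in> S")
    case True
    then obtain a b where ab: "(l', a) \<in> ?Q\<^sup>*" "(a, b) \<in> ?Q" "a \<notin> S" "b \<in> S"
      using path_crossing[OF assms(5) l'] by blast
    then have "a = j" using cut[of b a] edge_sym[of a b] by (auto simp: quiver_of_def)
    then show False using path_height[OF ab(1)] \<eta> by simp
  next
    case False
    then obtain a b where ab: "(a, b) \<in> ?Q" "a \<in> S" "b \<notin> S"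
      using path_crossing[OF assms(4), of "- S"] S(1) by auto
    then have "a = l" "b = j" using cut[of a b] by (auto simp: quiver_of_def)
    then show False using ab(1) \<eta> by (simp add: quiver_of_def)
  qed
qed

text \<open>
  A path from \<open>j\<close> to \<open>i\<close> of positive length has exactly one possible first arrow, since the graph is a tree.
\<close>

lemma path_root_local:
  assumes "height \<eta>" "i \<in> V" "j \<in> V"
  shows "path_root (quiver_of \<eta>) i j -
     (\<Sum>l\<in>V. if (j, l) \<in> quiver_of \<eta> then path_root (quiver_of \<eta>) i l else 0) = (if j = i then 1 else 0)"
proof -
  let ?Q = "quiver_of \<eta>"
  have terms: "(if (j, l) \<in> ?Q then path_root ?Q i l else 0) = (if (j, l) \<in> ?Q \<and> (l, i) \<in> ?Q\<^sup>* then 1 else 0)" for l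
    by (simp add: path_root_def)
  show ?thesis
  proof (cases "\<exists>l. (j, l) \<in> ?Q \<and> (l, i) \<in> ?Q\<^sup>*")
    case False
    then have "(j, i) \<in> ?Q\<^sup>* \<longleftrightarrow> j = i" by (metis converse_rtranclE rtrancl.rtrancl_refl)
    moreover have "(\<Sum>l\<in>V. if (j, l) \<in> ?Q \<and> (l, i) \<in> ?Q\<^sup>* then 1 else 0 :: int) = 0"
      using False by (intro sum.neutral) auto
    ultimately show ?thesis unfolding terms by (simp add: path_root_def)
  next
    case True
    then obtain l where l: "(j, l) \<in> ?Q" "(l, i) \<in> ?Q\<^sup>*" by blast
    have "(j, l') \<in> ?Q \<and> (l', i) \<in> ?Q\<^sup>* \<longleftrightarrow> l = l'" for l'
      using path_unique_start[OF assms(1) l(1) _ l(2)] l by blast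
    moreover have "l \<in> V" using l(1) edge_vertices by (auto simp: quiver_of_def)
    moreover have "j \<noteq> i" using path_height[OF l(2)] l(1) by (auto simp: quiver_of_def)
    moreover have "(j, i) \<in> ?Q\<^sup>*" using l by (rule converse_rtrancl_into_rtrancl)
    ultimately show ?thesis unfolding terms by (simp add: path_root_def)
  qed
qed

lemma euler_form_path_root:
  assumes "height \<eta>" "i \<in> V"
  shows "E \<eta> x (path_root (quiver_of \<eta>) i) = x i"
proof -
  have "E \<eta> x (path_root (quiver_of \<eta>) i) = (\<Sum>j\<in>V. if i = j then x j else 0)"
    unfolding euler_form_def using path_root_local[OF assms] by (intro sum.cong) auto
  then show ?thesis using assms(2) by simp
qed

lemma path_root_in_lattice: "i \<in> V \<Longrightarrow> path_root (quiver_of \<eta>) i \<in> root_lattice T"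
  using path_vertices by (auto simp: root_lattice_def path_root_def)

text \<open>
  Both sides represent the functional that takes the coefficient at \<open>i\<close>.
\<close>

lemma first_occurrence_root:
  assumes "height \<eta>" "adp \<eta> (us @ [i])" "set us \<subseteq> V" "i \<in> V" "i \<notin> set us"
  shows "W us (simple_root i) = path_root (quiver_of \<eta>) i"
proof (rule euler_form_nondegenerate[OF assms(1)])
  show "W us (simple_root i) \<in> root_lattice T"
    using word_action_in_lattice assms(3,4) simple_root_in_lattice by blast
  show "path_root (quiver_of \<eta>) i \<in> root_lattice T" using path_root_in_lattice assms(4) by blast
  fix x
  show "E \<eta> x (W us (simple_root i)) = E \<eta> x (path_root (quiver_of \<eta>) i)"
    using euler_form_root[OF assms(1-4)] euler_form_path_root[OF assms(1,4)] word_action_other[of i "rev us"] assms(5)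
    by simp
qed

section \<open>Coxeter elements\<close>

definition coxeter_word :: "(nat \<Rightarrow> int) \<Rightarrow> nat list \<Rightarrow> bool" where
  "coxeter_word \<eta> ws \<longleftrightarrow> distinct ws \<and> set ws = V \<and> adp \<eta> ws"

text \<open>
  Descending from \<open>\<eta>\<close> to \<open>\<eta> - 2\<close> uses every vertex exactly once.
\<close>

lemma coxeter_word_exists:
  assumes "height \<eta>" "source \<eta> i" "i \<in> V"
  shows "\<exists>us. coxeter_word \<eta> (i # us)"
proof -
  let ?\<zeta> = "\<lambda>j. \<eta> j + (- 2)"
  have h: "height (lower i \<eta>)" "height ?\<zeta>"
    using height_lower assms height_shift by blast+
  have "?\<zeta> j \<le> lower i \<eta> j" "even (lower i \<eta> j - ?\<zeta> j)" for j
    by (auto simp: lower_def)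
  then obtain us where us: "set us \<subseteq> V" "adp (lower i \<eta>) us" "\<forall>j\<in>V. final_height (lower i \<eta>) us j = ?\<zeta> j"
    using descend[OF h] by blast
  have c: "count_list (i # us) j = 1" if "j \<in> V" for j
    using us(3) that by (auto simp: final_height_def lower_def split: if_splits)
  then have "set (i # us) = V"
    using us(1) assms(3) by (metis count_list_0_iff insert_subset list.simps(15) subsetI subset_antisym zero_neq_one)
  moreover have "distinct (i # us)"
  proof (rule card_distinct)
    have "length (i # us) = (\<Sum>j\<in>V. count_list (i # us) j)"
      using sum_count_set[of "i # us" V] us(1) assms(3) by simp
    also have "\<dots> = card V" using c by simp
    finally show "card (set (i # us)) = length (i # us)" using \<open>set (i # us) = V\<close> by simp
  qed
  moreover have "adp \<eta> (i # us)" using adp_Cons[OF assms(1)] assms(2) us(2) by blast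
  ultimately show ?thesis unfolding coxeter_word_def by blast
qed

lemma coxeter_word_final:
  assumes "coxeter_word \<eta> ws" "i \<in> V"
  shows "final_height \<eta> ws i = \<eta> i - 2"
  using assms by (simp add: coxeter_word_def final_height_def count_list_distinct)

lemma coxeter_word_quiver: "coxeter_word \<eta> ws \<Longrightarrow> quiver_of (final_height \<eta> ws) = quiver_of \<eta>"
  using quiver_of_cong[of "final_height \<eta> ws" "\<lambda>j. \<eta> j + (- 2)"] coxeter_word_final[of \<eta> ws]
    quiver_of_shift[of \<eta> "-2"] by simp

lemma coxeter_word_positive:
  assumes "height \<eta>" "coxeter_word \<eta> ws"
  shows "positive_word ws"
proof -
  have "positive_word us" if "ws = us @ vs" for us vs
    using that
  proof (induction us arbitrary: vs rule: rev_induct)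
    case (snoc i us)
    have c: "adp \<eta> (us @ [i])" "set us \<subseteq> V" "i \<in> V" "i \<notin> set us"
      using assms(2) snoc.prems adp_append[OF assms(1), of "us @ [i]" vs] by (auto simp: coxeter_word_def)
    have "W us (simple_root i) = path_root (quiver_of \<eta>) i"
      using first_occurrence_root[OF assms(1) c] .
    moreover have "W us (simple_root i) \<in> norm_two_roots" using word_action_in_R simple_root_in_R c by blast
    ultimately have "W us (simple_root i) \<in> P"
      by (intro positive_if_pos_coeff[of _ i]) (auto simp: path_root_def)
    then show ?case using snoc c(3) by (simp add: positive_word_snoc)
  qed (simp add: positive_word_def)
  from this[of ws "[]"] show ?thesis by simp
qed

lemma top_is_source:
  assumes "height \<eta>" "\<And>j. j \<in> V \<Longrightarrow> \<eta> j \<le> \<eta> i"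
  shows "source \<eta> i"
  unfolding source_iff[OF assms(1)]
proof (intro allI impI)
  fix j assume e: "{i, j} \<in> dynkin_edges T"
  then have "\<eta> j \<le> \<eta> i" using assms(2) edge_vertices by blast
  then show "\<eta> j = \<eta> i - 1" using height_edge[OF assms(1) e] by linarith
qed

lemma source_exists:
  assumes "height \<eta>" "V \<noteq> {}"
  shows "\<exists>i\<in>V. source \<eta> i \<and> (\<forall>j\<in>V. \<eta> j \<le> \<eta> i)"
proof -
  define m where "m = Max (\<eta> ` V)"
  have "m \<in> \<eta> ` V" unfolding m_def using assms(2) by (intro Max_in) auto
  then obtain i where i: "i \<in> V" "\<eta> i = m" by auto
  have "\<eta> j \<le> \<eta> i" if "j \<in> V" for j unfolding i(2) m_def using that by simp
  then show ?thesis using i(1) top_is_source[OF assms(1)] by blast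
qed

lemma coxeter_of_quiver_eq:
  assumes h: "height \<eta>" and ws: "coxeter_word \<eta> ws"
  shows "coxeter_of_quiver T (quiver_of \<eta>) = W ws"
  unfolding coxeter_of_quiver_def
proof (rule the_equality)
  show "coxeter_element T (W ws) \<and> (\<exists>us. reduced_expression T (W ws) us \<and> adp \<eta> us)"
    using ws coxeter_word_positive[OF h ws] by (auto simp: coxeter_element_def coxeter_word_def reduced_expression_iff)
  fix w assume "coxeter_element T w \<and> (\<exists>us. reduced_expression T w us \<and> adp \<eta> us)"
  then obtain us cs where us: "reduced_expression T w us" "adp \<eta> us"
    and cs: "distinct cs" "set cs = V" "W cs = w" by (auto simp: coxeter_element_def)
  have usV: "set us \<subseteq> V" "W us = w" "length us = weyl_length T w"
    using us(1) by (auto simp: reduced_expression_def)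
  \<comment> \<open>A Coxeter element moves the coefficient at every vertex, so no letter can be missing.\<close>
  have "j \<in> set us" if j: "j \<in> V" for j
  proof (rule ccontr)
    assume "j \<notin> set us"
    obtain c1 c2 where c: "cs = c1 @ j # c2" using j cs(2) by (metis split_list)
    then have nj: "j \<notin> set c1" "j \<notin> set c2" "set c2 \<subseteq> V" using cs by auto
    let ?v = "W (rev c2) (simple_root j)"
    have "W cs ?v = W c1 (s j (simple_root j))" using c word_action_rev'[OF nj(3)] by simp
    then have "W cs ?v j = - 1"
      using word_action_other[OF nj(1)] simple_reflection_simple_root[OF j] by (simp add: negate_def)
    moreover have "?v j = 1" using word_action_other[of j "rev c2"] nj(2) by simp
    moreover have "W us ?v j = ?v j" using word_action_other \<open>j \<notin> set us\<close> by blast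
    ultimately show False using cs(3) usV(2) by simp
  qed
  then have setus: "set us = V" using usV(1) by blast
  have "length us \<le> length cs"
    unfolding usV(3) weyl_length_def using cs by (intro Least_le) auto
  then have "distinct us"
    using setus cs distinct_card card_distinct card_length by (metis le_antisym)
  then have "W us = W ws"
    using adapted_action_cong[OF h us(2), of ws] ws setus
    by (auto simp: coxeter_word_def count_list_distinct)
  then show "w = W ws" using usV(2) by simp
qed

abbreviation cox where "cox \<eta> \<equiv> coxeter_of_quiver T (quiver_of \<eta>)"

lemma coxeter_conjugate_step:
  assumes "height \<eta>" "source \<eta> i" "i \<in> V"
  shows "cox \<eta> (s i v) = s i (cox (lower i \<eta>) v)"
proof -
  obtain us where us: "coxeter_word \<eta> (i # us)" using coxeter_word_exists assms by blast
  have h: "height (lower i \<eta>)" using height_lower assms by blast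
  have ad: "adp (lower i \<eta>) us" using us adp_Cons[OF assms(1)] by (auto simp: coxeter_word_def)
  have "source (final_height (lower i \<eta>) us) i"
    using coxeter_word_quiver[OF us] assms(2) by simp
  then have "coxeter_word (lower i \<eta>) (us @ [i])"
    using us ad adp_append[OF h] by (auto simp: coxeter_word_def)
  then have "cox (lower i \<eta>) = W (us @ [i])" using coxeter_of_quiver_eq h by blast
  moreover have "cox \<eta> = W (i # us)" using coxeter_of_quiver_eq assms(1) us by blast
  ultimately show ?thesis by simp
qed

lemma coxeter_conjugate:
  "height \<eta> \<Longrightarrow> adp \<eta> us \<Longrightarrow> set us \<subseteq> V \<Longrightarrow> cox \<eta> (W us v) = W us (cox (final_height \<eta> us) v)"
proof (induction us arbitrary: \<eta>)
  case (Cons i us)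
  have src: "source \<eta> i" "adp (lower i \<eta>) us" using Cons.prems adp_Cons by blast+
  show ?case
    using Cons.IH[OF height_lower[OF Cons.prems(1) src(1)] src(2)] Cons.prems(3)
      coxeter_conjugate_step[OF Cons.prems(1) src(1)] by simp
qed simp

text \<open>
  Some Coxeter word starts with \<open>i\<close>.  It and \<open>i # us\<close> contain \<open>i\<close> only as their first letter, so both roots represent the functional that takes the
  coefficient of \<open>s\<^sub>i x\<close> at \<open>i\<close>.
\<close>

lemma return_root:
  assumes "height \<eta>" "i \<in> V" "set us \<subseteq> V" "i \<notin> set us" "adp \<eta> (i # us @ [i])"
  shows "W (i # us) (simple_root i) = cox \<eta> (simple_root i)"
proof -
  have src: "source \<eta> i" using assms(5) by simp
  have E: "E \<eta> x (W (i # vs) (simple_root i)) = s i x i"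
    if "adp \<eta> (i # vs @ [i])" "i \<notin> set vs" "set vs \<subseteq> V" for vs x
    using euler_form_root[OF assms(1), of "i # vs" i x] that assms(2) word_action_other[of i "rev vs" "s i x"] by simp
  obtain vs where vs: "coxeter_word \<eta> (i # vs)" using coxeter_word_exists assms(1,2) src by blast
  have vsV: "i \<notin> set vs" "set vs \<subseteq> V" using vs by (auto simp: coxeter_word_def)
  have "source (final_height \<eta> (i # vs)) i" using coxeter_word_quiver[OF vs] src by simp
  then have advs: "adp \<eta> (i # vs @ [i])"
    using vs adp_append[OF assms(1), of "i # vs" "[i]"] by (auto simp: coxeter_word_def)
  have "W (i # us) (simple_root i) = W (i # vs) (simple_root i)"
  proof (rule euler_form_nondegenerate[OF assms(1)])
    show "W (i # us) (simple_root i) \<in> root_lattice T" "W (i # vs) (simple_root i) \<in> root_lattice T"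
      using word_action_in_lattice[of "i # us"] word_action_in_lattice[of "i # vs"] simple_root_in_lattice
        assms(2,3) vsV by auto
    show "E \<eta> x (W (i # us) (simple_root i)) = E \<eta> x (W (i # vs) (simple_root i))" for x
      using E[OF assms(5,4,3)] E[OF advs vsV] by simp
  qed
  then show ?thesis using coxeter_of_quiver_eq[OF assms(1) vs] by simp
qed

text \<open>
  The root at an occurrence of \<open>i\<close> is the image under the Coxeter element of the root at the previous
  occurrence: after pulling back to that time, this is \<open>return_root\<close>.
\<close>

lemma occurrence_root:
  assumes "height \<eta>" "adp \<eta> (us @ [i])" "set us \<subseteq> V" "i \<in> V"
  shows "W us (simple_root i) = (cox \<eta> ^^ count_list us i) (path_root (quiver_of \<eta>) i)"
  using assms(2,3)
proof (induction "length us" arbitrary: us rule: less_induct)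
  case less
  show ?case
  proof (cases "i \<in> set us")
    case False
    then show ?thesis using first_occurrence_root[OF assms(1) less.prems(1,2) assms(4)] by simp
  next
    case True
    then obtain u1 u2 where us: "us = u1 @ i # u2" "i \<notin> set u2" by (meson split_list_last)
    have ad: "adp \<eta> u1" "adp (final_height \<eta> u1) (i # u2 @ [i])"
      using less.prems(1) us adp_append[OF assms(1), of u1 "i # u2 @ [i]"] by auto
    then have ad1: "adp \<eta> (u1 @ [i])" using adp_append[OF assms(1)] by simp
    have V: "set u1 \<subseteq> V" "set u2 \<subseteq> V" using less.prems(2) us by auto
    have "W us (simple_root i) = W u1 (W (i # u2) (simple_root i))" by (simp add: us)
    also have "\<dots> = W u1 (cox (final_height \<eta> u1) (simple_root i))"
      using return_root[OF height_final[OF assms(1) ad(1)] assms(4) V(2) us(2) ad(2)] by simp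
    also have "\<dots> = cox \<eta> (W u1 (simple_root i))"
      using coxeter_conjugate[OF assms(1) ad(1) V(1)] by simp
    also have "W u1 (simple_root i) = (cox \<eta> ^^ count_list u1 i) (path_root (quiver_of \<eta>) i)"
      using less.hyps[OF _ ad1 V(1)] us(1) by simp
    finally show ?thesis using us by simp
  qed
qed

section \<open>Coordinates along an adapted word\<close>

lemma root_list_nth_eq: "n < length ws \<Longrightarrow> rl ws ! n = W (take n ws) (simple_root (ws ! n))"
  by (simp add: root_list_nth root_of_word_def)

lemma root_list_nth_coxeter:
  assumes "height \<eta>" "adp \<eta> ws" "set ws \<subseteq> V" "n < length ws"
  shows "rl ws ! n = (cox \<eta> ^^ count_list (take n ws) (ws ! n)) (path_root (quiver_of \<eta>) (ws ! n))"
proof -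
  have ws: "ws = (take n ws @ [ws ! n]) @ drop (Suc n) ws" using assms(4) by (simp add: id_take_nth_drop)
  then have "adp \<eta> (take n ws @ [ws ! n])" using assms(1,2) adp_append by metis
  moreover have "set (take n ws) \<subseteq> V" "ws ! n \<in> V" using assms(3,4) set_take_subset nth_mem by fastforce+
  ultimately show ?thesis using occurrence_root[OF assms(1)] root_list_nth_eq[OF assms(4)] by simp
qed

lemma occurrence_position:
  "m < count_list ws i \<Longrightarrow> \<exists>n < length ws. ws ! n = i \<and> count_list (take n ws) i = m"
proof (induction ws rule: rev_induct)
  case (snoc a ws)
  show ?case
  proof (cases "m < count_list ws i")
    case True
    then obtain n where "n < length ws" "ws ! n = i" "count_list (take n ws) i = m" using snoc.IH by blast
    then show ?thesis by (intro exI[of _ n]) (simp add: nth_append)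
  next
    case False
    then have "a = i" "m = count_list ws i" using snoc.prems by (auto split: if_splits)
    then show ?thesis by (intro exI[of _ "length ws"]) simp
  qed
qed simp

text \<open>
  After a full word every root that an adapted continuation produces first is negative.  So in the sequence
  \<open>\<gamma>\<^sub>i, \<tau>(\<gamma>\<^sub>i), \<tau>\<^sup>2(\<gamma>\<^sub>i), \<dots>\<close> the first negative root comes right after those of the letters \<open>i\<close> of the word.
\<close>

lemma row_positive_iff:
  assumes "height \<eta>" "full_word ws" "adp \<eta> ws" "i \<in> V"
  shows "(\<forall>m'\<le>m. (cox \<eta> ^^ m') (path_root (quiver_of \<eta>) i) \<in> P) \<longleftrightarrow> m < count_list ws i"
proof
  assume "m < count_list ws i"
  show "\<forall>m'\<le>m. (cox \<eta> ^^ m') (path_root (quiver_of \<eta>) i) \<in> P"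
  proof (intro allI impI)
    fix m' assume "m' \<le> m"
    then have "m' < count_list ws i" using \<open>m < count_list ws i\<close> by simp
    then obtain n where n: "n < length ws" "ws ! n = i" "count_list (take n ws) i = m'"
      using occurrence_position[of m' ws i] by blast
    then have "(cox \<eta> ^^ m') (path_root (quiver_of \<eta>) i) = rl ws ! n"
      using root_list_nth_coxeter[OF assms(1,3) full_word_vertices[OF assms(2)]] by simp
    also have "\<dots> \<in> set (rl ws)" using n by simp
    finally show "(cox \<eta> ^^ m') (path_root (quiver_of \<eta>) i) \<in> P" using assms(2) by (simp add: full_word_def)
  qed
next
  assume pos: "\<forall>m'\<le>m. (cox \<eta> ^^ m') (path_root (quiver_of \<eta>) i) \<in> P"
  show "m < count_list ws i"
  proof (rule ccontr)
    assume "\<not> m < count_list ws i"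
    let ?\<zeta> = "final_height \<eta> ws"
    have h: "height ?\<zeta>" using height_final assms by blast
    obtain vs where vs: "full_word vs" "adp ?\<zeta> vs" using adapted_full_exists[OF h] by blast
    have wsV: "set ws \<subseteq> V" "set vs \<subseteq> V" using full_word_vertices assms vs by auto
    obtain v1 v2 where v: "vs = v1 @ i # v2" "i \<notin> set v1"
      using mem_full_word[OF vs(1) assms(4)] by (meson split_list_first)
    have "positive_word (v1 @ [i])"
      using positive_word_append[of "v1 @ [i]" v2] full_word_positive[OF vs(1)] v by simp
    then have p: "W v1 (simple_root i) \<in> P" by (simp add: positive_word_snoc)
    have "adp ?\<zeta> (v1 @ [i])" using vs(2) v adp_append[OF h, of "v1 @ [i]" v2] by simp
    then have "adp \<eta> ((ws @ v1) @ [i])" using adp_append[OF assms(1)] assms(3) by simp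
    then have "W (ws @ v1) (simple_root i) = (cox \<eta> ^^ count_list (ws @ v1) i) (path_root (quiver_of \<eta>) i)"
      using occurrence_root[OF assms(1), of "ws @ v1" i] wsV v assms(4) by (simp del: word_action_append)
    then have "W ws (W v1 (simple_root i)) \<in> P"
      using pos \<open>\<not> m < count_list ws i\<close> v(2) by simp
    then show False using full_word_negative[OF assms(2) p] not_both_positive by blast
  qed
qed

lemma coordinate_eq:
  assumes "height \<eta>" "full_word ws" "adp \<eta> ws" "n < length ws"
  shows "coordinate T (quiver_of \<eta>) \<xi> (rl ws ! n) = (ws ! n, \<xi> (ws ! n) - 2 * int (count_list (take n ws) (ws ! n)))"
  unfolding coordinate_def
proof (rule the_equality)
  let ?i = "ws ! n" and ?m = "count_list (take n ws) (ws ! n)"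
  have wsV: "set ws \<subseteq> V" using full_word_vertices assms by blast
  have iV: "?i \<in> V" using wsV assms(4) nth_mem by blast
  have "?m < count_list ws ?i"
    using arg_cong[OF id_take_nth_drop[OF assms(4)], of "\<lambda>us. count_list us (ws ! n)"] by simp
  then show "\<exists>i\<in>V. \<exists>m. rl ws ! n = (cox \<eta> ^^ m) (path_root (quiver_of \<eta>) i) \<and>
      (\<forall>m'\<le>m. (cox \<eta> ^^ m') (path_root (quiver_of \<eta>) i) \<in> P) \<and> (?i, \<xi> ?i - 2 * int ?m) = (i, \<xi> i - 2 * int m)"
    using row_positive_iff[OF assms(1-3) iV] root_list_nth_coxeter[OF assms(1,3) wsV assms(4)] iV by blast
  fix c assume "\<exists>i\<in>V. \<exists>m. rl ws ! n = (cox \<eta> ^^ m) (path_root (quiver_of \<eta>) i) \<and>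
      (\<forall>m'\<le>m. (cox \<eta> ^^ m') (path_root (quiver_of \<eta>) i) \<in> P) \<and> c = (i, \<xi> i - 2 * int m)"
  then obtain i m where im: "i \<in> V" "rl ws ! n = (cox \<eta> ^^ m) (path_root (quiver_of \<eta>) i)"
      "m < count_list ws i" "c = (i, \<xi> i - 2 * int m)"
    using row_positive_iff[OF assms(1-3)] by blast
  obtain k where k: "k < length ws" "ws ! k = i" "count_list (take k ws) i = m"
    using occurrence_position[OF im(3)] by metis
  then have "rl ws ! k = rl ws ! n" using im root_list_nth_coxeter[OF assms(1,3) wsV k(1)] by simp
  then have "k = n"
    using positive_word_distinct[OF full_word_positive[OF assms(2)]] k(1) assms(4) by (simp add: nth_eq_iff_index_eq)
  then show "c = (?i, \<xi> ?i - 2 * int ?m)" using im k by simp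
qed

end

section \<open>Orders along a list of roots\<close>

primrec before :: "'a list \<Rightarrow> 'a \<Rightarrow> 'a \<Rightarrow> bool" where
  "before [] a b \<longleftrightarrow> False"
| "before (x # xs) a b \<longleftrightarrow> x = a \<and> b \<in> set xs \<or> before xs a b"

lemma before_iff_nth: "before xs a b \<longleftrightarrow> (\<exists>k l. k < l \<and> l < length xs \<and> xs ! k = a \<and> xs ! l = b)"
proof (induction xs)
  case (Cons x xs)
  have "(\<exists>k l. k < l \<and> l < length (x # xs) \<and> (x # xs) ! k = a \<and> (x # xs) ! l = b) \<longleftrightarrow>
      (\<exists>l. l < length xs \<and> x = a \<and> xs ! l = b) \<or> (\<exists>k l. k < l \<and> l < length xs \<and> xs ! k = a \<and> xs ! l = b)"
    (is "?L \<longleftrightarrow> ?R")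
  proof
    assume ?L
    then obtain k l where kl: "k < l" "l < length (x # xs)" "(x # xs) ! k = a" "(x # xs) ! l = b" by blast
    then obtain l' where "l = Suc l'" by (cases l) auto
    then show ?R using kl by (cases k) auto
  next
    assume ?R
    then show ?L
    proof
      assume "\<exists>l. l < length xs \<and> x = a \<and> xs ! l = b"
      then obtain l where "l < length xs" "x = a" "xs ! l = b" by blast
      then show ?L by (intro exI[of _ 0] exI[of _ "Suc l"]) simp
    next
      assume "\<exists>k l. k < l \<and> l < length xs \<and> xs ! k = a \<and> xs ! l = b"
      then obtain k l where "k < l" "l < length xs" "xs ! k = a" "xs ! l = b" by blast
      then show ?L by (intro exI[of _ "Suc k"] exI[of _ "Suc l"]) simp
    qed
  qed
  then show ?case using Cons by (auto simp: in_set_conv_nth)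
qed simp

lemma before_set: "before xs a b \<Longrightarrow> a \<in> set xs \<and> b \<in> set xs"
  by (induction xs) auto

lemma before_filter: "p a \<Longrightarrow> p b \<Longrightarrow> before (filter p xs) a b \<longleftrightarrow> before xs a b"
  by (induction xs) auto

lemma before_map: "inj f \<Longrightarrow> before (map f xs) (f a) (f b) \<longleftrightarrow> before xs a b"
  by (induction xs) (auto simp: inj_def)

lemma before_append: "before (xs @ ys) a b \<longleftrightarrow> before xs a b \<or> before ys a b \<or> a \<in> set xs \<and> b \<in> set ys"
  by (induction xs) auto

lemma before_rev: "before (rev xs) a b \<longleftrightarrow> before xs b a"
  by (induction xs) (auto simp: before_append)

text \<open>
  Both comparisons concern the first and the last entry at which the functions differ.  In this form
  it is evident what dropping entries with equal values, reversing the list or relabelling it does.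
\<close>

definition bilex_less :: "'a list \<Rightarrow> ('a \<Rightarrow> nat) \<Rightarrow> ('a \<Rightarrow> nat) \<Rightarrow> bool" where
  "bilex_less xs m' m \<longleftrightarrow> (let ds = filter (\<lambda>v. m' v \<noteq> m v) xs in
     ds \<noteq> [] \<and> m' (hd ds) < m (hd ds) \<and> m' (last ds) < m (last ds))"

lemma bilex_less_filter:
  assumes "\<And>v. v \<in> set xs \<Longrightarrow> \<not> p v \<Longrightarrow> m' v = m v"
  shows "bilex_less (filter p xs) m' m \<longleftrightarrow> bilex_less xs m' m"
proof -
  have "filter (\<lambda>v. m' v \<noteq> m v) (filter p xs) = filter (\<lambda>v. m' v \<noteq> m v) xs"
    unfolding filter_filter using assms by (intro filter_cong) auto
  then show ?thesis by (simp add: bilex_less_def)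
qed

lemma bilex_less_map: "bilex_less (map f xs) m' m \<longleftrightarrow> bilex_less xs (m' \<circ> f) (m \<circ> f)"
  by (auto simp: bilex_less_def Let_def filter_map comp_def hd_map last_map)

lemma bilex_less_rev: "bilex_less (rev xs) m' m \<longleftrightarrow> bilex_less xs m' m"
  by (auto simp: bilex_less_def Let_def rev_filter[symmetric] hd_rev last_rev)

lemma hd_filter_nth:
  "k < length xs \<Longrightarrow> p (xs ! k) \<Longrightarrow> (\<And>t. t < k \<Longrightarrow> \<not> p (xs ! t)) \<Longrightarrow> filter p xs \<noteq> [] \<and> hd (filter p xs) = xs ! k"
proof (induction xs arbitrary: k)
  case (Cons x xs)
  show ?case
  proof (cases k)
    case 0
    then show ?thesis using Cons.prems by simp
  next
    case (Suc k')
    then have "\<not> p x" using Cons.prems(3)[of 0] by simp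
    moreover have "\<not> p (xs ! t)" if "t < k'" for t using Cons.prems(3)[of "Suc t"] that Suc by simp
    ultimately show ?thesis using Cons.IH[of k'] Cons.prems(1,2) Suc by simp
  qed
qed simp

lemma filter_hd_nth:
  assumes "filter p xs \<noteq> []"
  shows "\<exists>k<length xs. p (xs ! k) \<and> (\<forall>t<k. \<not> p (xs ! t)) \<and> hd (filter p xs) = xs ! k"
proof -
  have ex: "\<exists>k. k < length xs \<and> p (xs ! k)" using assms by (auto simp: filter_empty_conv in_set_conv_nth)
  define k where "k = (LEAST k. k < length xs \<and> p (xs ! k))"
  have k: "k < length xs" "p (xs ! k)" using LeastI_ex[OF ex] by (auto simp: k_def)
  have least: "\<not> p (xs ! t)" if "t < k" for t
    using not_less_Least[OF that[unfolded k_def]] that k(1) by auto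
  then show ?thesis using k hd_filter_nth[of k xs p] by blast
qed

lemma last_filter_nth:
  assumes "k < length xs" "p (xs ! k)" "\<And>t. k < t \<Longrightarrow> t < length xs \<Longrightarrow> \<not> p (xs ! t)"
  shows "last (filter p xs) = xs ! k"
proof -
  let ?k = "length xs - Suc k"
  have "hd (filter p (rev xs)) = rev xs ! ?k"
  proof (rule conjunct2[OF hd_filter_nth])
    show "?k < length (rev xs)" using assms(1) by simp
    show "p (rev xs ! ?k)" using assms(1,2) by (simp add: rev_nth)
    fix t assume "t < ?k"
    then show "\<not> p (rev xs ! t)" using assms(3)[of "length xs - Suc t"] assms(1) by (simp add: rev_nth)
  qed
  then show ?thesis using assms(1) by (simp add: rev_nth rev_filter[symmetric] hd_rev)
qed

lemma filter_last_nth: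
  assumes "filter p xs \<noteq> []"
  shows "\<exists>k<length xs. p (xs ! k) \<and> (\<forall>t. k < t \<and> t < length xs \<longrightarrow> \<not> p (xs ! t)) \<and> last (filter p xs) = xs ! k"
proof -
  have "filter p (rev xs) \<noteq> []" using assms by (simp add: filter_empty_conv)
  then obtain k where k: "k < length xs" "p (rev xs ! k)" "\<forall>t<k. \<not> p (rev xs ! t)"
    using filter_hd_nth[of p "rev xs"] by auto
  let ?k = "length xs - Suc k"
  have 1: "?k < length xs" "p (xs ! ?k)" using k(1,2) by (auto simp: rev_nth)
  have 2: "\<not> p (xs ! t)" if "?k < t" "t < length xs" for t
    using k(3)[rule_format, of "length xs - Suc t"] that k(1) by (auto simp: rev_nth)
  show ?thesis using 1 2 last_filter_nth[of ?k xs p] by blast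
qed

lemma bilex_less_iff_nth:
  "bilex_less xs m' m \<longleftrightarrow> (\<exists>k s. k \<le> s \<and> s < length xs \<and>
     (\<forall>t<k. m' (xs ! t) = m (xs ! t)) \<and> m' (xs ! k) < m (xs ! k) \<and>
     (\<forall>t. s < t \<and> t < length xs \<longrightarrow> m' (xs ! t) = m (xs ! t)) \<and> m' (xs ! s) < m (xs ! s))"
  (is "?L \<longleftrightarrow> ?R")
proof
  let ?p = "\<lambda>v. m' v \<noteq> m v"
  assume ?L
  then have ne: "filter ?p xs \<noteq> []" and h: "m' (hd (filter ?p xs)) < m (hd (filter ?p xs))"
    and l: "m' (last (filter ?p xs)) < m (last (filter ?p xs))"
    by (auto simp: bilex_less_def Let_def)
  obtain k where k: "k < length xs" "?p (xs ! k)" "\<forall>t<k. \<not> ?p (xs ! t)" "hd (filter ?p xs) = xs ! k"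
    using filter_hd_nth[OF ne] by blast
  obtain s where s: "s < length xs" "?p (xs ! s)" "\<forall>t. s < t \<and> t < length xs \<longrightarrow> \<not> ?p (xs ! t)"
      "last (filter ?p xs) = xs ! s"
    using filter_last_nth[OF ne] by blast
  have "k \<le> s" using k(1,2) s(3) not_less by blast
  then show ?R using k s h l by (intro exI[of _ k] exI[of _ s]) auto
next
  let ?p = "\<lambda>v. m' v \<noteq> m v"
  assume ?R
  then obtain k s where ks: "k \<le> s" "s < length xs" "\<forall>t<k. m' (xs ! t) = m (xs ! t)" "m' (xs ! k) < m (xs ! k)"
    "\<forall>t. s < t \<and> t < length xs \<longrightarrow> m' (xs ! t) = m (xs ! t)" "m' (xs ! s) < m (xs ! s)" by blast
  have "filter ?p xs \<noteq> [] \<and> hd (filter ?p xs) = xs ! k" using ks by (intro hd_filter_nth) auto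
  moreover have "last (filter ?p xs) = xs ! s" using ks by (intro last_filter_nth) auto
  ultimately show ?L using ks by (simp add: bilex_less_def)
qed

definition comparable :: "dynkin \<Rightarrow> quiver \<Rightarrow> lattice \<Rightarrow> lattice \<Rightarrow> bool" where
  "comparable T Q a b \<longleftrightarrow> root_less T Q a b \<or> root_less T Q b a"

lemma comparable_sym: "comparable T Q a b \<longleftrightarrow> comparable T Q b a"
  by (auto simp: comparable_def)

context finite_type
begin

lemma root_less_word_iff: "root_less_word T ws a b \<longleftrightarrow> before (rl ws) a b"
  unfolding root_less_word_def before_iff_nth using root_list_nth by (metis length_root_list order_less_trans)

lemma seq_less_word_iff: "seq_less_word T ws m' m \<longleftrightarrow> weight T m' = weight T m \<and> bilex_less (rl ws) m' m"
proof -
  have "(let \<beta> = root_of_word T ws in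
      \<exists>k s. k \<le> s \<and> s < length ws \<and>
        (\<forall>t<k. m' (\<beta> t) = m (\<beta> t)) \<and> m' (\<beta> k) < m (\<beta> k) \<and>
        (\<forall>t. s < t \<and> t < length ws \<longrightarrow> m' (\<beta> t) = m (\<beta> t)) \<and> m' (\<beta> s) < m (\<beta> s)) \<longleftrightarrow> bilex_less (rl ws) m' m"
    unfolding Let_def bilex_less_iff_nth length_root_list
    by (intro iff_exI conj_cong refl) (auto simp: root_list_nth)
  then show ?thesis unfolding seq_less_word_def by simp
qed

lemma adapted_class_quiver_of: "ws \<in> adapted_class T (quiver_of \<eta>) \<longleftrightarrow> full_word ws \<and> adp \<eta> ws"
  by (rule adapted_class_iff)

section \<open>Transport of the orders along a linear map\<close>

definition supported_in :: "lattice set \<Rightarrow> multiplicity \<Rightarrow> bool" where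
  "supported_in A m \<longleftrightarrow> (\<forall>v. v \<notin> A \<longrightarrow> m v = 0)"

lemma sequences_iff: "m \<in> sequences T \<longleftrightarrow> supported_in P m"
  by (simp add: sequences_def supported_in_def)

text \<open>
  Every adapted word of \<open>Q\<close> has a partner for \<open>Q'\<close> that lists the roots in \<open>B\<close> as the images of those in \<open>A\<close>, in
  the same order or, if \<open>b\<close> holds, in the opposite one.  By the last condition everything below a sequence
  supported in \<open>A\<close> is supported in \<open>A\<close> as well, so its distance can be computed inside \<open>A\<close>.
\<close>

definition order_transport ::
    "(lattice \<Rightarrow> lattice) \<Rightarrow> (lattice \<Rightarrow> lattice) \<Rightarrow> lattice set \<Rightarrow> lattice set \<Rightarrow> quiver \<Rightarrow> quiver \<Rightarrow> bool \<Rightarrow> bool" where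
  "order_transport f g A B Q Q' b \<longleftrightarrow>
     linear_map f \<and> (\<forall>v. g (f v) = v) \<and> (\<forall>v. f (g v) = v) \<and> A \<subseteq> P \<and> B \<subseteq> P \<and> f ` A = B \<and>
     (\<forall>ws\<in>adapted_class T Q. \<exists>ws'\<in>adapted_class T Q'.
        filter (\<lambda>v. v \<in> B) (rl ws') = (if b then rev else id) (map f (filter (\<lambda>v. v \<in> A) (rl ws)))) \<and>
     (\<forall>m m'. supported_in A m \<longrightarrow> supported_in P m' \<longrightarrow> seq_less T Q m' m \<longrightarrow> supported_in A m')"

lemma bilex_less_transport:
  assumes "order_transport f g A B Q Q' b"
    and "filter (\<lambda>v. v \<in> B) (rl ws') = (if b then rev else id) (map f (filter (\<lambda>v. v \<in> A) (rl ws)))"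
    and "supported_in A m" "supported_in A m'"
  shows "bilex_less (rl ws') (m' \<circ> g) (m \<circ> g) \<longleftrightarrow> bilex_less (rl ws) m' m"
proof -
  have gf: "g (f v) = v" "f (g v) = v" for v using assms(1) by (auto simp: order_transport_def)
  have fA: "f ` A = B" using assms(1) by (simp add: order_transport_def)
  have z: "m (g v) = 0" "m' (g v) = 0" if "v \<notin> B" for v
    using that fA gf(2) assms(3,4) unfolding supported_in_def by (metis image_eqI)+
  have "bilex_less (rl ws') (m' \<circ> g) (m \<circ> g) \<longleftrightarrow> bilex_less (filter (\<lambda>v. v \<in> B) (rl ws')) (m' \<circ> g) (m \<circ> g)"
    using z by (intro bilex_less_filter[symmetric]) simp
  also have "\<dots> \<longleftrightarrow> bilex_less (map f (filter (\<lambda>v. v \<in> A) (rl ws))) (m' \<circ> g) (m \<circ> g)"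
    unfolding assms(2) by (simp add: bilex_less_rev)
  also have "\<dots> \<longleftrightarrow> bilex_less (filter (\<lambda>v. v \<in> A) (rl ws)) m' m"
    unfolding bilex_less_map by (simp add: comp_def gf)
  also have "\<dots> \<longleftrightarrow> bilex_less (rl ws) m' m"
    using assms(3,4) by (intro bilex_less_filter) (auto simp: supported_in_def)
  finally show ?thesis .
qed

lemma weight_transport:
  assumes "order_transport f g A B Q Q' b" "supported_in A m"
  shows "weight T (m \<circ> g) = f (weight T m)"
proof -
  have gf: "g (f v) = v" "f (g v) = v" for v using assms(1) by (auto simp: order_transport_def)
  have AB: "f ` A = B" "A \<subseteq> P" "B \<subseteq> P" "linear_map f" using assms(1) by (auto simp: order_transport_def)
  have z: "m (g v) = 0" if "v \<notin> B" for v
    using that AB(1) gf(2) assms(2) unfolding supported_in_def by (metis image_eqI)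
  have "f (weight T m) = (\<lambda>j. \<Sum>v\<in>P. int (m v) * f v j)"
    unfolding weight_def by (rule linear_map_sum[OF AB(4) finite_P])
  also have "\<dots> = (\<lambda>j. \<Sum>v\<in>A. int (m v) * f v j)"
    using assms(2) AB(2) by (intro ext sum.mono_neutral_right) (auto simp: supported_in_def)
  also have "\<dots> = (\<lambda>j. \<Sum>v\<in>B. int (m (g v)) * v j)"
  proof
    fix j
    have "inj_on f A" by (metis gf(1) inj_onI)
    then show "(\<Sum>v\<in>A. int (m v) * f v j) = (\<Sum>v\<in>B. int (m (g v)) * v j)"
      unfolding AB(1)[symmetric] by (simp add: sum.reindex gf)
  qed
  also have "\<dots> = weight T (m \<circ> g)"
    unfolding weight_def comp_apply using z AB(3) by (intro ext sum.mono_neutral_left) auto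
  finally show ?thesis by simp
qed

lemma supported_in_transport:
  assumes "order_transport f g A B Q Q' b" "supported_in A m"
  shows "supported_in B (m \<circ> g)"
proof -
  have "f (g v) = v" for v using assms(1) by (auto simp: order_transport_def)
  moreover have "f ` A = B" using assms(1) by (simp add: order_transport_def)
  ultimately show ?thesis using assms(2) unfolding supported_in_def by (metis comp_apply image_eqI)
qed

lemma supported_in_mono: "supported_in A m \<Longrightarrow> A \<subseteq> B \<Longrightarrow> supported_in B m"
  by (auto simp: supported_in_def)

lemma seq_less_transport1:
  assumes tr: "order_transport f g A B Q Q' b" and "supported_in A m" "supported_in A m'"
    and less: "seq_less T Q' (m' \<circ> g) (m \<circ> g)"
  shows "seq_less T Q m' m"
  unfolding seq_less_def
proof
  fix ws assume ws: "ws \<in> adapted_class T Q"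
  obtain ws' where ws': "ws' \<in> adapted_class T Q'"
      "filter (\<lambda>v. v \<in> B) (rl ws') = (if b then rev else id) (map f (filter (\<lambda>v. v \<in> A) (rl ws)))"
    using tr ws unfolding order_transport_def by blast
  have "seq_less_word T ws' (m' \<circ> g) (m \<circ> g)" using less ws'(1) by (simp add: seq_less_def)
  then have "weight T (m' \<circ> g) = weight T (m \<circ> g)" "bilex_less (rl ws) m' m"
    using bilex_less_transport[OF tr ws'(2) assms(2,3)] by (auto simp: seq_less_word_iff)
  moreover have "g (f v) = v" for v using tr by (auto simp: order_transport_def)
  ultimately show "seq_less_word T ws m' m"
    using weight_transport[OF tr assms(2)] weight_transport[OF tr assms(3)] by (metis seq_less_word_iff)
qed

lemma comparable_transport1:
  assumes tr: "order_transport f g A B Q Q' b" and "u \<in> A" "v \<in> A" and c: "comparable T Q' (f u) (f v)"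
  shows "comparable T Q u v"
proof -
  have less: "if b then root_less T Q v u else root_less T Q u v"
    if "u \<in> A" "v \<in> A" "root_less T Q' (f u) (f v)" for u v
  proof -
    have "g (f v) = v" for v using tr by (auto simp: order_transport_def)
    then have inj: "inj f" by (metis injI)
    have B: "f u \<in> B" "f v \<in> B" using tr that by (auto simp: order_transport_def)
    have "if b then before (rl ws) v u else before (rl ws) u v" if ws: "ws \<in> adapted_class T Q" for ws
    proof -
      obtain ws' where ws': "ws' \<in> adapted_class T Q'"
        "filter (\<lambda>v. v \<in> B) (rl ws') = (if b then rev else id) (map f (filter (\<lambda>v. v \<in> A) (rl ws)))"
        using tr ws unfolding order_transport_def by blast
      have "before (rl ws') (f u) (f v)"
        using \<open>root_less T Q' (f u) (f v)\<close> ws'(1) by (simp add: root_less_def root_less_word_iff)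
      then have "before (filter (\<lambda>v. v \<in> B) (rl ws')) (f u) (f v)" using B by (simp add: before_filter)
      then show ?thesis
        unfolding ws'(2) using \<open>u \<in> A\<close> \<open>v \<in> A\<close>
        by (auto simp: before_rev before_map[OF inj] before_filter split: if_splits)
    qed
    then show ?thesis by (auto simp: root_less_def root_less_word_iff)
  qed
  show ?thesis using c less[OF assms(2,3)] less[OF assms(3,2)] unfolding comparable_def by (auto split: if_splits)
qed

text \<open>
  The condition in the definition of \<open>gdist\<close>, which is the greatest such \<open>k\<close>.
\<close>

definition chain_to :: "quiver \<Rightarrow> multiplicity \<Rightarrow> nat \<Rightarrow> bool" where
  "chain_to Q m k \<longleftrightarrow> (\<exists>c :: nat \<Rightarrow> multiplicity.
     (\<forall>j\<le>k. c j \<in> sequences T) \<and> simple_seq T Q (c 0) \<and> c k = m \<and>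
     (\<forall>j<k. seq_less T Q (c j) (c (Suc j))))"

lemma gdist_chain_to: "gdist T Q m = (GREATEST k. chain_to Q m k)"
  by (simp add: gdist_def chain_to_def)

lemma chain_to_transport1:
  assumes tr: "order_transport f g A B Q Q' b" and tr': "order_transport g f B A Q' Q b"
    and m: "supported_in A m" and chain: "chain_to Q m k"
  shows "chain_to Q' (m \<circ> g) k"
proof -
  obtain c where c: "\<forall>j\<le>k. c j \<in> sequences T" "simple_seq T Q (c 0)" "c k = m"
      "\<forall>j<k. seq_less T Q (c j) (c (Suc j))" using chain by (auto simp: chain_to_def)
  have gf: "g (f v) = v" for v using tr by (auto simp: order_transport_def)
  then have g: "(n \<circ> g) \<circ> f = n" for n :: multiplicity by (auto simp: comp_def)
  have fg: "f (g v) = v" for v using tr by (auto simp: order_transport_def)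
  then have fgn: "(n \<circ> f) \<circ> g = n" for n :: multiplicity by (auto simp: comp_def)
  have AP: "A \<subseteq> P" "B \<subseteq> P" using tr by (auto simp: order_transport_def)
  have closed: "supported_in A n'" if "supported_in A n" "supported_in P n'" "seq_less T Q n' n" for n n'
    using tr that unfolding order_transport_def by blast
  have closed': "supported_in B n'" if "supported_in B n" "supported_in P n'" "seq_less T Q' n' n" for n n'
    using tr' that unfolding order_transport_def by blast
  have supp: "supported_in A (c j)" if "j \<le> k" for j
    using that
  proof (induction "k - j" arbitrary: j)
    case 0
    then show ?case using c(3) m by simp
  next
    case (Suc d)
    then have "supported_in A (c (Suc j))" by simp
    moreover have "seq_less T Q (c j) (c (Suc j))" using Suc.hyps(2) c(4) by simp
    moreover have "supported_in P (c j)" using c(1) Suc.prems sequences_iff by blast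
    ultimately show ?case using closed by blast
  qed
  have seq: "(c j \<circ> g) \<in> sequences T" if "j \<le> k" for j
    using supported_in_transport[OF tr supp[OF that]] AP(2) supported_in_mono sequences_iff by blast
  have step: "seq_less T Q' (c j \<circ> g) (c (Suc j) \<circ> g)" if "j < k" for j
    using seq_less_transport1[OF tr' supported_in_transport[OF tr supp[of "Suc j"]] supported_in_transport[OF tr supp[of j]]]
      that c(4) g by simp
  have "\<not> seq_less T Q' n (c 0 \<circ> g)" if n: "n \<in> sequences T" for n
  proof
    assume less: "seq_less T Q' n (c 0 \<circ> g)"
    then have nB: "supported_in B n"
      using closed'[OF supported_in_transport[OF tr supp[of 0]]] n sequences_iff by simp
    then have nA: "supported_in A (n \<circ> f)" using supported_in_transport[OF tr'] by blast
    have "seq_less T Q (n \<circ> f) (c 0)"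
      using seq_less_transport1[OF tr supp[of 0] nA] less fgn by simp
    moreover have "(n \<circ> f) \<in> sequences T" using nA AP(1) supported_in_mono sequences_iff by blast
    ultimately show False using c(2) unfolding simple_seq_def by blast
  qed
  then have "simple_seq T Q' (c 0 \<circ> g)" using seq[of 0] unfolding simple_seq_def by blast
  then show ?thesis
    unfolding chain_to_def using seq step c(3) by (intro exI[of _ "\<lambda>j. c j \<circ> g"]) auto
qed

text \<open>
  The chains that end in corresponding sequences correspond to each other.
\<close>

lemma gdist_transport:
  assumes tr: "order_transport f g A B Q Q' b" and tr': "order_transport g f B A Q' Q b"
    and m: "supported_in A m"
  shows "gdist T Q' (m \<circ> g) = gdist T Q m"
proof -
  have "(m \<circ> g) \<circ> f = m" using tr by (auto simp: order_transport_def comp_def)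
  then have "chain_to Q' (m \<circ> g) k \<longleftrightarrow> chain_to Q m k" for k
    using chain_to_transport1[OF tr tr' m] chain_to_transport1[OF tr' tr supported_in_transport[OF tr m]] by metis
  then show ?thesis by (simp add: gdist_chain_to)
qed

lemma pair_transport:
  assumes tr: "order_transport f g A B Q Q' b" and tr': "order_transport g f B A Q' Q b"
    and uv: "u \<in> A" "v \<in> A"
  shows "gdist T Q' (pair_seq (f u) (f v)) = gdist T Q (pair_seq u v)"
    and "comparable T Q' (f u) (f v) \<longleftrightarrow> comparable T Q u v"
proof -
  have gf: "g (f w) = w" "f (g w) = w" for w using tr by (auto simp: order_transport_def)
  have "pair_seq u v \<circ> g = pair_seq (f u) (f v)"
    unfolding pair_seq_def comp_def by (intro ext) (metis gf)
  then show "gdist T Q' (pair_seq (f u) (f v)) = gdist T Q (pair_seq u v)"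
    using gdist_transport[OF tr tr', of "pair_seq u v"] uv by (auto simp: supported_in_def pair_seq_def)
  have "f u \<in> B" "f v \<in> B" using tr uv by (auto simp: order_transport_def)
  then show "comparable T Q' (f u) (f v) \<longleftrightarrow> comparable T Q u v"
    using comparable_transport1[OF tr uv] comparable_transport1[OF tr', of "f u" "f v"] gf by auto
qed

end

context finite_type
begin

section \<open>Opposite vertices\<close>

abbreviation w0 where "w0 \<equiv> longest_element T"

lemma longest_element_full: "full_word ws \<Longrightarrow> W ws = w0"
  using longest_element_eq by simp

lemma longest_element_rev: "full_word ws \<Longrightarrow> W (rev ws) = w0"
  using longest_element_full[OF full_word_rev] .

lemma longest_element_invol [simp]: "w0 (w0 v) = v"
proof -
  obtain ws where ws: "full_word ws" using full_word_exists by blast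
  then show ?thesis
    using word_action_rev[OF full_word_vertices[OF ws], of v] longest_element_full longest_element_rev by simp
qed

lemma longest_element_linear: "linear_map w0"
  using full_word_exists longest_element_full word_action_linear by metis

lemma longest_element_negate: "w0 (negate v) = negate (w0 v)"
  using linear_map_negate[OF longest_element_linear] .

lemma full_word_cong:
  assumes "full_word ws" "set us \<subseteq> V" "W us = W ws" "length us = length ws"
  shows "full_word us"
proof -
  have "reduced_expression T w0 ws" using assms(1) reduced_longest_iff by blast
  then have "reduced_expression T w0 us" using assms by (simp add: reduced_expression_def)
  then show ?thesis using reduced_longest_iff by blast
qed

text \<open>
  The involution of the diagram that the longest element induces, as a relation.
\<close>

definition opposite :: "nat \<Rightarrow> nat \<Rightarrow> bool" where
  "opposite i j \<longleftrightarrow> i \<in> V \<and> j \<in> V \<and> w0 (simple_root j) = negate (simple_root i)"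

lemma opposite_sym: "opposite i j \<longleftrightarrow> opposite j i"
proof -
  have "opposite j i" if "opposite i j" for i j
  proof -
    have "simple_root j = w0 (negate (simple_root i))"
      using that longest_element_invol[of "simple_root j"] by (simp add: opposite_def)
    then show ?thesis using that longest_element_negate by (simp add: opposite_def)
  qed
  then show ?thesis by blast
qed

lemma opposite_unique:
  assumes "opposite i j" "opposite i j'"
  shows "j = j'"
  using assms longest_element_invol unfolding opposite_def by (metis simple_root_inject)

lemma reflection_image:
  assumes i: "i \<in> V"
  shows "s i ` (P - {simple_root i}) = P - {simple_root i}"
proof -
  have sub: "s i u \<in> P - {simple_root i}" if "u \<in> P - {simple_root i}" for u
  proof -
    have "s i u \<noteq> simple_root i"
    proof
      assume "s i u = simple_root i"
      then have "u = s i (simple_root i)" using i by (metis simple_reflection_invol)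
      then have "u = negate (simple_root i)" using simple_reflection_simple_root[OF i] by simp
      then show False using that simple_root_positive[OF i] not_both_positive by blast
    qed
    then show ?thesis using that reflection_positive[OF i] by blast
  qed
  have "v \<in> s i ` (P - {simple_root i})" if "v \<in> P - {simple_root i}" for v
    using sub[OF that] i by (intro image_eqI[of _ _ "s i v"]) auto
  then show ?thesis using sub by (intro equalityI image_subsetI subsetI)
qed

lemma full_word_Cons_roots:
  assumes "full_word (i # us)"
  shows "positive_word us" "set (rl us) = P - {simple_root i}" "simple_root i \<in> P" "i \<in> V"
proof -
  show "positive_word us" using positive_word_tl full_word_positive[OF assms] by blast
  show i: "i \<in> V" using full_word_vertices[OF assms] by simp
  then show "simple_root i \<in> P" by (rule simple_root_positive)
  have "distinct (rl (i # us))" using positive_word_distinct full_word_positive[OF assms] by blast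
  then have "simple_root i \<notin> s i ` set (rl us)" by simp
  moreover have "insert (simple_root i) (s i ` set (rl us)) = P" using assms by (simp add: full_word_def)
  ultimately have "s i ` set (rl us) = P - {simple_root i}" by blast
  then have "s i ` s i ` set (rl us) = P - {simple_root i}" using reflection_image[OF i] by simp
  then show "set (rl us) = P - {simple_root i}" using i by (simp add: image_image)
qed

text \<open>
  The letters \<open>us\<close> already use every positive root except \<open>\<alpha>\<^sub>i\<close>, so this is the root that the last letter adds.
\<close>

lemma full_word_rotate_root:
  assumes "full_word (i # us)" "positive_word (us @ [j])"
  shows "full_word (us @ [j])" "W us (simple_root j) = simple_root i" "opposite i j"
proof -
  note f = full_word_Cons_roots[OF assms(1)]
  show fu: "full_word (us @ [j])"
    using assms by (simp add: full_word_iff)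
  have "distinct (rl (us @ [j]))" using positive_word_distinct assms(2) by blast
  then have "W us (simple_root j) \<notin> set (rl us)" by (simp add: root_list_append)
  moreover have "W us (simple_root j) \<in> P" "j \<in> V" using assms(2) by (auto simp: positive_word_snoc)
  ultimately show r: "W us (simple_root j) = simple_root i" using f(2) by blast
  have "w0 (simple_root j) = s i (W us (simple_root j))"
    using longest_element_full[OF assms(1)] by (metis comp_apply word_action_Cons)
  then show "opposite i j"
    using r simple_reflection_simple_root[OF f(4)] f(4) \<open>j \<in> V\<close> by (simp add: opposite_def)
qed

lemma opposite_exists:
  assumes "i \<in> V"
  shows "\<exists>j. opposite i j"
proof -
  have "positive_word [i]" using assms simple_root_positive by (simp add: positive_word_def)
  then obtain us where us: "full_word (i # us)" using positive_word_extend[of "[i]"] by auto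
  then obtain vs where vs: "full_word (us @ vs)" using positive_word_extend full_word_Cons_roots(1) by blast
  have "length vs = 1" using us vs by (simp add: full_word_iff)
  then obtain j where "vs = [j]" by (cases vs) auto
  then show ?thesis using full_word_rotate_root(3)[OF us] full_word_positive[OF vs] by blast
qed

text \<open>
  Without its first letter \<open>i\<close>, an adapted full word is adapted to the reflected quiver and one letter short of
  a full word.
\<close>

lemma adapted_rotate:
  assumes "height \<eta>" "full_word (i # us)" "adp \<eta> (i # us)"
  shows "\<exists>j. full_word (us @ [j]) \<and> adp (lower i \<eta>) (us @ [j]) \<and> W us (simple_root j) = simple_root i \<and> opposite i j"
proof -
  have src: "source \<eta> i" "adp (lower i \<eta>) us" using assms(1,3) adp_Cons by blast+
  have h: "height (lower i \<eta>)" using height_lower assms(1) src(1) by blast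
  have "\<not> full_word us" using assms(2) by (simp add: full_word_iff)
  then obtain j where j: "positive_word (us @ [j])" "adp (lower i \<eta>) (us @ [j])"
    using adapted_extend_one[OF h src(2) full_word_Cons_roots(1)[OF assms(2)]] by blast
  then show ?thesis using full_word_rotate_root[OF assms(2) j(1)] by blast
qed

section \<open>Bottoms of rows and reversal of words\<close>

lemma count_full_word:
  assumes "height \<eta>" "full_word us" "adp \<eta> us" "full_word ws" "adp \<eta> ws" "i \<in> V"
  shows "count_list us i = count_list ws i"
  using row_positive_iff[OF assms(1-3,6)] row_positive_iff[OF assms(1,4-6)]
  by (metis less_irrefl linorder_neqE_nat)

text \<open>
  One step below the last point of each row.  The chosen word does not matter: see \<open>bottom_eq\<close>.
\<close>

definition bottom :: "(nat \<Rightarrow> int) \<Rightarrow> nat \<Rightarrow> int" where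
  "bottom \<eta> = final_height \<eta> (SOME ws. full_word ws \<and> adp \<eta> ws)"

lemma bottom_eq:
  assumes "height \<eta>" "full_word ws" "adp \<eta> ws" "i \<in> V"
  shows "final_height \<eta> ws i = bottom \<eta> i"
proof -
  have "full_word (SOME ws. full_word ws \<and> adp \<eta> ws) \<and> adp \<eta> (SOME ws. full_word ws \<and> adp \<eta> ws)"
    using assms(2,3) by (intro someI[of "\<lambda>ws. full_word ws \<and> adp \<eta> ws" ws]) simp
  then show ?thesis
    using count_full_word[OF assms(1-3) _ _ assms(4)] by (simp add: bottom_def final_height_def)
qed

text \<open>
  Rotating a full word that starts with \<open>i\<close> removes a point from the top of row \<open>i\<close> and adds one below the
  row of the opposite vertex.
\<close>

lemma bottom_lower:
  assumes "height \<eta>" "source \<eta> i" "i \<in> V" "l \<in> V"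
  shows "bottom (lower i \<eta>) l = bottom \<eta> l - (if opposite i l then 2 else 0)"
proof -
  obtain us where us: "full_word (i # us)" "adp \<eta> (i # us)"
    using adapted_full_from_source assms(1-3) by blast
  obtain j where j: "full_word (us @ [j])" "adp (lower i \<eta>) (us @ [j])" "opposite i j"
    using adapted_rotate[OF assms(1) us] by blast
  have h: "height (lower i \<eta>)" using height_lower assms by blast
  have "bottom (lower i \<eta>) l = final_height (lower i \<eta>) (us @ [j]) l"
    using bottom_eq[OF h j(1,2) assms(4)] by simp
  also have "\<dots> = final_height \<eta> (i # us) l - (if l = j then 2 else 0)"
    by (auto simp: final_height_append lower_def)
  also have "final_height \<eta> (i # us) l = bottom \<eta> l" using bottom_eq[OF assms(1) us assms(4)] .
  also have "l = j \<longleftrightarrow> opposite i l" using j(3) opposite_unique by blast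
  finally show ?thesis .
qed

text \<open>
  A source becomes a sink by its reflection, hence a source of the reversed quiver.
\<close>

lemma adp_rev:
  "height \<eta> \<Longrightarrow> adp \<eta> ws \<Longrightarrow> adp (\<lambda>i. - final_height \<eta> ws i) (rev ws)"
proof (induction ws arbitrary: \<eta>)
  case (Cons i ws)
  let ?\<eta>' = "lower i \<eta>"
  have src: "source \<eta> i" "adp ?\<eta>' ws" using Cons.prems adp_Cons by blast+
  have h: "height ?\<eta>'" using height_lower Cons.prems(1) src(1) by blast
  let ?\<zeta> = "\<lambda>j. - final_height ?\<eta>' ws j"
  have hz: "height ?\<zeta>" using height_minus height_final h src(2) by blast
  have "final_height ?\<zeta> (rev ws) = (\<lambda>j. - ?\<eta>' j)" by (auto simp: final_height_def)
  moreover have "source (\<lambda>j. - ?\<eta>' j) i"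
    unfolding source_iff[OF height_minus[OF h]]
  proof (intro allI impI)
    fix j assume e: "{i, j} \<in> dynkin_edges T"
    then have "j \<noteq> i" using edge_vertices by blast
    then show "- ?\<eta>' j = - ?\<eta>' i - 1" using e src(1) source_iff[OF Cons.prems(1)] by (simp add: lower_def)
  qed
  ultimately show ?case using Cons.IH[OF h src(2)] adp_append[OF hz] by simp
qed simp

text \<open>
  A height function of the reverse of the quiver that is reached after a full adapted word.
\<close>

definition dual :: "(nat \<Rightarrow> int) \<Rightarrow> nat \<Rightarrow> int" where
  "dual \<eta> = (\<lambda>i. - bottom \<eta> i)"

lemma height_cong: "height \<eta> \<Longrightarrow> (\<And>i. i \<in> V \<Longrightarrow> \<eta> i = \<zeta> i) \<Longrightarrow> height \<zeta>"
  unfolding height_def using edge_vertices by metis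

lemma height_dual: assumes "height \<eta>" shows "height (dual \<eta>)"
proof -
  obtain ws where ws: "full_word ws" "adp \<eta> ws" using adapted_full_exists assms by blast
  then have "height (\<lambda>i. - final_height \<eta> ws i)" using height_minus height_final assms by blast
  then show ?thesis by (rule height_cong) (simp add: dual_def bottom_eq[OF assms ws])
qed

lemma adp_dual:
  assumes "height \<eta>" "full_word ws" "adp \<eta> ws"
  shows "adp (dual \<eta>) (rev ws)"
proof -
  have "quiver_of (dual \<eta>) = quiver_of (\<lambda>i. - final_height \<eta> ws i)"
    using bottom_eq[OF assms] by (intro quiver_of_cong) (simp add: dual_def)
  then show ?thesis using adp_rev[OF assms(1,3)] by simp
qed

lemma bottom_dual:
  assumes "height \<eta>" "i \<in> V"
  shows "bottom (dual \<eta>) i = - \<eta> i"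
proof -
  obtain ws where ws: "full_word ws" "adp \<eta> ws" using adapted_full_exists assms by blast
  have "bottom (dual \<eta>) i = final_height (dual \<eta>) (rev ws) i"
    using bottom_eq[OF height_dual[OF assms(1)] full_word_rev[OF ws(1)] adp_dual[OF assms(1) ws] assms(2)] by simp
  then show ?thesis using bottom_eq[OF assms(1) ws assms(2)] by (simp add: final_height_def dual_def)
qed

lemma adp_dual_iff:
  assumes "height \<eta>" "full_word ws"
  shows "adp (dual \<eta>) (rev ws) \<longleftrightarrow> adp \<eta> ws"
proof
  assume "adp (dual \<eta>) (rev ws)"
  then have "adp (dual (dual \<eta>)) ws"
    using adp_dual[OF height_dual[OF assms(1)] full_word_rev[OF assms(2)]] by simp
  moreover have "quiver_of (dual (dual \<eta>)) = quiver_of \<eta>"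
    using bottom_dual[OF assms(1)] by (intro quiver_of_cong) (simp add: dual_def)
  ultimately show "adp \<eta> ws" by simp
qed (use adp_dual assms in blast)

lemma root_list_rev_full:
  assumes "full_word ws"
  shows "rl (rev ws) = rev (map (\<lambda>v. negate (w0 v)) (rl ws))"
  using root_list_rev[OF full_word_vertices[OF assms]] longest_element_rev[OF assms] by simp

section \<open>Reflection at a source and reversal\<close>

lemma full_word_source_front:
  assumes "height \<eta>" "source \<eta> i" "i \<in> V" "full_word ws" "adp \<eta> ws"
  shows "\<exists>us. full_word (i # us) \<and> adp \<eta> (i # us) \<and>
     filter (\<lambda>v. v \<noteq> simple_root i) (rl ws) = filter (\<lambda>v. v \<noteq> simple_root i) (rl (i # us))"
proof -
  obtain u1 u2 where ws: "ws = u1 @ i # u2" "i \<notin> set u1"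
    using mem_full_word[OF assms(4,3)] by (meson split_list_first)
  have V: "set u1 \<subseteq> V" "set u2 \<subseteq> V" using full_word_vertices[OF assms(4)] ws by auto
  have mv: "adp \<eta> (i # u1 @ u2)" "W ws = W (i # u1 @ u2)"
    "filter (\<lambda>v. v \<noteq> simple_root i) (rl ws) = filter (\<lambda>v. v \<noteq> simple_root i) (rl (i # u1 @ u2))"
    using move_source_to_front[OF assms(1-3) ws(2) V(1)] assms(5) unfolding ws(1) by blast+
  have "full_word (i # u1 @ u2)"
    using full_word_cong[OF assms(4), of "i # u1 @ u2"] mv(2) V assms(3) ws(1) by simp
  then show ?thesis using mv by blast
qed

text \<open>
  The reversed word is adapted to the dual height function, for which the letter of the last root is a
  source.  It can be moved to the front there.
\<close>

lemma full_word_sink_back: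
  assumes "height \<eta>" "source \<eta> i" "i \<in> V" "full_word ws" "adp (lower i \<eta>) ws"
  shows "\<exists>us j. full_word (us @ [j]) \<and> adp (lower i \<eta>) (us @ [j]) \<and> W us (simple_root j) = simple_root i \<and>
     filter (\<lambda>v. v \<noteq> simple_root i) (rl ws) = filter (\<lambda>v. v \<noteq> simple_root i) (rl (us @ [j]))"
proof -
  let ?\<zeta> = "lower i \<eta>"
  have h: "height ?\<zeta>" using height_lower assms by blast
  obtain vs where "full_word (i # vs)" "adp \<eta> (i # vs)"
    using adapted_full_from_source assms(1-3) by blast
  then obtain j where j: "full_word (vs @ [j])" "adp ?\<zeta> (vs @ [j])" "opposite i j"
    using adapted_rotate[OF assms(1)] by blast
  have jV: "j \<in> V" and w0j: "w0 (simple_root j) = negate (simple_root i)"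
    using j(3) by (auto simp: opposite_def)
  have "adp (dual ?\<zeta>) (rev (vs @ [j]))" using adp_dual[OF h j(1,2)] .
  then have src: "source (dual ?\<zeta>) j" by simp
  have "adp (dual ?\<zeta>) (rev ws)" using adp_dual[OF h assms(4,5)] .
  then obtain us where us: "full_word (j # us)" "adp (dual ?\<zeta>) (j # us)"
    "filter (\<lambda>v. v \<noteq> simple_root j) (rl (rev ws)) = filter (\<lambda>v. v \<noteq> simple_root j) (rl (j # us))"
    using full_word_source_front[OF height_dual[OF h] src jV full_word_rev[OF assms(4)]] by blast
  have f: "full_word (rev us @ [j])" using full_word_rev[OF us(1)] by simp
  have ad: "adp ?\<zeta> (rev us @ [j])" using adp_dual_iff[OF h f] us(2) by simp
  have n: "negate (w0 v) = simple_root i \<longleftrightarrow> v = simple_root j" for v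
    using w0j by (metis longest_element_invol negate_negate)
  have fl: "filter (\<lambda>v. v \<noteq> simple_root i) (rl (rev xs)) =
      rev (map (\<lambda>v. negate (w0 v)) (filter (\<lambda>v. v \<noteq> simple_root j) (rl xs)))" if "full_word xs" for xs
    unfolding root_list_rev_full[OF that] by (simp add: rev_filter[symmetric] filter_map comp_def n)
  have "filter (\<lambda>v. v \<noteq> simple_root i) (rl ws) = filter (\<lambda>v. v \<noteq> simple_root i) (rl (rev us @ [j]))"
    using fl[OF full_word_rev[OF assms(4)]] fl[OF us(1)] us(3) by simp
  moreover have "W (rev us) (simple_root j) = simple_root i"
  proof -
    have "w0 (s j (simple_root j)) = W (rev us) (simple_root j)"
      using longest_element_full[OF f, symmetric] jV by simp
    then show ?thesis using simple_reflection_simple_root[OF jV] longest_element_negate w0j by simp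
  qed
  ultimately show ?thesis using f ad by blast
qed

lemma filter_roots_front:
  assumes "full_word (i # us)"
  shows "filter (\<lambda>v. v \<noteq> simple_root i) (rl (i # us)) = map (s i) (rl us)"
proof -
  have "distinct (rl (i # us))" using positive_word_distinct full_word_positive[OF assms] by blast
  then have "simple_root i \<notin> set (map (s i) (rl us))" by simp
  then have "v \<noteq> simple_root i" if "v \<in> set (map (s i) (rl us))" for v using that by blast
  then have "filter (\<lambda>v. v \<noteq> simple_root i) (map (s i) (rl us)) = map (s i) (rl us)"
    by (intro filter_True) blast
  then show ?thesis by simp
qed

lemma filter_roots_back:
  assumes "full_word (us @ [j])" "W us (simple_root j) = simple_root i"
  shows "filter (\<lambda>v. v \<noteq> simple_root i) (rl (us @ [j])) = rl us"
proof -
  have "distinct (rl (us @ [j]))" using positive_word_distinct full_word_positive[OF assms(1)] by blast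
  then show ?thesis using assms(2) by (auto simp: root_list_append filter_id_conv)
qed

lemma full_word_rotate_back:
  assumes "full_word (us @ [j])" "W us (simple_root j) = simple_root i" "i \<in> V"
  shows "full_word (i # us)"
proof -
  have jV: "j \<in> V" and usV: "set us \<subseteq> V" using full_word_vertices[OF assms(1)] by auto
  have pos: "positive_word us" using positive_word_append full_word_positive[OF assms(1)] by blast
  have "distinct (rl (us @ [j]))" "set (rl (us @ [j])) = P"
    using assms(1) positive_word_distinct by (auto simp: full_word_def)
  then have "set (rl us) \<subseteq> P - {simple_root i}" using assms(2) by (auto simp: root_list_append)
  then have "set (rl (i # us)) \<subseteq> P"
    using reflection_positive[OF assms(3)] simple_root_positive[OF assms(3)] by auto
  then have "positive_word (i # us)" using usV assms(3) by (simp add: positive_word_def)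
  then show ?thesis using assms(1) by (simp add: full_word_iff)
qed

lemma filter_full: 
  assumes "full_word ws"
  shows "filter (\<lambda>v. v \<in> P - {a}) (rl ws) = filter (\<lambda>v. v \<noteq> a) (rl ws)"
  using assms by (intro filter_cong) (auto simp: full_word_def)

text \<open>
  Adapted full words of \<open>\<eta>\<close> may be assumed to start with \<open>i\<close>, and those of the reflected height function to
  end with the letter whose root is \<open>\<alpha>\<^sub>i\<close>.  Between \<open>i # us\<close> and \<open>us @ [j]\<close> the roots of \<open>us\<close> differ by \<open>s\<^sub>i\<close>.
\<close>

lemma move_transport:
  assumes "height \<eta>" "source \<eta> i" "i \<in> V"
  defines "A \<equiv> P - {simple_root i}"
  shows "order_transport (s i) (s i) A A (quiver_of \<eta>) (quiver_of (lower i \<eta>)) False"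
    and "order_transport (s i) (s i) A A (quiver_of (lower i \<eta>)) (quiver_of \<eta>) False"
proof -
  have h: "height (lower i \<eta>)" using height_lower assms by blast
  obtain us0 where us0: "full_word (i # us0)" "adp \<eta> (i # us0)"
    using adapted_full_from_source assms(1-3) by blast
  obtain j0 where j0: "full_word (us0 @ [j0])" "adp (lower i \<eta>) (us0 @ [j0])" "W us0 (simple_root j0) = simple_root i"
    using adapted_rotate[OF assms(1) us0] by blast
  have A: "s i ` A = A" unfolding A_def using reflection_image[OF assms(3)] .
  have AP: "A \<subseteq> P" by (auto simp: A_def)
  have basic: "linear_map (s i)" "\<forall>v. s i (s i v) = v" using simple_reflection_linear assms(3) by auto
  have fwd: "\<exists>ws'\<in>adapted_class T (quiver_of (lower i \<eta>)).
      filter (\<lambda>v. v \<in> A) (rl ws') = map (s i) (filter (\<lambda>v. v \<in> A) (rl ws))"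
    if ws: "ws \<in> adapted_class T (quiver_of \<eta>)" for ws
  proof -
    have fw: "full_word ws" "adp \<eta> ws" using ws adapted_class_quiver_of by auto
    obtain us where us: "full_word (i # us)" "adp \<eta> (i # us)"
      "filter (\<lambda>v. v \<noteq> simple_root i) (rl ws) = filter (\<lambda>v. v \<noteq> simple_root i) (rl (i # us))"
      using full_word_source_front[OF assms(1-3) fw] by blast
    obtain j where j: "full_word (us @ [j])" "adp (lower i \<eta>) (us @ [j])" "W us (simple_root j) = simple_root i"
      using adapted_rotate[OF assms(1) us(1,2)] by blast
    have "filter (\<lambda>v. v \<in> A) (rl (us @ [j])) = rl us"
      unfolding A_def filter_full[OF j(1)] using filter_roots_back[OF j(1,3)] .
    moreover have "map (s i) (filter (\<lambda>v. v \<in> A) (rl ws)) = rl us"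
      unfolding A_def filter_full[OF fw(1)] us(3) filter_roots_front[OF us(1)] using basic(2) by (simp add: comp_def)
    ultimately show ?thesis using j adapted_class_quiver_of by (intro bexI[of _ "us @ [j]"]) auto
  qed
  have bwd: "\<exists>ws'\<in>adapted_class T (quiver_of \<eta>).
      filter (\<lambda>v. v \<in> A) (rl ws') = map (s i) (filter (\<lambda>v. v \<in> A) (rl ws))"
    if ws: "ws \<in> adapted_class T (quiver_of (lower i \<eta>))" for ws
  proof -
    have fw: "full_word ws" "adp (lower i \<eta>) ws" using ws adapted_class_quiver_of by auto
    obtain us j where us: "full_word (us @ [j])" "adp (lower i \<eta>) (us @ [j])" "W us (simple_root j) = simple_root i"
      "filter (\<lambda>v. v \<noteq> simple_root i) (rl ws) = filter (\<lambda>v. v \<noteq> simple_root i) (rl (us @ [j]))"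
      using full_word_sink_back[OF assms(1-3) fw] by blast
    have f: "full_word (i # us)" using full_word_rotate_back[OF us(1,3) assms(3)] .
    have "adp \<eta> (i # us)" using adp_Cons[OF assms(1)] adp_append[OF h] us(2) assms(2) by blast
    moreover have "filter (\<lambda>v. v \<in> A) (rl (i # us)) = map (s i) (rl us)"
      unfolding A_def filter_full[OF f] using filter_roots_front[OF f] .
    moreover have "filter (\<lambda>v. v \<in> A) (rl ws) = rl us"
      unfolding A_def filter_full[OF fw(1)] us(4) using filter_roots_back[OF us(1,3)] .
    ultimately show ?thesis using f adapted_class_quiver_of by (intro bexI[of _ "i # us"]) auto
  qed
  \<comment> \<open>No smaller sequence involves a root that comes first in some adapted word, or last in one.\<close>
  have closed: "supported_in A m'" if "supported_in A m" "supported_in P m'" "m' (simple_root i) = 0" for m m'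
    using that unfolding supported_in_def A_def by blast
  have cl1: "m' (simple_root i) = 0" if "supported_in A m" "seq_less T (quiver_of \<eta>) m' m" for m m'
  proof (rule ccontr)
    assume n: "m' (simple_root i) \<noteq> 0"
    have z: "m (simple_root i) = 0" using that(1) by (simp add: supported_in_def A_def)
    have "bilex_less (rl (i # us0)) m' m"
      using that(2) us0 adapted_class_quiver_of[of "i # us0" \<eta>] seq_less_word_iff unfolding seq_less_def by blast
    then show False using n z by (auto simp: bilex_less_def Let_def)
  qed
  have cl2: "m' (simple_root i) = 0" if "supported_in A m" "seq_less T (quiver_of (lower i \<eta>)) m' m" for m m'
  proof (rule ccontr)
    assume n: "m' (simple_root i) \<noteq> 0"
    have z: "m (simple_root i) = 0" using that(1) by (simp add: supported_in_def A_def)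
    have "bilex_less (rl (us0 @ [j0])) m' m"
      using that(2) j0 adapted_class_quiver_of[of "us0 @ [j0]" "lower i \<eta>"] seq_less_word_iff unfolding seq_less_def by blast
    then show False using n z j0(3) by (auto simp: bilex_less_def Let_def root_list_append)
  qed
  have cl1': "\<forall>m m'. supported_in A m \<longrightarrow> supported_in P m' \<longrightarrow> seq_less T (quiver_of \<eta>) m' m \<longrightarrow> supported_in A m'"
    using closed cl1 by metis
  have cl2': "\<forall>m m'. supported_in A m \<longrightarrow> supported_in P m' \<longrightarrow> seq_less T (quiver_of (lower i \<eta>)) m' m \<longrightarrow> supported_in A m'"
    using closed cl2 by metis
  show "order_transport (s i) (s i) A A (quiver_of \<eta>) (quiver_of (lower i \<eta>)) False"
    unfolding order_transport_def if_False id_apply by (intro conjI basic A AP ballI fwd cl1')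
  show "order_transport (s i) (s i) A A (quiver_of (lower i \<eta>)) (quiver_of \<eta>) False"
    unfolding order_transport_def if_False id_apply by (intro conjI basic A AP ballI bwd cl2')
qed

text \<open>
  The root list of a reversed full word is the reversed image under \<open>- w\<^sub>0\<close>.
\<close>

lemma dual_transport:
  assumes "height \<eta>"
  defines "f \<equiv> \<lambda>v. negate (w0 v)"
  shows "order_transport f f P P (quiver_of \<eta>) (quiver_of (dual \<eta>)) True"
    and "order_transport f f P P (quiver_of (dual \<eta>)) (quiver_of \<eta>) True"
proof -
  have lin: "linear_map f"
    unfolding f_def using linear_map_compose[OF linear_map_negate_self longest_element_linear] by (simp add: comp_def)
  have inv: "f (f v) = v" for v by (simp add: f_def longest_element_negate)
  obtain ws0 where ws0: "full_word ws0" using full_word_exists by blast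
  have im: "f ` P = P" using full_word_rev_image[OF ws0] longest_element_rev[OF ws0] by (simp add: f_def)
  have all: "filter (\<lambda>v. v \<in> P) (rl ws) = rl ws" if "full_word ws" for ws
    using that by (simp add: full_word_def filter_id_conv)
  have rl: "rl (rev ws) = rev (map f (rl ws))" if "full_word ws" for ws
    using root_list_rev_full[OF that] by (simp add: f_def)
  have "\<exists>ws'\<in>adapted_class T (quiver_of (dual \<eta>)).
      filter (\<lambda>v. v \<in> P) (rl ws') = rev (map f (filter (\<lambda>v. v \<in> P) (rl ws)))"
    if "ws \<in> adapted_class T (quiver_of \<eta>)" for ws
  proof -
    have ws: "full_word ws" "adp \<eta> ws" using that adapted_class_quiver_of by auto
    then have "filter (\<lambda>v. v \<in> P) (rl (rev ws)) = rev (map f (filter (\<lambda>v. v \<in> P) (rl ws)))"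
      using all[OF full_word_rev] all rl by simp
    then show ?thesis using ws full_word_rev adp_dual[OF assms(1)] adapted_class_quiver_of by blast
  qed
  then show "order_transport f f P P (quiver_of \<eta>) (quiver_of (dual \<eta>)) True"
    unfolding order_transport_def using lin inv im by simp
  have "\<exists>ws'\<in>adapted_class T (quiver_of \<eta>).
      filter (\<lambda>v. v \<in> P) (rl ws') = rev (map f (filter (\<lambda>v. v \<in> P) (rl ws)))"
    if "ws \<in> adapted_class T (quiver_of (dual \<eta>))" for ws
  proof -
    have ws: "full_word ws" "adp (dual \<eta>) ws" using that adapted_class_quiver_of by auto
    then have "adp \<eta> (rev ws)" using adp_dual_iff[OF assms(1) full_word_rev[OF ws(1)]] by simp
    moreover have "filter (\<lambda>v. v \<in> P) (rl (rev ws)) = rev (map f (filter (\<lambda>v. v \<in> P) (rl ws)))"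
      using all[OF full_word_rev] all rl ws by simp
    ultimately show ?thesis using ws full_word_rev adapted_class_quiver_of by blast
  qed
  then show "order_transport f f P P (quiver_of (dual \<eta>)) (quiver_of \<eta>) True"
    unfolding order_transport_def using lin inv im by simp
qed

section \<open>Positions of roots\<close>

definition pos :: "(nat \<Rightarrow> int) \<Rightarrow> lattice \<Rightarrow> nat \<times> int" where
  "pos \<eta> v = coordinate T (quiver_of \<eta>) \<eta> v"

lemma pos_nth:
  assumes "height \<eta>" "full_word ws" "adp \<eta> ws" "n < length ws"
  shows "pos \<eta> (rl ws ! n) = (ws ! n, \<eta> (ws ! n) - 2 * int (count_list (take n ws) (ws ! n)))"
  unfolding pos_def using coordinate_eq[OF assms] .

lemma full_word_nth:
  assumes "full_word ws" "v \<in> P"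
  obtains n where "n < length ws" "rl ws ! n = v"
  using assms unfolding full_word_def by (metis in_set_conv_nth length_root_list)

lemma pos_range:
  assumes "height \<eta>" "v \<in> P" "pos \<eta> v = (i, p)"
  shows "i \<in> V" "bottom \<eta> i < p" "p \<le> \<eta> i" "even (\<eta> i - p)"
proof -
  obtain ws where ws: "full_word ws" "adp \<eta> ws" using adapted_full_exists assms(1) by blast
  obtain n where n: "n < length ws" "rl ws ! n = v" using full_word_nth[OF ws(1) assms(2)] .
  have ip: "i = ws ! n" "p = \<eta> i - 2 * int (count_list (take n ws) i)"
    using pos_nth[OF assms(1) ws n(1)] n(2) assms(3) by auto
  show iV: "i \<in> V" using ip(1) n(1) full_word_vertices[OF ws(1)] by auto
  have "count_list (take n ws) i < count_list ws i"
    using arg_cong[OF id_take_nth_drop[OF n(1)], of "\<lambda>us. count_list us (ws ! n)"] ip(1) by simp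
  then show "bottom \<eta> i < p"
    using bottom_eq[OF assms(1) ws iV] ip(2) by (simp add: final_height_def)
  show "p \<le> \<eta> i" "even (\<eta> i - p)" using ip(2) by auto
qed

lemma pos_surj:
  assumes "height \<eta>" "i \<in> V" "bottom \<eta> i < p" "p \<le> \<eta> i" "even (\<eta> i - p)"
  shows "\<exists>v\<in>P. pos \<eta> v = (i, p)"
proof -
  obtain ws where ws: "full_word ws" "adp \<eta> ws" using adapted_full_exists assms(1) by blast
  define m where "m = nat ((\<eta> i - p) div 2)"
  have m: "p = \<eta> i - 2 * int m" using assms(4,5) by (auto simp: m_def)
  then have "m < count_list ws i" using assms(3) bottom_eq[OF assms(1) ws assms(2)] by (simp add: final_height_def)
  then obtain n where n: "n < length ws" "ws ! n = i" "count_list (take n ws) i = m"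
    using occurrence_position[of m ws i] by blast
  then have "pos \<eta> (rl ws ! n) = (i, p)" using pos_nth[OF assms(1) ws n(1)] m by simp
  moreover have "rl ws ! n \<in> P" using ws(1) n(1) nth_mem[of n "rl ws"] by (simp add: full_word_def)
  ultimately show ?thesis by blast
qed

lemma count_take_inject:
  assumes "k < length ws" "n < length ws" "ws ! k = ws ! n"
    "count_list (take k ws) (ws ! n) = count_list (take n ws) (ws ! n)"
  shows "k = n"
proof -
  have less: "count_list (take a ws) (ws ! a) < count_list (take b ws) (ws ! a)" if "a < b" "b < length ws" for a b
  proof -
    have "take b ws = take a ws @ ws ! a # drop (Suc a) (take b ws)"
      using that id_take_nth_drop[of a "take b ws"] by (simp add: min_def)
    then have "count_list (take b ws) (ws ! a) = count_list (take a ws @ ws ! a # drop (Suc a) (take b ws)) (ws ! a)"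
      by (rule arg_cong)
    then show ?thesis by simp
  qed
  show ?thesis using less[of k n] less[of n k] assms by (cases k n rule: linorder_cases) auto
qed

lemma pos_inject:
  assumes "height \<eta>" "u \<in> P" "v \<in> P" "pos \<eta> u = pos \<eta> v"
  shows "u = v"
proof -
  obtain ws where ws: "full_word ws" "adp \<eta> ws" using adapted_full_exists assms(1) by blast
  obtain k where k: "k < length ws" "rl ws ! k = u" using full_word_nth[OF ws(1) assms(2)] .
  obtain n where n: "n < length ws" "rl ws ! n = v" using full_word_nth[OF ws(1) assms(3)] .
  have "ws ! k = ws ! n" "count_list (take k ws) (ws ! n) = count_list (take n ws) (ws ! n)"
    using pos_nth[OF assms(1) ws k(1)] pos_nth[OF assms(1) ws n(1)] k(2) n(2) assms(4) by auto
  then have "k = n" using count_take_inject k(1) n(1) by blast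
  then show ?thesis using k n by simp
qed

lemma pos_source:
  assumes "height \<eta>" "source \<eta> i" "i \<in> V"
  shows "pos \<eta> (simple_root i) = (i, \<eta> i)"
proof -
  obtain us where us: "full_word (i # us)" "adp \<eta> (i # us)"
    using adapted_full_from_source assms by blast
  then show ?thesis using pos_nth[OF assms(1) us, of 0] by simp
qed

lemma pos_lower:
  assumes "height \<eta>" "source \<eta> i" "i \<in> V" "v \<in> P" "v \<noteq> simple_root i"
  shows "pos (lower i \<eta>) (s i v) = pos \<eta> v"
proof -
  obtain us where us: "full_word (i # us)" "adp \<eta> (i # us)"
    using adapted_full_from_source assms(1-3) by blast
  obtain j where j: "full_word (us @ [j])" "adp (lower i \<eta>) (us @ [j])"
    using adapted_rotate[OF assms(1) us] by blast
  obtain k where k: "k < length (i # us)" "rl (i # us) ! k = v" using full_word_nth[OF us(1) assms(4)] .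
  then obtain n where n: "k = Suc n" "n < length us" using assms(5) by (cases k) auto
  then have v: "v = s i (rl us ! n)" using k(2) by simp
  then have "s i v = rl (us @ [j]) ! n" using n(2) assms(3) by (simp add: root_list_append nth_append)
  then show ?thesis
    using pos_nth[OF height_lower[OF assms(1,2)] j, of n] pos_nth[OF assms(1) us k(1)] k(2) n
    by (auto simp: nth_append lower_def)
qed

text \<open>
  A letter that lowers a height from \<open>p\<close> to \<open>p - 2\<close> raises it back in the reversed word.  With signs
  changed, it lowers \<open>2 - p\<close> to \<open>- p\<close>.
\<close>

lemma pos_dual:
  assumes "height \<eta>" "v \<in> P" "pos \<eta> v = (i, p)"
  shows "pos (dual \<eta>) (negate (w0 v)) = (i, 2 - p)"
proof -
  obtain ws where ws: "full_word ws" "adp \<eta> ws" using adapted_full_exists assms(1) by blast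
  obtain n where n: "n < length ws" "rl ws ! n = v" using full_word_nth[OF ws(1) assms(2)] .
  have ip: "i = ws ! n" "p = \<eta> i - 2 * int (count_list (take n ws) i)"
    using pos_nth[OF assms(1) ws n(1)] n(2) assms(3) by auto
  have iV: "i \<in> V" using ip(1) n(1) full_word_vertices[OF ws(1)] by auto
  let ?k = "length ws - Suc n"
  have k: "?k < length (rev ws)" "length ws - Suc ?k = n" using n(1) by auto
  have r: "rl (rev ws) ! ?k = negate (w0 v)"
    unfolding root_list_rev_full[OF ws(1)] using n k by (simp add: rev_nth)
  have l: "rev ws ! ?k = i" using n(1) ip(1) by (simp add: rev_nth)
  have "take ?k (rev ws) = rev (drop (Suc n) ws)" using n(1) by (simp add: take_rev)
  then have c: "count_list (take ?k (rev ws)) i = count_list (drop (Suc n) ws) i" by simp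
  have "count_list ws i = count_list (take n ws) i + Suc (count_list (drop (Suc n) ws) i)"
    using arg_cong[OF id_take_nth_drop[OF n(1)], of "\<lambda>us. count_list us (ws ! n)"] ip(1) by simp
  then have "dual \<eta> i - 2 * int (count_list (drop (Suc n) ws) i) = 2 - p"
    using bottom_eq[OF assms(1) ws iV] ip(2) by (simp add: dual_def final_height_def)
  then show ?thesis
    using pos_nth[OF height_dual[OF assms(1)] full_word_rev[OF ws(1)] adp_dual[OF assms(1) ws] k(1)] r l c by simp
qed

end

context finite_type
begin

section \<open>Comparing height functions\<close>

lemma height_parity:
  assumes "height \<eta>" "height \<zeta>" "k \<in> V" "even (\<eta> k - \<zeta> k)" "i \<in> V"
  shows "even (\<eta> i - \<zeta> i)"
proof -
  have "V \<subseteq> {i. even (\<eta> i - \<zeta> i)}"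
  proof (rule connected[OF assms(3)])
    show "k \<in> {i. even (\<eta> i - \<zeta> i)}" using assms(4) by simp
    fix a b assume e: "{a, b} \<in> dynkin_edges T" and "a \<in> {i. even (\<eta> i - \<zeta> i)}"
    then have "even (\<eta> a - \<zeta> a)" by simp
    moreover have "\<bar>\<eta> a - \<eta> b\<bar> = 1" "\<bar>\<zeta> a - \<zeta> b\<bar> = 1" using height_edge[OF assms(1) e] height_edge[OF assms(2) e] by auto
    ultimately show "b \<in> {i. even (\<eta> i - \<zeta> i)}" by simp presburger
  qed
  then show ?thesis using assms(5) by blast
qed

lemma height_difference_const:
  assumes "height \<eta>" "height \<zeta>" "quiver_of \<eta> = quiver_of \<zeta>" "k \<in> V" "i \<in> V"
  shows "\<eta> i - \<zeta> i = \<eta> k - \<zeta> k"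
proof -
  have "V \<subseteq> {i. \<eta> i - \<zeta> i = \<eta> k - \<zeta> k}"
  proof (rule connected[OF assms(4)])
    fix a b assume e: "{a, b} \<in> dynkin_edges T" and a: "a \<in> {i. \<eta> i - \<zeta> i = \<eta> k - \<zeta> k}"
    have "\<bar>\<eta> a - \<eta> b\<bar> = 1" "\<bar>\<zeta> a - \<zeta> b\<bar> = 1" using height_edge[OF assms(1) e] height_edge[OF assms(2) e] by auto
    moreover have "\<eta> a = \<eta> b + 1 \<longleftrightarrow> \<zeta> a = \<zeta> b + 1" using assms(3) e unfolding quiver_of_def by blast
    ultimately have "\<eta> a - \<eta> b = \<zeta> a - \<zeta> b" by linarith
    then show "b \<in> {i. \<eta> i - \<zeta> i = \<eta> k - \<zeta> k}" using a by simp
  qed simp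
  then show ?thesis using assms(5) by blast
qed

lemma height_bounded:
  assumes "k \<in> V"
  shows "\<exists>C. \<forall>\<eta>. height \<eta> \<longrightarrow> (\<forall>i\<in>V. \<bar>\<eta> i - \<eta> k\<bar> \<le> C)"
proof -
  let ?S = "{i. \<exists>C. \<forall>\<eta>. height \<eta> \<longrightarrow> \<bar>\<eta> i - \<eta> k\<bar> \<le> C}"
  have "V \<subseteq> ?S"
  proof (rule connected[OF assms])
    show "k \<in> ?S" by (auto intro: exI[of _ 0])
    fix a b assume e: "{a, b} \<in> dynkin_edges T" and "a \<in> ?S"
    then obtain C where C: "\<And>\<eta>. height \<eta> \<Longrightarrow> \<bar>\<eta> a - \<eta> k\<bar> \<le> C" by blast
    have "\<bar>\<eta> b - \<eta> k\<bar> \<le> C + 1" if "height \<eta>" for \<eta>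
      using C[OF that] height_edge[OF that e] by linarith
    then show "b \<in> ?S" by blast
  qed
  then have "\<forall>i\<in>V. \<exists>C. \<forall>\<eta>. height \<eta> \<longrightarrow> \<bar>\<eta> i - \<eta> k\<bar> \<le> C" by blast
  then obtain C where C: "\<And>i \<eta>. i \<in> V \<Longrightarrow> height \<eta> \<Longrightarrow> \<bar>\<eta> i - \<eta> k\<bar> \<le> C i" by metis
  have "C i \<le> (\<Sum>i\<in>V. \<bar>C i\<bar>)" if "i \<in> V" for i
    using member_le_sum[of i V "\<lambda>i. \<bar>C i\<bar>"] that by fastforce
  then show ?thesis using C by (intro exI[of _ "\<Sum>i\<in>V. \<bar>C i\<bar>"]) (meson order_trans)
qed

lemma height_min:
  assumes "height \<eta>" "height \<zeta>" "\<And>i. i \<in> V \<Longrightarrow> even (\<eta> i - \<zeta> i)"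
  shows "height (\<lambda>i. min (\<eta> i) (\<zeta> i))"
  unfolding height_def
proof (intro allI impI)
  fix a b assume e: "{a, b} \<in> dynkin_edges T"
  then have "even (\<eta> a - \<zeta> a)" "even (\<eta> b - \<zeta> b)" using assms(3) edge_vertices by blast+
  then obtain p q where "\<eta> a - \<zeta> a = 2 * p" "\<eta> b - \<zeta> b = 2 * q" by (meson evenE)
  moreover have "\<bar>\<eta> a - \<eta> b\<bar> = 1" "\<bar>\<zeta> a - \<zeta> b\<bar> = 1" using height_edge[OF assms(1) e] height_edge[OF assms(2) e] by auto
  ultimately show "\<bar>min (\<eta> a) (\<zeta> a) - min (\<eta> b) (\<zeta> b)\<bar> = 1" unfolding min_def by (smt (verit))
qed

lemma final_height_le: "final_height \<eta> ws i \<le> \<eta> i"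
  by (simp add: final_height_def)

lemma descend_to_min:
  assumes "height \<eta>" "height \<zeta>" "\<And>i. i \<in> V \<Longrightarrow> even (\<eta> i - \<zeta> i)"
  shows "\<exists>ws. set ws \<subseteq> V \<and> adp \<eta> ws \<and> (\<forall>i\<in>V. final_height \<eta> ws i = min (\<eta> i) (\<zeta> i))"
proof (rule descend[OF assms(1) height_min[OF assms]])
  show "min (\<eta> i) (\<zeta> i) \<le> \<eta> i" for i by simp
  show "even (\<eta> i - min (\<eta> i) (\<zeta> i))" if "i \<in> V" for i using assms(3)[OF that] by (simp add: min_def)
qed

lemma bottom_vertices_cong:
  assumes "height \<eta>" "\<And>i. i \<in> V \<Longrightarrow> \<eta> i = \<zeta> i" "i \<in> V"
  shows "bottom \<eta> i = bottom \<zeta> i"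
proof -
  obtain ws where ws: "full_word ws" "adp \<eta> ws" using adapted_full_exists assms(1) by blast
  have "height \<zeta>" using height_cong assms by blast
  moreover have "adp \<zeta> ws" using ws(2) quiver_of_cong[of \<eta> \<zeta>] assms(2) by simp
  ultimately show ?thesis
    using bottom_eq[OF assms(1) ws assms(3)] bottom_eq[of \<zeta> ws i] ws(1) assms(2,3) by (simp add: final_height_def)
qed

lemma opposite_bottom_word:
  "height \<eta> \<Longrightarrow> opposite l l' \<Longrightarrow> adp \<eta> ws \<Longrightarrow> set ws \<subseteq> V \<Longrightarrow>
     final_height \<eta> ws l' - bottom (final_height \<eta> ws) l = \<eta> l' - bottom \<eta> l"
proof (induction ws arbitrary: \<eta>)
  case (Cons i ws)
  have src: "source \<eta> i" "adp (lower i \<eta>) ws" using Cons.prems adp_Cons by blast+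
  have i: "i \<in> V" "l \<in> V" using Cons.prems by (auto simp: opposite_def)
  have "opposite i l \<longleftrightarrow> i = l'"
    using Cons.prems(2) opposite_sym opposite_unique by blast
  then have "lower i \<eta> l' - bottom (lower i \<eta>) l = \<eta> l' - bottom \<eta> l"
    using bottom_lower[OF Cons.prems(1) src(1) i] by (simp add: lower_def)
  then show ?case using Cons.IH[OF height_lower[OF Cons.prems(1) src(1)] Cons.prems(2) src(2)] Cons.prems(4) by simp
qed simp

text \<open>
  A reflection at a source \<open>i\<close> lowers the height at \<open>l'\<close> if \<open>i = l'\<close>, and the bottom of row \<open>l\<close> if \<open>i\<close> is opposite to
  \<open>l\<close>, which is the same condition.
\<close>

lemma opposite_bottom_const:
  assumes "height \<eta>" "height \<zeta>" "\<And>i. i \<in> V \<Longrightarrow> even (\<eta> i - \<zeta> i)" "opposite l l'"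
  shows "\<eta> l' - bottom \<eta> l = \<zeta> l' - bottom \<zeta> l"
proof -
  let ?m = "\<lambda>i. min (\<eta> i) (\<zeta> i)"
  have lV: "l \<in> V" "l' \<in> V" using assms(4) by (auto simp: opposite_def)
  have ev: "even (\<zeta> i - \<eta> i)" if "i \<in> V" for i using assms(3)[OF that] by presburger
  obtain us where us: "set us \<subseteq> V" "adp \<eta> us" "\<forall>i\<in>V. final_height \<eta> us i = ?m i"
    using descend_to_min[OF assms(1-3)] by blast
  obtain ws where ws: "set ws \<subseteq> V" "adp \<zeta> ws" "\<forall>i\<in>V. final_height \<zeta> ws i = min (\<zeta> i) (\<eta> i)"
    using descend_to_min[OF assms(2,1) ev] by blast
  have "bottom (final_height \<eta> us) l = bottom (final_height \<zeta> ws) l"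
    using us(3) ws(3) by (intro bottom_vertices_cong height_final assms us lV) (simp add: min.commute)
  moreover have "final_height \<eta> us l' = final_height \<zeta> ws l'" using us(3) ws(3) lV by (simp add: min.commute)
  ultimately show ?thesis
    using opposite_bottom_word[OF assms(1,4) us(2,1)] opposite_bottom_word[OF assms(2,4) ws(2,1)] by simp
qed

section \<open>Invariance of the data of a pair\<close>

text \<open>
  What the exponents need to know about the two roots at given points, without naming the roots, which
  change under reflections.
\<close>

definition pair_data :: "(nat \<Rightarrow> int) \<Rightarrow> nat \<Rightarrow> int \<Rightarrow> nat \<Rightarrow> int \<Rightarrow> bool \<Rightarrow> nat \<Rightarrow> bool" where
  "pair_data \<eta> k a l b c d \<longleftrightarrow> (\<exists>u\<in>P. \<exists>v\<in>P. pos \<eta> u = (k, a) \<and> pos \<eta> v = (l, b) \<and>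
     comparable T (quiver_of \<eta>) u v = c \<and> gdist T (quiver_of \<eta>) (pair_seq u v) = d)"

lemma pair_data_unique:
  assumes "height \<eta>" "pair_data \<eta> k a l b c d" "pair_data \<eta> k a l b c' d'"
  shows "c = c' \<and> d = d'"
  using assms(2,3) pos_inject[OF assms(1)] unfolding pair_data_def by metis

lemma pair_data_exists:
  assumes "height \<eta>" "k \<in> V" "bottom \<eta> k < a" "a \<le> \<eta> k" "even (\<eta> k - a)"
    "l \<in> V" "bottom \<eta> l < b" "b \<le> \<eta> l" "even (\<eta> l - b)"
  shows "\<exists>c d. pair_data \<eta> k a l b c d"
  using pos_surj[OF assms(1-5)] pos_surj[OF assms(1,6-9)] unfolding pair_data_def by blast

lemma pair_data_range:
  assumes "height \<eta>" "pair_data \<eta> k a l b c d"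
  shows "k \<in> V" "bottom \<eta> k < a" "a \<le> \<eta> k" "even (\<eta> k - a)"
    "l \<in> V" "bottom \<eta> l < b" "b \<le> \<eta> l" "even (\<eta> l - b)"
proof -
  obtain u v where uv: "u \<in> P" "v \<in> P" "pos \<eta> u = (k, a)" "pos \<eta> v = (l, b)"
    using assms(2) unfolding pair_data_def by blast
  show "k \<in> V" "bottom \<eta> k < a" "a \<le> \<eta> k" "even (\<eta> k - a)" using pos_range[OF assms(1) uv(1,3)] by auto
  show "l \<in> V" "bottom \<eta> l < b" "b \<le> \<eta> l" "even (\<eta> l - b)" using pos_range[OF assms(1) uv(2,4)] by auto
qed

lemma pair_seq_commute: "pair_seq u v = pair_seq v u"
  by (auto simp: pair_seq_def)

lemma pair_data_swap: "pair_data \<eta> k a l b c d \<Longrightarrow> pair_data \<eta> l b k a c d"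
  unfolding pair_data_def using pair_seq_commute comparable_sym by metis

lemma pos_cong:
  assumes "height \<eta>" "\<And>i. i \<in> V \<Longrightarrow> \<eta> i = \<zeta> i" "v \<in> P"
  shows "pos \<zeta> v = pos \<eta> v"
proof -
  obtain ws where ws: "full_word ws" "adp \<eta> ws" using adapted_full_exists assms(1) by blast
  obtain n where n: "n < length ws" "rl ws ! n = v" using full_word_nth[OF ws(1) assms(3)] .
  have "height \<zeta>" using height_cong assms by blast
  moreover have "adp \<zeta> ws" using ws(2) quiver_of_cong[of \<eta> \<zeta>] assms(2) by simp
  moreover have "ws ! n \<in> V" using n(1) full_word_vertices[OF ws(1)] by auto
  ultimately show ?thesis
    using pos_nth[OF assms(1) ws n(1)] pos_nth[of \<zeta> ws n] ws(1) n assms(2) by simp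
qed

lemma pair_data_cong:
  assumes "height \<eta>" "\<And>i. i \<in> V \<Longrightarrow> \<eta> i = \<zeta> i" "pair_data \<eta> k a l b c d"
  shows "pair_data \<zeta> k a l b c d"
  using assms(3) pos_cong[OF assms(1,2)] quiver_of_cong[of \<eta> \<zeta>] assms(2) unfolding pair_data_def by metis

lemma pos_shift:
  assumes "height \<eta>" "v \<in> P" "pos \<eta> v = (i, p)"
  shows "pos (\<lambda>j. \<eta> j + c) v = (i, p + c)"
proof -
  obtain ws where ws: "full_word ws" "adp \<eta> ws" using adapted_full_exists assms(1) by blast
  obtain n where n: "n < length ws" "rl ws ! n = v" using full_word_nth[OF ws(1) assms(2)] .
  have "adp (\<lambda>j. \<eta> j + c) ws" using ws(2) quiver_of_shift[of \<eta> c] by simp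
  then show ?thesis
    using pos_nth[OF assms(1) ws n(1)] pos_nth[OF height_shift[OF assms(1)] ws(1) _ n(1), of c] n assms(3) by auto
qed

lemma pair_data_shift:
  assumes "height \<eta>" "pair_data \<eta> k a l b c d"
  shows "pair_data (\<lambda>j. \<eta> j + e) k (a + e) l (b + e) c d"
  using assms(2) pos_shift[OF assms(1)] unfolding pair_data_def quiver_of_shift by blast

text \<open>
  A reflection at \<open>i\<close> removes only the top point of row \<open>i\<close>.
\<close>

lemma pair_data_lower:
  assumes "height \<eta>" "source \<eta> i" "i \<in> V" "pair_data \<eta> k a l b c d"
    "(k, a) \<noteq> (i, \<eta> i)" "(l, b) \<noteq> (i, \<eta> i)"
  shows "pair_data (lower i \<eta>) k a l b c d"
proof -
  obtain u v where uv: "u \<in> P" "v \<in> P" "pos \<eta> u = (k, a)" "pos \<eta> v = (l, b)"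
     "comparable T (quiver_of \<eta>) u v = c" "gdist T (quiver_of \<eta>) (pair_seq u v) = d"
    using assms(4) unfolding pair_data_def by blast
  have ne: "u \<noteq> simple_root i" "v \<noteq> simple_root i" using pos_source[OF assms(1-3)] uv(3,4) assms(5,6) by auto
  then have uv': "u \<in> P - {simple_root i}" "v \<in> P - {simple_root i}" using uv by auto
  note tr = move_transport[OF assms(1-3)]
  have "s i u \<in> P" "s i v \<in> P" using reflection_positive assms(3) uv(1,2) ne by auto
  moreover have "pos (lower i \<eta>) (s i u) = (k, a)" "pos (lower i \<eta>) (s i v) = (l, b)"
    using pos_lower[OF assms(1-3)] uv ne by auto
  ultimately show ?thesis
    unfolding pair_data_def using pair_transport[OF tr uv'] uv(5,6) by blast
qed

lemma pair_data_word:
  "height \<eta> \<Longrightarrow> adp \<eta> ws \<Longrightarrow> set ws \<subseteq> V \<Longrightarrow> pair_data \<eta> k a l b c d \<Longrightarrow>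
     a \<le> final_height \<eta> ws k \<Longrightarrow> b \<le> final_height \<eta> ws l \<Longrightarrow> pair_data (final_height \<eta> ws) k a l b c d"
proof (induction ws arbitrary: \<eta>)
  case (Cons i ws)
  have src: "source \<eta> i" "adp (lower i \<eta>) ws" using Cons.prems adp_Cons by blast+
  have iV: "i \<in> V" "set ws \<subseteq> V" using Cons.prems by auto
  have "final_height (lower i \<eta>) ws i \<le> \<eta> i - 2" using final_height_le[of "lower i \<eta>" ws i] by (simp add: lower_def)
  then have "(k, a) \<noteq> (i, \<eta> i)" "(l, b) \<noteq> (i, \<eta> i)" using Cons.prems(5,6) by auto
  then have "pair_data (lower i \<eta>) k a l b c d"
    using pair_data_lower[OF Cons.prems(1) src(1) iV(1) Cons.prems(4)] by blast
  then show ?case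
    using Cons.IH[OF height_lower[OF Cons.prems(1) src(1)] src(2) iV(2)] Cons.prems(5,6) by simp
qed simp

lemma pair_data_descend:
  assumes "height \<eta>" "height \<zeta>" "\<And>i. i \<in> V \<Longrightarrow> \<zeta> i \<le> \<eta> i" "\<And>i. i \<in> V \<Longrightarrow> even (\<eta> i - \<zeta> i)"
    and "pair_data \<eta> k a l b c d" "a \<le> \<zeta> k" "b \<le> \<zeta> l"
  shows "pair_data \<zeta> k a l b c d"
proof -
  obtain ws where ws: "set ws \<subseteq> V" "adp \<eta> ws" "\<forall>i\<in>V. final_height \<eta> ws i = \<zeta> i"
    using descend[OF assms(1-4)] by blast
  have "k \<in> V" "l \<in> V" using pair_data_range[OF assms(1,5)] by auto
  then have "pair_data (final_height \<eta> ws) k a l b c d"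
    using pair_data_word[OF assms(1) ws(2,1) assms(5)] assms(6,7) ws(3) by simp
  then show ?thesis using pair_data_cong[OF height_final[OF assms(1) ws(2)]] ws(3) by blast
qed

lemma pair_data_dual:
  assumes "height \<eta>" "pair_data \<eta> k a l b c d"
  shows "pair_data (dual \<eta>) k (2 - a) l (2 - b) c d"
proof -
  obtain u v where uv: "u \<in> P" "v \<in> P" "pos \<eta> u = (k, a)" "pos \<eta> v = (l, b)"
     "comparable T (quiver_of \<eta>) u v = c" "gdist T (quiver_of \<eta>) (pair_seq u v) = d"
    using assms(2) unfolding pair_data_def by blast
  note tr = dual_transport[OF assms(1)]
  obtain ws where ws: "full_word ws" using full_word_exists by blast
  have "negate (w0 x) \<in> P" if "x \<in> P" for x
    using full_word_negative[OF ws that] longest_element_full[OF ws] by simp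
  then show ?thesis
    unfolding pair_data_def using pair_transport[OF tr uv(1,2)] uv pos_dual[OF assms(1)] by blast
qed

text \<open>
  After a shift both pairs occupy the same points, and both descend to the minimum of the two
  height functions.
\<close>

lemma pair_data_translation:
  assumes "height \<eta>" "height \<zeta>" "pair_data \<eta> k a l b c d" "pair_data \<zeta> k a' l b' c' d'" "a - b = a' - b'"
  shows "c = c' \<and> d = d'"
proof -
  let ?e = "a - a'"
  let ?\<zeta> = "\<lambda>j. \<zeta> j + ?e"
  have hz: "height ?\<zeta>" using height_shift assms(2) by blast
  have z: "pair_data ?\<zeta> k a l b c' d'"
    using pair_data_shift[OF assms(2,4), of ?e] assms(5) by (simp add: algebra_simps)
  note r = pair_data_range[OF assms(1,3)] and r' = pair_data_range[OF hz z]
  have ev: "even (\<eta> i - ?\<zeta> i)" if "i \<in> V" for i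
  proof (rule height_parity[OF assms(1) hz r(1) _ that])
    show "even (\<eta> k - ?\<zeta> k)" using r(4) r'(4) by presburger
  qed
  let ?m = "\<lambda>i. min (\<eta> i) (?\<zeta> i)"
  have hm: "height ?m" using height_min[OF assms(1) hz ev] .
  have "even (\<eta> i - ?m i)" "even (?\<zeta> i - ?m i)" if "i \<in> V" for i
  proof -
    have "even (?\<zeta> i - \<eta> i)" using ev[OF that] by presburger
    then show "even (\<eta> i - ?m i)" "even (?\<zeta> i - ?m i)" using ev[OF that] by (auto simp: min_def)
  qed
  then have "pair_data ?m k a l b c d" "pair_data ?m k a l b c' d'"
    using pair_data_descend[OF assms(1) hm _ _ assms(3)] pair_data_descend[OF hz hm _ _ z] r r' by simp_all
  then show ?thesis using pair_data_unique[OF hm] by blast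
qed

text \<open>
  If the differences have opposite signs, the dual height function changes the sign of one of them.
\<close>

lemma pair_data_invariant:
  assumes "height \<eta>" "height \<zeta>" "pair_data \<eta> k a l b c d" "pair_data \<zeta> k a' l b' c' d'" "\<bar>a - b\<bar> = \<bar>a' - b'\<bar>"
  shows "c = c' \<and> d = d'"
proof (cases "a - b = a' - b'")
  case True
  then show ?thesis using pair_data_translation assms by blast
next
  case False
  then have "a - b = (2 - a') - (2 - b')" using assms(5) by linarith
  then show ?thesis
    using pair_data_translation[OF assms(1) height_dual[OF assms(2)] assms(3) pair_data_dual[OF assms(2,4)]] by blast
qed

section \<open>Simple and incomparable pairs\<close>

lemma simple_seq_gdist:
  assumes "simple_seq T Q m"
  shows "gdist T Q m = 0"
proof -
  have "k = 0" if k: "chain_to Q m k" for k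
  proof (rule ccontr)
    assume "k \<noteq> 0"
    obtain c where c: "\<forall>j\<le>k. c j \<in> sequences T" "c k = m" "\<forall>j<k. seq_less T Q (c j) (c (Suc j))"
      using k by (auto simp: chain_to_def)
    obtain k' where "k = Suc k'" using \<open>k \<noteq> 0\<close> by (cases k) auto
    then have "seq_less T Q (c k') m" "c k' \<in> sequences T" using c by auto
    then show False using assms by (auto simp: simple_seq_def)
  qed
  moreover have "chain_to Q m 0" using assms by (auto simp: chain_to_def simple_seq_def)
  ultimately show ?thesis unfolding gdist_chain_to by (intro Greatest_equality) auto
qed

lemma euler_form_weight: "E \<eta> x (weight T m) = (\<Sum>v\<in>P. int (m v) * E \<eta> x v)"
  unfolding weight_def by (rule euler_form_sum_right[OF finite_P])

text \<open>
  Consider a smaller sequence.  Pairing the weights with \<open>\<alpha>\<^sub>k\<close> from the left gives one for the given pair, and only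
  \<open>\<alpha>\<^sub>k\<close> itself contributes positively.  So the smaller sequence contains \<open>\<alpha>\<^sub>k\<close>.  The first and the last
  difference are decreases, so both occur at \<open>\<alpha>\<^sub>j\<close>; but then the weights differ by \<open>\<alpha>\<^sub>j\<close>.
\<close>

lemma nonadjacent_simple_pair:
  assumes h: "height \<eta>" and src: "source \<eta> k" and kj: "k \<in> V" "j \<in> V" "j \<noteq> k" "{k, j} \<notin> dynkin_edges T"
  shows "gdist T (quiver_of \<eta>) (pair_seq (simple_root k) (simple_root j)) = 0"
proof (rule simple_seq_gdist)
  let ?u = "simple_root k" and ?v = "simple_root j"
  let ?m = "pair_seq ?u ?v"
  have uv: "?u \<in> P" "?v \<in> P" "?u \<noteq> ?v" using kj simple_root_positive by auto
  have m: "?m \<in> sequences T" using uv by (auto simp: sequences_def pair_seq_def)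
  obtain us where us: "full_word (k # us)" "adp \<eta> (k # us)"
    using adapted_full_from_source[OF h src kj(1)] by blast
  have mu: "?m ?u = 1" "?m ?v = 1" "?m x \<noteq> 0 \<Longrightarrow> x = ?u \<or> x = ?v" for x
    by (auto simp: pair_seq_def split: if_splits)
  have "\<not> seq_less T (quiver_of \<eta>) m' ?m" if m': "m' \<in> sequences T" for m'
  proof
    assume "seq_less T (quiver_of \<eta>) m' ?m"
    then have w: "weight T m' = weight T ?m" and bl: "bilex_less (rl (k # us)) m' ?m"
      using us adapted_class_quiver_of[of "k # us" \<eta>] seq_less_word_iff unfolding seq_less_def by blast+
    have le: "E \<eta> ?u x \<le> 0" if "x \<in> P" "x \<noteq> ?u" for x
      using euler_form_order[OF h, of "[k]" ?u x] that src kj(1) uv by (simp add: positive_word_def)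
    have uu: "E \<eta> ?u ?u = 1" using euler_simple_right[OF src kj(1)] by simp
    have "E \<eta> ?u ?v = 0" using euler_simple_simple[OF kj(1,2)] kj(3,4) by (auto simp: quiver_of_def)
    then have "(\<Sum>x\<in>P. int (?m x) * E \<eta> ?u x) = (\<Sum>x\<in>P. if ?u = x then 1 else 0)"
      using uu by (intro sum.cong) (auto simp: pair_seq_def)
    then have "E \<eta> ?u (weight T ?m) = 1" using uv by (simp add: euler_form_weight)
    then have "(\<Sum>x\<in>P. int (m' x) * E \<eta> ?u x) = 1" using w euler_form_weight by metis
    moreover have "(\<Sum>x\<in>P. int (m' x) * E \<eta> ?u x) = int (m' ?u) + (\<Sum>x\<in>P - {?u}. int (m' x) * E \<eta> ?u x)"
      using uv uu by (simp add: sum.remove)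
    moreover have "(\<Sum>x\<in>P - {?u}. int (m' x) * E \<eta> ?u x) \<le> 0"
      using le by (intro sum_nonpos) (auto intro: mult_nonneg_nonpos)
    ultimately have m1: "m' ?u \<ge> 1" by linarith
    define ds where "ds = filter (\<lambda>x. m' x \<noteq> ?m x) (rl (k # us))"
    have ds: "ds \<noteq> []" "m' (hd ds) < ?m (hd ds)" "m' (last ds) < ?m (last ds)"
      using bl by (auto simp: bilex_less_def ds_def Let_def)
    have "hd ds \<noteq> ?u" "last ds \<noteq> ?u" using ds m1 mu(1) by auto
    moreover have "?m (hd ds) \<noteq> 0" "?m (last ds) \<noteq> 0" using ds(2,3) by auto
    ultimately have hl: "hd ds = ?v" "last ds = ?v" using mu(3) by blast+
    have "distinct ds" using positive_word_distinct[OF full_word_positive[OF us(1)]] unfolding ds_def by (rule distinct_filter)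
    have dv: "ds = [?v]"
    proof (cases ds)
      case (Cons x xs)
      then have "xs = []" using hl \<open>distinct ds\<close> last_in_set[of xs] by (metis distinct.simps(2) last_ConsR list.sel(1))
      then show ?thesis using Cons hl by simp
    qed (use ds(1) in simp)
    have "set (rl (k # us)) = P" using us(1) unfolding full_word_def by blast
    then have "{x \<in> P. m' x \<noteq> ?m x} = {?v}" using dv unfolding ds_def by (metis list.set(1,2) set_filter)
    then have other: "m' x = ?m x" if "x \<in> P" "x \<noteq> ?v" for x using that by blast
    have "m' ?v = 0" using ds(2) hl mu(2) by simp
    have "weight T ?m j - weight T m' j = (\<Sum>x\<in>P. if ?v = x then 1 else 0)"
      unfolding weight_def sum_subtractf[symmetric] using other \<open>m' ?v = 0\<close> mu(2)
      by (intro sum.cong) auto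
    then show False using w uv(2) by simp
  qed
  then show "simple_seq T (quiver_of \<eta>) ?m" unfolding simple_seq_def using m by blast
qed

text \<open>
  Either of two sources can start an adapted word.
\<close>

lemma sources_incomparable:
  assumes "height \<eta>" "source \<eta> i" "i \<in> V" "source \<eta> j" "j \<in> V" "i \<noteq> j"
  shows "\<not> comparable T (quiver_of \<eta>) (simple_root i) (simple_root j)"
proof -
  have nl: "\<not> root_less T (quiver_of \<eta>) (simple_root i) (simple_root j)"
    if j: "source \<eta> j" "j \<in> V" "i \<noteq> j" for i j
  proof
    assume less: "root_less T (quiver_of \<eta>) (simple_root i) (simple_root j)"
    obtain us where us: "full_word (j # us)" "adp \<eta> (j # us)"
      using adapted_full_from_source[OF assms(1) j(1,2)] by blast
    then have "before (rl (j # us)) (simple_root i) (simple_root j)"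
      using less adapted_class_quiver_of[of "j # us" \<eta>] root_less_word_iff unfolding root_less_def by blast
    moreover have "distinct (rl (j # us))" using positive_word_distinct full_word_positive[OF us(1)] by blast
    ultimately show False using j(3) before_set by fastforce
  qed
  show ?thesis
    unfolding comparable_def using nl[of j i] nl[of i j] assms by simp
qed

section \<open>Existence of pairs in other quivers\<close>

text \<open>
  Lower the height function as long as both points remain.  In the end every source is the vertex of one of
  the two points, with the point on top of its row.  The highest vertex is a source, so it belongs to the higher
  point; if the other vertex were a source too, the roots would be incomparable.
\<close>

lemma comparable_pair_canonical:
  assumes h: "height \<eta>" and pd: "pair_data \<eta> k a l b True d" and ab: "b < a"
  shows "\<exists>\<mu>. height \<mu> \<and> pair_data \<mu> k a l b True d \<and> \<mu> k = a \<and> (\<forall>j\<in>V. j \<noteq> k \<longrightarrow> \<mu> j < a) \<and>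
    (\<forall>i\<in>V. source \<mu> i \<longrightarrow> i = k)"
proof -
  have kV: "k \<in> V" using pair_data_range[OF h pd] by blast
  obtain C where C: "\<And>\<eta> i. height \<eta> \<Longrightarrow> i \<in> V \<Longrightarrow> \<bar>\<eta> i - \<eta> k\<bar> \<le> C" using height_bounded[OF kV] by blast
  \<comment> \<open>Height functions that keep the point of row \<open>k\<close> are at least \<open>a - C\<close> everywhere, so lowering terminates.\<close>
  define f where "f \<mu> = nat (\<Sum>i\<in>V. \<mu> i - (a - C))" for \<mu> :: "nat \<Rightarrow> int"
  let ?M = "\<lambda>\<mu>. height \<mu> \<and> pair_data \<mu> k a l b True d"
  obtain \<mu> where \<mu>: "?M \<mu>" and least: "\<And>\<nu>. ?M \<nu> \<Longrightarrow> f \<mu> \<le> f \<nu>"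
    using ex_has_least_nat[of ?M \<eta> f] h pd by blast
  have hm: "height \<mu>" and pm: "pair_data \<mu> k a l b True d" using \<mu> by auto
  note r = pair_data_range[OF hm pm]
  have srcs: "i = k \<and> \<mu> k = a \<or> i = l \<and> \<mu> l = b" if i: "i \<in> V" "source \<mu> i" for i
  proof (rule ccontr)
    assume n: "\<not> ?thesis"
    then have "(k, a) \<noteq> (i, \<mu> i)" "(l, b) \<noteq> (i, \<mu> i)" by auto
    then have M: "?M (lower i \<mu>)" using height_lower[OF hm i(2)] pair_data_lower[OF hm i(2,1) pm] by blast
    have "lower i \<mu> j - (a - C) \<ge> 0" if "j \<in> V" for j
      using C[of "lower i \<mu>" j] pair_data_range(3)[of "lower i \<mu>"] M that by fastforce
    then have "(\<Sum>j\<in>V. lower i \<mu> j - (a - C)) \<ge> 0" by (intro sum_nonneg) simp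
    moreover have "(\<Sum>j\<in>V. lower i \<mu> j - (a - C)) < (\<Sum>j\<in>V. \<mu> j - (a - C))"
      using i(1) by (intro sum_strict_mono_ex1) (auto simp: lower_def)
    ultimately have "f (lower i \<mu>) < f \<mu>" by (simp add: f_def)
    then show False using least[OF M] by simp
  qed
  obtain i where i: "i \<in> V" "source \<mu> i" "\<forall>j\<in>V. \<mu> j \<le> \<mu> i" using source_exists[OF hm] kV by blast
  have "i = k \<and> \<mu> k = a"
  proof (rule ccontr)
    assume "\<not> ?thesis"
    then have "i = l" "\<mu> l = b" using srcs[OF i(1,2)] by auto
    then show False using i(3) kV r(3) ab by fastforce
  qed
  then have ka: "\<mu> k = a" "source \<mu> k" "\<forall>j\<in>V. \<mu> j \<le> a" using i by auto
  have uniq: "j = k" if j: "j \<in> V" "source \<mu> j" for j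
  proof (rule ccontr)
    assume "j \<noteq> k"
    then have jl: "j = l" "\<mu> l = b" using srcs[OF j] by auto
    obtain u v where uv: "u \<in> P" "v \<in> P" "pos \<mu> u = (k, a)" "pos \<mu> v = (l, b)" "comparable T (quiver_of \<mu>) u v"
      using pm unfolding pair_data_def by blast
    have "u = simple_root k" "v = simple_root j"
      using pos_inject[OF hm] uv simple_root_positive pos_source[OF hm ka(2) kV] pos_source[OF hm j(2,1)] kV j(1) ka(1) jl
      by metis+
    then show False using sources_incomparable[OF hm ka(2) kV j(2,1)] uv(5) \<open>j \<noteq> k\<close> by blast
  qed
  have "\<mu> j < a" if "j \<in> V" "j \<noteq> k" for j
  proof (rule ccontr)
    assume "\<not> \<mu> j < a"
    then have "source \<mu> j" using ka(3) that(1) top_is_source[OF hm, of j] by fastforce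
    then show False using uniq that by blast
  qed
  then show ?thesis using hm pm ka uniq by blast
qed

text \<open>
  Wherever \<open>\<mu>\<close> exceeds \<open>\<zeta>\<close>, it does so at a source.
\<close>

lemma unique_source_least:
  assumes "height \<mu>" "\<And>i. i \<in> V \<Longrightarrow> source \<mu> i \<Longrightarrow> i = k" "height \<zeta>" "\<mu> k = \<zeta> k" "k \<in> V" "j \<in> V"
  shows "\<mu> j \<le> \<zeta> j"
proof (rule ccontr)
  assume n: "\<not> \<mu> j \<le> \<zeta> j"
  have ev: "even (\<mu> i - \<zeta> i)" if "i \<in> V" for i
    using height_parity[OF assms(1,3,5) _ that] assms(4) by simp
  let ?m = "\<lambda>i. min (\<mu> i) (\<zeta> i)"
  have "\<exists>i\<in>V. source \<mu> i \<and> ?m i \<le> \<mu> i - 2 \<and> (\<forall>j\<in>V. ?m j < \<mu> j \<longrightarrow> \<mu> j \<le> \<mu> i)"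
  proof (rule descend_step[OF assms(1) height_min[OF assms(1,3) ev]])
    show "\<exists>i\<in>V. ?m i < \<mu> i" using n assms(6) by (intro bexI[of _ j]) auto
    show "even (\<mu> i - ?m i)" if "i \<in> V" for i using ev[OF that] by (simp add: min_def)
  qed simp_all
  then obtain i where "i \<in> V" "source \<mu> i" "?m i \<le> \<mu> i - 2" by blast
  then show False using assms(2,4) by fastforce
qed

lemma height_raise:
  assumes h: "height \<nu>" and sink: "\<And>j. {i, j} \<in> dynkin_edges T \<Longrightarrow> \<nu> j = \<nu> i + 1"
  shows "height (\<nu>(i := \<nu> i + 2))"
  unfolding height_def
proof (intro allI impI)
  fix a b assume e: "{a, b} \<in> dynkin_edges T"
  then have "a \<noteq> b" using edge_vertices by blast
  then show "\<bar>(\<nu>(i := \<nu> i + 2)) a - (\<nu>(i := \<nu> i + 2)) b\<bar> = 1"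
    using height_edge[OF h e] sink[of a] sink[of b] e edge_sym[of a b] by auto
qed

text \<open>
  The last letter of some full adapted word comes from rotating \<open>i\<close> away from the front; its root is \<open>\<alpha>\<^sub>i\<close>.
\<close>

lemma sink_last_root:
  assumes h: "height \<nu>" and sink: "\<And>j. {i, j} \<in> dynkin_edges T \<Longrightarrow> \<nu> j = \<nu> i + 1" and opp: "opposite l i"
  shows "pos \<nu> (simple_root i) = (l, bottom \<nu> l + 2)"
proof -
  let ?\<nu> = "\<nu>(i := \<nu> i + 2)"
  have lV: "i \<in> V" "l \<in> V" using opp by (auto simp: opposite_def)
  have h': "height ?\<nu>" using height_raise[OF h sink] .
  have src: "source ?\<nu> i"
    unfolding source_iff[OF h']
  proof (intro allI impI)
    fix j assume e: "{i, j} \<in> dynkin_edges T"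
    then have "j \<noteq> i" using edge_vertices by blast
    then show "?\<nu> j = ?\<nu> i - 1" using sink[OF e] by simp
  qed
  have low: "lower i ?\<nu> = \<nu>" by (auto simp: lower_def)
  obtain us where us: "full_word (i # us)" "adp ?\<nu> (i # us)"
    using adapted_full_from_source[OF h' src lV(1)] by blast
  obtain j where j: "full_word (us @ [j])" "adp \<nu> (us @ [j])" "W us (simple_root j) = simple_root i" "opposite i j"
    using adapted_rotate[OF h' us] low by auto
  have jl: "j = l" using j(4) opp opposite_sym opposite_unique by blast
  have "rl (us @ [j]) ! length us = simple_root i" using j(3) by (simp add: root_list_append nth_append)
  then have "pos \<nu> (simple_root i) = (l, \<nu> l - 2 * int (count_list us l))"
    using pos_nth[OF h j(1,2), of "length us"] jl by simp
  moreover have "bottom \<nu> l = \<nu> l - 2 * int (count_list us l) - 2"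
    using bottom_eq[OF h j(1,2) lV(2)] jl by (simp add: final_height_def)
  ultimately show ?thesis by simp
qed

text \<open>
  Raise \<open>\<mu>\<close> as far as possible such that \<open>k\<close> remains the highest vertex and \<open>(l, b)\<close> is not lost, that is,
  the height at \<open>l'\<close> is at most \<open>b + h - 2\<close>.  As \<open>a - b \<ge> h\<close>, the vertex \<open>l'\<close> ends up as a sink of
  exactly this height.  Then the roots of the pair are \<open>\<alpha>\<^sub>k\<close> and the simple root of \<open>l'\<close>, and \<open>k\<close>, \<open>l'\<close> are
  not adjacent because their heights differ by at least two.
\<close>

lemma distant_pair:
  assumes hm: "height \<mu>" and pm: "pair_data \<mu> k a l b c d" and ka: "\<mu> k = a"
    and top: "\<And>j. j \<in> V \<Longrightarrow> j \<noteq> k \<Longrightarrow> \<mu> j < a" and uniq: "\<And>i. i \<in> V \<Longrightarrow> source \<mu> i \<Longrightarrow> i = k"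
    and opp: "opposite l l'" and far: "b + (\<mu> l' - bottom \<mu> l) \<le> a"
  shows "d = 0"
proof -
  let ?h = "\<mu> l' - bottom \<mu> l"
  \<comment> \<open>With this height at \<open>l'\<close>, the point \<open>(l, b)\<close> is the last one of its row.\<close>
  define e where "e = b + ?h - 2"
  note r = pair_data_range[OF hm pm]
  have lV: "l \<in> V" "l' \<in> V" "k \<in> V" using opp r by (auto simp: opposite_def)
  obtain ws where ws: "full_word ws" "adp \<mu> ws" using adapted_full_exists hm by blast
  have "even (\<mu> l - bottom \<mu> l)" using bottom_eq[OF hm ws lV(1)] by (simp add: final_height_def) presburger
  then have evb: "even (b - bottom \<mu> l)" using r(8) by presburger
  then have "bottom \<mu> l + 2 \<le> b" using r(6) by presburger
  then have e: "\<mu> l' \<le> e" "e \<le> a - 2" "even (e - \<mu> l')" using far evb by (auto simp: e_def)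
  have l'k: "l' \<noteq> k" using e ka by auto
  let ?N = "\<lambda>\<nu>. height \<nu> \<and> (\<forall>j\<in>V. even (\<nu> j - \<mu> j)) \<and> \<nu> k = a \<and> (\<forall>j\<in>V. j \<noteq> k \<longrightarrow> \<nu> j < a) \<and> \<nu> l' \<le> e"
  define f where "f \<nu> = nat (\<Sum>i\<in>V. a - \<nu> i)" for \<nu> :: "nat \<Rightarrow> int"
  have "?N \<mu>" using hm ka top e(1) by auto
  then obtain \<nu> where \<nu>: "?N \<nu>" and least: "\<And>\<nu>'. ?N \<nu>' \<Longrightarrow> f \<nu> \<le> f \<nu>'"
    using ex_has_least_nat[of ?N \<mu> f] by blast
  have hn: "height \<nu>" and na: "\<nu> k = a" and ntop: "\<And>j. j \<in> V \<Longrightarrow> j \<noteq> k \<Longrightarrow> \<nu> j < a" and nl': "\<nu> l' \<le> e"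
    and evn: "\<And>j. j \<in> V \<Longrightarrow> even (\<nu> j - \<mu> j)" using \<nu> by auto
  have sinks: "\<nu> j \<ge> a - 2 \<or> j = l' \<and> \<nu> l' = e"
    if j: "j \<in> V" "j \<noteq> k" "\<And>i. {j, i} \<in> dynkin_edges T \<Longrightarrow> \<nu> i = \<nu> j + 1" for j
  proof (rule ccontr)
    assume n: "\<not> ?thesis"
    let ?\<nu> = "\<nu>(j := \<nu> j + 2)"
    have h': "height ?\<nu>" using height_raise[OF hn j(3)] .
    have "even (\<nu> l' - e)" using evn[OF lV(2)] e(3) by presburger
    then have "j = l' \<Longrightarrow> \<nu> l' + 2 \<le> e" using n nl' by presburger
    then have N: "?N ?\<nu>" using h' evn na ntop nl' n j(2) by auto
    have "(\<Sum>i\<in>V. a - ?\<nu> i) < (\<Sum>i\<in>V. a - \<nu> i)"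
      using j(1) by (intro sum_strict_mono_ex1) auto
    moreover have "(\<Sum>i\<in>V. a - ?\<nu> i) \<ge> 0"
    proof (intro sum_nonneg)
      fix i assume "i \<in> V"
      have "?\<nu> k = a" "\<forall>j\<in>V. j \<noteq> k \<longrightarrow> ?\<nu> j < a" using N by blast+
      then show "0 \<le> a - ?\<nu> i" using \<open>i \<in> V\<close> by (cases "i = k") fastforce+
    qed
    ultimately have "f ?\<nu> < f \<nu>" by (simp add: f_def)
    then show False using least[OF N] by simp
  qed
  \<comment> \<open>A vertex of least height is a sink that cannot be raised, which forces it to have the height \<open>e\<close> of \<open>l'\<close>.\<close>
  define m where "m = Min (\<nu> ` V)"
  have "m \<in> \<nu> ` V" unfolding m_def using lV by (intro Min_in) auto
  then obtain j where j: "j \<in> V" "\<nu> j = m" by auto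
  have jmin: "\<nu> j \<le> \<nu> i" if "i \<in> V" for i unfolding j(2) m_def using that by simp
  have sink: "\<nu> i = \<nu> x + 1" if "{x, i} \<in> dynkin_edges T" "\<nu> x = m" for x i
    using height_edge[OF hn that(1)] jmin[of i] edge_vertices[OF that(1)] that(2) j(2) by fastforce
  have "j \<noteq> k" using jmin[OF lV(2)] nl' e(2) na by auto
  then have "\<nu> j \<ge> a - 2 \<or> j = l' \<and> \<nu> l' = e" using sinks[OF j(1)] sink j(2) by blast
  then have l'm: "\<nu> l' = e" "\<nu> l' = m" using jmin[OF lV(2)] nl' e(2) j(2) by auto
  have "b = bottom \<nu> l + 2"
    using opposite_bottom_const[OF hn hm evn opp] l'm(1) by (simp add: e_def)
  then have p2: "pos \<nu> (simple_root l') = (l, b)"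
    using sink_last_root[OF hn _ opp] sink l'm(2) by blast
  have srck: "source \<nu> k"
    using na ntop by (intro top_is_source[OF hn]) fastforce
  then have p1: "pos \<nu> (simple_root k) = (k, a)" using pos_source[OF hn srck lV(3)] na by simp
  have "{k, l'} \<notin> dynkin_edges T"
    using height_edge[OF hn, of k l'] na l'm(1) e(2) by auto
  then have "gdist T (quiver_of \<nu>) (pair_seq (simple_root k) (simple_root l')) = 0"
    using nonadjacent_simple_pair[OF hn srck lV(3,2) l'k] by blast
  then have "\<exists>c'. pair_data \<nu> k a l b c' 0"
    unfolding pair_data_def using p1 p2 simple_root_positive lV by blast
  then obtain c' where "pair_data \<nu> k a l b c' 0" by blast
  moreover have "\<mu> i \<le> \<nu> i" if "i \<in> V" for i
    using unique_source_least[OF hm uniq hn _ lV(3) that] ka na by simp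
  ultimately have "pair_data \<mu> k a l b c' 0"
    using pair_data_descend[OF hn hm _ evn] ka r(7) by simp
  then show ?thesis using pair_data_unique[OF hm pm] by blast
qed

text \<open>
  Shifted to the value \<open>a\<close> at \<open>k\<close>, both \<open>\<zeta>\<close> and \<open>- \<zeta>\<close> lie above the canonical height function.  As their sum is
  \<open>2 a\<close> everywhere, they can both lose \<open>(l, b)\<close> only if the points are so far apart that \<open>distant_pair\<close> applies.
\<close>

lemma comparable_pair_transfer:
  assumes h: "height \<eta>" and pd: "pair_data \<eta> k a l b True d" and ab: "b < a" and d: "d \<noteq> 0" and hz: "height \<zeta>"
  shows "(\<exists>c. pair_data \<zeta> k (a + c) l (b + c) True d) \<or> (\<exists>c. pair_data (\<lambda>i. - \<zeta> i) k (a + c) l (b + c) True d)"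
proof -
  obtain \<mu> where hm: "height \<mu>" and pm: "pair_data \<mu> k a l b True d" and ka: "\<mu> k = a"
    and top: "\<And>j. j \<in> V \<Longrightarrow> j \<noteq> k \<Longrightarrow> \<mu> j < a" and uniq: "\<And>i. i \<in> V \<Longrightarrow> source \<mu> i \<Longrightarrow> i = k"
    using comparable_pair_canonical[OF h pd ab] by blast
  note r = pair_data_range[OF hm pm]
  obtain l' where opp: "opposite l l'" using opposite_exists r(5) by blast
  have l'V: "l' \<in> V" using opp by (simp add: opposite_def)
  have inside: "pair_data \<omega> k a l b True d"
    if ho: "height \<omega>" and oa: "\<omega> k = a" and ob: "bottom \<omega> l < b" for \<omega>
  proof -
    have le: "\<mu> i \<le> \<omega> i" if "i \<in> V" for i
      using unique_source_least[OF hm uniq ho _ r(1) that] ka oa by simp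
    have ev: "even (\<omega> i - \<mu> i)" if "i \<in> V" for i
      using height_parity[OF ho hm r(1) _ that] ka oa by simp
    obtain ws where ws: "full_word ws" "adp \<omega> ws" using adapted_full_exists ho by blast
    have "count_list ws k > 0" using mem_full_word[OF ws(1) r(1)] by (metis count_list_0_iff gr0I)
    then have bk: "bottom \<omega> k < a" using bottom_eq[OF ho ws r(1)] oa by (simp add: final_height_def)
    have "even (\<omega> l - b)" using ev[OF r(5)] r(8) by presburger
    then obtain c' d' where pd': "pair_data \<omega> k a l b c' d'"
      using pair_data_exists[OF ho r(1) bk _ _ r(5) ob] oa le[OF r(5)] r(7) by auto
    then have "pair_data \<mu> k a l b c' d'"
      using pair_data_descend[OF ho hm le ev] ka r(7) by simp
    then show ?thesis using pd' pair_data_unique[OF hm pm] by blast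
  qed
  let ?o1 = "\<lambda>i. \<zeta> i + (a - \<zeta> k)" and ?o2 = "\<lambda>i. - \<zeta> i + (a + \<zeta> k)"
  have h1: "height ?o1" and h2: "height ?o2"
    using height_shift[OF hz] height_shift[OF height_minus[OF hz]] by auto
  have ev1: "even (?o1 i - \<mu> i)" if "i \<in> V" for i
    using height_parity[OF h1 hm r(1) _ that] ka by simp
  have ev2: "even (?o2 i - \<mu> i)" if "i \<in> V" for i
    using height_parity[OF h2 hm r(1) _ that] ka by simp
  have "bottom ?o1 l < b \<or> bottom ?o2 l < b"
  proof (rule ccontr)
    assume "\<not> ?thesis"
    then have "b + (\<mu> l' - bottom \<mu> l) \<le> ?o1 l'" "b + (\<mu> l' - bottom \<mu> l) \<le> ?o2 l'"
      using opposite_bottom_const[OF h1 hm ev1 opp] opposite_bottom_const[OF h2 hm ev2 opp] by auto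
    then have "b + (\<mu> l' - bottom \<mu> l) \<le> a" by simp
    then show False using distant_pair[OF hm pm ka top uniq opp] d by blast
  qed
  then show ?thesis
  proof
    assume "bottom ?o1 l < b"
    then have "pair_data ?o1 k a l b True d" using inside[OF h1] by simp
    then have "pair_data (\<lambda>j. ?o1 j + - (a - \<zeta> k)) k (a + - (a - \<zeta> k)) l (b + - (a - \<zeta> k)) True d"
      by (rule pair_data_shift[OF h1])
    moreover have "(\<lambda>j. ?o1 j + - (a - \<zeta> k)) = \<zeta>" by (simp add: fun_eq_iff)
    ultimately show ?thesis by metis
  next
    assume "bottom ?o2 l < b"
    then have "pair_data ?o2 k a l b True d" using inside[OF h2] by simp
    then have "pair_data (\<lambda>j. ?o2 j + - (a + \<zeta> k)) k (a + - (a + \<zeta> k)) l (b + - (a + \<zeta> k)) True d"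
      by (rule pair_data_shift[OF h2])
    moreover have "(\<lambda>j. ?o2 j + - (a + \<zeta> k)) = (\<lambda>i. - \<zeta> i)" by (simp add: fun_eq_iff)
    ultimately show ?thesis by metis
  qed
qed

section \<open>Exponents of the distance polynomial\<close>

definition has_pair :: "(nat \<Rightarrow> int) \<Rightarrow> nat \<Rightarrow> nat \<Rightarrow> nat \<Rightarrow> nat \<Rightarrow> bool" where
  "has_pair \<eta> k l t d \<longleftrightarrow> (\<exists>a b. \<bar>a - b\<bar> = int t \<and> pair_data \<eta> k a l b True d)"

lemma has_pair_unique:
  assumes "height \<eta>" "height \<zeta>" "has_pair \<eta> k l t d" "has_pair \<zeta> k l t d'"
  shows "d = d'"
  using assms pair_data_invariant unfolding has_pair_def by metis

text \<open>
  In the pair, the point with the larger second coordinate may lie in either row.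
\<close>

lemma has_pair_transfer:
  assumes "height \<eta>" "has_pair \<eta> k l t d" "t \<noteq> 0" "d \<noteq> 0" "height \<zeta>"
  shows "has_pair \<zeta> k l t d \<or> has_pair (\<lambda>i. - \<zeta> i) k l t d"
proof -
  obtain a b where ab: "\<bar>a - b\<bar> = int t" "pair_data \<eta> k a l b True d" using assms(2) unfolding has_pair_def by blast
  have hp: "has_pair \<omega> k l t d" if "pair_data \<omega> k (a + c) l (b + c) True d" for \<omega> c
    unfolding has_pair_def using that ab(1) by (intro exI[of _ "a + c"] exI[of _ "b + c"]) simp
  show ?thesis
  proof (cases "b < a")
    case True
    then show ?thesis using comparable_pair_transfer[OF assms(1) ab(2) True assms(4,5)] hp by blast
  next
    case False
    then have "a < b" using ab(1) assms(3) by auto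
    then show ?thesis
      using comparable_pair_transfer[OF assms(1) pair_data_swap[OF ab(2)] _ assms(4,5)] hp pair_data_swap by blast
  qed
qed

lemma root_pairs_has_pair:
  "(\<exists>(u, v)\<in>root_pairs T \<xi> (quiver_of (\<xi> Q)) k l t. gdist T Q (pair_seq u v) = d) \<longleftrightarrow> has_pair (\<xi> Q) k l t d"
  if Q: "Q = quiver_of (\<xi> Q)"
proof -
  have pos: "coordinate T Q (\<xi> Q) u = pos (\<xi> Q) u" for u
    unfolding pos_def using Q by simp
  show ?thesis
  proof
    assume "\<exists>(u, v)\<in>root_pairs T \<xi> (quiver_of (\<xi> Q)) k l t. gdist T Q (pair_seq u v) = d"
    then obtain u v where uv: "(u, v) \<in> root_pairs T \<xi> Q k l t" "gdist T Q (pair_seq u v) = d"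
      using Q by auto
    then obtain a b where ab: "{pos (\<xi> Q) u, pos (\<xi> Q) v} = {(k, a), (l, b)}" "\<bar>a - b\<bar> = int t"
      unfolding root_pairs_def pos by blast
    have c: "u \<in> P" "v \<in> P" "comparable T Q u v" using uv(1) by (auto simp: root_pairs_def comparable_def)
    have "pair_data (\<xi> Q) k a l b True d"
    proof (cases "pos (\<xi> Q) u = (k, a) \<and> pos (\<xi> Q) v = (l, b)")
      case True
      then show ?thesis unfolding pair_data_def using c uv(2) Q by metis
    next
      case False
      then have "pos (\<xi> Q) v = (k, a)" "pos (\<xi> Q) u = (l, b)" using ab(1) by (auto simp: doubleton_eq_iff)
      then have "pair_data (\<xi> Q) l b k a True d" unfolding pair_data_def using c uv(2) Q by metis
      then show ?thesis by (rule pair_data_swap)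
    qed
    then show "has_pair (\<xi> Q) k l t d" using ab(2) unfolding has_pair_def by blast
  next
    assume "has_pair (\<xi> Q) k l t d"
    then obtain a b u v where "\<bar>a - b\<bar> = int t" "u \<in> P" "v \<in> P" "pos (\<xi> Q) u = (k, a)" "pos (\<xi> Q) v = (l, b)"
      "comparable T Q u v" "gdist T Q (pair_seq u v) = d"
      using Q unfolding has_pair_def pair_data_def by metis
    then have "(u, v) \<in> root_pairs T \<xi> Q k l t" "gdist T Q (pair_seq u v) = d"
      unfolding root_pairs_def pos comparable_def by auto
    then show "\<exists>(u, v)\<in>root_pairs T \<xi> (quiver_of (\<xi> Q)) k l t. gdist T Q (pair_seq u v) = d"
      using Q by auto
  qed
qed

lemma dist_exponent_eq:
  assumes h: "height (\<xi> Q)" and Q: "Q = quiver_of (\<xi> Q)" and t: "t \<noteq> 0"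
  shows "has_pair (\<xi> Q) k l t d \<Longrightarrow> dist_exponent T \<xi> Q k l t = d"
    and "dist_exponent T \<xi> Q k l t \<noteq> 0 \<Longrightarrow> has_pair (\<xi> Q) k l t (dist_exponent T \<xi> Q k l t)"
proof -
  note rp = root_pairs_has_pair[of Q \<xi> k l t, OF Q, folded Q]
  show eq: "dist_exponent T \<xi> Q k l t = d" if hp: "has_pair (\<xi> Q) k l t d" for d
  proof -
    obtain u v where uv: "(u, v) \<in> root_pairs T \<xi> Q k l t" "gdist T Q (pair_seq u v) = d" using hp rp by blast
    have all: "gdist T Q (pair_seq u' v') = d" if "(u', v') \<in> root_pairs T \<xi> Q k l t" for u' v'
    proof -
      have "has_pair (\<xi> Q) k l t (gdist T Q (pair_seq u' v'))" using that rp by blast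
      then show ?thesis using has_pair_unique[OF h h hp] by simp
    qed
    have "(THE e. \<forall>(\<alpha>, \<beta>)\<in>root_pairs T \<xi> Q k l t. gdist T Q (pair_seq \<alpha> \<beta>) = e) = d"
      using all uv by (intro the_equality) auto
    then show ?thesis unfolding dist_exponent_def using t uv(1) by auto
  qed
  assume nz: "dist_exponent T \<xi> Q k l t \<noteq> 0"
  then have "root_pairs T \<xi> Q k l t \<noteq> {}" unfolding dist_exponent_def by (auto split: if_splits)
  then obtain u v where "(u, v) \<in> root_pairs T \<xi> Q k l t" by auto
  then have "has_pair (\<xi> Q) k l t (gdist T Q (pair_seq u v))" using rp by blast
  then show "has_pair (\<xi> Q) k l t (dist_exponent T \<xi> Q k l t)" using eq by simp
qed

text \<open>
  Two height functions of one quiver differ by a constant.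
\<close>

lemma has_pair_quiver_cong:
  assumes "height \<eta>" "height \<zeta>" "quiver_of \<eta> = quiver_of \<zeta>" "has_pair \<eta> k l t d"
  shows "has_pair \<zeta> k l t d"
proof -
  obtain a b where ab: "\<bar>a - b\<bar> = int t" "pair_data \<eta> k a l b True d" using assms(4) unfolding has_pair_def by blast
  have kV: "k \<in> V" using pair_data_range[OF assms(1) ab(2)] by blast
  define c where "c = \<zeta> k - \<eta> k"
  have "pair_data (\<lambda>j. \<eta> j + c) k (a + c) l (b + c) True d" using pair_data_shift[OF assms(1) ab(2)] .
  moreover have "\<eta> i + c = \<zeta> i" if "i \<in> V" for i
    using height_difference_const[OF assms(1-3) kV that] by (simp add: c_def)
  ultimately have "pair_data \<zeta> k (a + c) l (b + c) True d"
    using pair_data_cong[OF height_shift[OF assms(1)], of c \<zeta>] by blast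
  then show ?thesis unfolding has_pair_def using ab(1) by (intro exI[of _ "a + c"] exI[of _ "b + c"]) simp
qed

text \<open>
  A nonzero maximum is the distance of a pair for \<open>Q\<close> or its reverse; such a pair exists for \<open>Q'\<close> or its
  reverse and has the same distance.
\<close>

lemma dist_exponent_sym_le:
  assumes xi: "\<And>R. dynkin_quiver T R \<Longrightarrow> height_function R (\<xi> R)"
    and Q: "dynkin_quiver T Q" and Q': "dynkin_quiver T Q'"
  shows "dist_exponent_sym T \<xi> Q k l t \<le> dist_exponent_sym T \<xi> Q' k l t"
proof (cases "t = 0 \<or> dist_exponent_sym T \<xi> Q k l t = 0")
  case True
  then show ?thesis
  proof
    assume "t = 0"
    then show ?thesis by (simp add: dist_exponent_sym_def dist_exponent_def)
  qed simp
next
  case False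
  then have t: "t \<noteq> 0" and nz: "dist_exponent_sym T \<xi> Q k l t \<noteq> 0" by auto
  have good: "height (\<xi> R)" "R = quiver_of (\<xi> R)" if "dynkin_quiver T R" for R
    using quiver_of_height_function[OF that xi[OF that]] by auto
  have conv: "dynkin_quiver T (R\<inverse>)" "quiver_of (\<lambda>i. - \<xi> R i) = R\<inverse>" if "dynkin_quiver T R" for R
  proof -
    show "quiver_of (\<lambda>i. - \<xi> R i) = R\<inverse>" using quiver_of_minus[of "\<xi> R"] good(2)[OF that] by simp
    then show "dynkin_quiver T (R\<inverse>)" using dynkin_quiver_of[OF height_minus[OF good(1)[OF that]]] by simp
  qed
  let ?d = "dist_exponent_sym T \<xi> Q k l t"
  have "?d = dist_exponent T \<xi> Q k l t \<or> ?d = dist_exponent T \<xi> (Q\<inverse>) k l t"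
    by (simp add: dist_exponent_sym_def max_def)
  then obtain R where R: "dynkin_quiver T R" "?d = dist_exponent T \<xi> R k l t"
    using Q conv(1) by blast
  have "has_pair (\<xi> R) k l t ?d"
    using dist_exponent_eq(2)[where \<xi> = \<xi> and Q = R and k = k and l = l, OF good[OF R(1)] t] nz R(2) by simp
  then have "has_pair (\<xi> Q') k l t ?d \<or> has_pair (\<lambda>i. - \<xi> Q' i) k l t ?d"
    using has_pair_transfer[OF good(1)[OF R(1)] _ t nz good(1)[OF Q']] by blast
  then show ?thesis
  proof
    assume "has_pair (\<xi> Q') k l t ?d"
    then show ?thesis using dist_exponent_eq(1)[where \<xi> = \<xi> and Q = Q' and k = k and l = l, OF good[OF Q'] t] by (simp add: dist_exponent_sym_def)
  next
    assume hp: "has_pair (\<lambda>i. - \<xi> Q' i) k l t ?d"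
    note g = good[OF conv(1)[OF Q']]
    have "has_pair (\<xi> (Q'\<inverse>)) k l t ?d"
      using has_pair_quiver_cong[OF height_minus[OF good(1)[OF Q']] g(1) _ hp] conv(2)[OF Q'] g(2) by simp
    then show ?thesis using dist_exponent_eq(1)[where \<xi> = \<xi> and Q = "Q'\<inverse>" and k = k and l = l, OF g t] by (simp add: dist_exponent_sym_def)
  qed
qed

theorem distance_poly_independent:
  assumes "\<And>R. dynkin_quiver T R \<Longrightarrow> height_function R (\<xi> R)"
    and "dynkin_quiver T Q" "dynkin_quiver T Q'"
  shows "distance_poly T \<xi> Q k l = distance_poly T \<xi> Q' k l"
proof -
  have "dist_exponent_sym T \<xi> Q k l t = dist_exponent_sym T \<xi> Q' k l t" for t
    using dist_exponent_sym_le[OF assms] dist_exponent_sym_le[OF assms(1,3,2)] by (simp add: antisym)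
  then show ?thesis by (simp add: distance_poly_def)
qed

end

section \<open>The diagrams of types A, D and E\<close>

lemma edges_A:
  "{i, j} \<in> dynkin_edges (TypeA n) \<longleftrightarrow> 1 \<le> i \<and> j = i + 1 \<and> j \<le> n \<or> 1 \<le> j \<and> i = j + 1 \<and> i \<le> n"
  by (auto simp: doubleton_eq_iff)

lemma edges_D:
  "{i, j} \<in> dynkin_edges (TypeD n) \<longleftrightarrow> 1 \<le> i \<and> j = i + 1 \<and> j \<le> n - 1 \<or> 1 \<le> j \<and> i = j + 1 \<and> i \<le> n - 1
     \<or> i = n - 2 \<and> j = n \<or> j = n - 2 \<and> i = n"
  by (auto simp: doubleton_eq_iff)

lemma edges_E:
  "{i, j} \<in> dynkin_edges (TypeE n) \<longleftrightarrow> 3 \<le> i \<and> j = i + 1 \<and> j \<le> n \<or> 3 \<le> j \<and> i = j + 1 \<and> i \<le> n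
     \<or> i = 1 \<and> j = 3 \<or> i = 3 \<and> j = 1 \<or> i = 2 \<and> j = 4 \<or> i = 4 \<and> j = 2"
  by (auto simp: doubleton_eq_iff)

lemma chain_connected:
  assumes "\<And>x::nat. lo \<le> x \<Longrightarrow> x < hi \<Longrightarrow> x \<in> S \<longleftrightarrow> Suc x \<in> S" "lo \<le> x" "x \<le> hi"
  shows "x \<in> S \<longleftrightarrow> lo \<in> S"
  using assms(2,3)
proof (induction x rule: dec_induct)
  case (step x)
  then show ?case using assms(1)[of x] by simp
qed simp

lemma cut_flip:
  assumes "j \<in> S" "i \<notin> S" "\<And>a b. {a, b} \<in> dynkin_edges T \<Longrightarrow> a \<in> S \<Longrightarrow> b \<notin> S \<Longrightarrow> a = j \<and> b = i"
  shows "\<exists>S. j \<in> S \<and> i \<notin> S \<and> (\<forall>a b. {a, b} \<in> dynkin_edges T \<and> a \<in> S \<and> b \<notin> S \<longrightarrow> a = j \<and> b = i)"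
    and "\<exists>S. i \<in> S \<and> j \<notin> S \<and> (\<forall>a b. {a, b} \<in> dynkin_edges T \<and> a \<in> S \<and> b \<notin> S \<longrightarrow> a = i \<and> b = j)"
proof -
  show "\<exists>S. j \<in> S \<and> i \<notin> S \<and> (\<forall>a b. {a, b} \<in> dynkin_edges T \<and> a \<in> S \<and> b \<notin> S \<longrightarrow> a = j \<and> b = i)"
    using assms by blast
  have "{a, b} = {b, a}" for a b :: nat by blast
  then show "\<exists>S. i \<in> S \<and> j \<notin> S \<and> (\<forall>a b. {a, b} \<in> dynkin_edges T \<and> a \<in> S \<and> b \<notin> S \<longrightarrow> a = i \<and> b = j)"
    using assms by (intro exI[of _ "- S"]) (metis ComplD ComplI)
qed

lemma int_abs_le_square: "\<bar>x\<bar> \<le> x ^ 2" for x :: int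
proof (cases "x = 0")
  case False
  then have "\<bar>x\<bar> * 1 \<le> \<bar>x\<bar> * \<bar>x\<bar>" by (intro mult_left_mono) auto
  then show ?thesis by (simp add: power2_eq_square)
qed simp

text \<open>
  For \<open>m\<close> consecutive vertices of a chain, completing squares leaves a boundary term at the open end.
\<close>

lemma chain_form:
  fixes x :: "nat \<Rightarrow> int"
  assumes "x 0 = 0"
  shows "(\<Sum>i = 1..m. x i * (2 * x i - x (i - 1) - x (i + 1))) =
    (\<Sum>i<m. (x (Suc i) - x i) ^ 2) + x m ^ 2 - x m * x (m + 1)"
proof (induction m)
  case (Suc m)
  then show ?case by (simp add: algebra_simps power2_eq_square)
qed (simp add: assms)

lemma chain_bound:
  fixes x :: "nat \<Rightarrow> int"
  assumes "x 0 = 0" "i \<le> m"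
  shows "\<bar>x i\<bar> \<le> (\<Sum>i<m. (x (Suc i) - x i) ^ 2)"
proof -
  have "\<bar>x i\<bar> \<le> (\<Sum>j<i. (x (Suc j) - x j) ^ 2)"
  proof (induction i)
    case (Suc i)
    have "\<bar>x (Suc i)\<bar> \<le> \<bar>x i\<bar> + \<bar>x (Suc i) - x i\<bar>" by simp
    then show ?case using Suc int_abs_le_square[of "x (Suc i) - x i"] by simp
  qed (simp add: assms(1))
  also have "\<dots> \<le> (\<Sum>i<m. (x (Suc i) - x i) ^ 2)"
    using assms(2) by (intro sum_mono2) auto
  finally show ?thesis .
qed

lemma sum_delta_lattice:
  assumes "v \<in> root_lattice T"
  shows "(\<Sum>j\<in>vertices T. if j = k then v j else 0) = v k"
  using assms by (simp add: root_lattice_def)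

lemma coroot_A:
  assumes "v \<in> root_lattice (TypeA n)" "i \<in> {1..n}"
  shows "coroot_pairing (TypeA n) i v = 2 * v i - v (i - 1) - v (i + 1)"
proof -
  note d = sum_delta_lattice[OF assms(1)]
  have "coroot_pairing (TypeA n) i v = (\<Sum>j\<in>vertices (TypeA n). 2 * (if j = i then v j else 0)
      - (if j = i - 1 then v j else 0) - (if j = i + 1 then v j else 0))"
    unfolding coroot_pairing_def using assms(2)
    by (intro sum.cong refl) (auto simp del: dynkin_edges.simps simp: cartan_def edges_A)
  then show ?thesis using d[of i] d[of "i - 1"] d[of "i + 1"]
    by (simp add: sum_subtractf sum_distrib_left[symmetric] del: vertices.simps)
qed

lemma form_A:
  assumes "v \<in> root_lattice (TypeA n)"
  shows "cartan_form (TypeA n) v v = (\<Sum>i<n. (v (Suc i) - v i) ^ 2) + v n ^ 2"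
proof -
  have "v 0 = 0" "v (n + 1) = 0" using assms by (auto simp: root_lattice_def)
  moreover have "cartan_form (TypeA n) v v = (\<Sum>i = 1..n. v i * (2 * v i - v (i - 1) - v (i + 1)))"
    unfolding cartan_form_def using coroot_A[OF assms] by (intro sum.cong) auto
  ultimately show ?thesis using chain_form[of v n] by simp
qed

lemma finite_type_A:
  assumes "n \<ge> 1"
  shows "finite_type (TypeA n)"
proof
  fix i j assume e: "{i, j} \<in> dynkin_edges (TypeA n)"
  then show "i \<in> vertices (TypeA n) \<and> j \<in> vertices (TypeA n) \<and> i \<noteq> j" unfolding edges_A by auto
  show "\<exists>S. j \<in> S \<and> i \<notin> S \<and> (\<forall>a b. {a, b} \<in> dynkin_edges (TypeA n) \<and> a \<in> S \<and> b \<notin> S \<longrightarrow> a = j \<and> b = i)"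
  proof (cases "i < j")
    case True
    then have "j = i + 1" using e unfolding edges_A by auto
    then show ?thesis by (intro cut_flip(1)[of j "{j..}"]) (auto simp: edges_A simp del: dynkin_edges.simps)
  next
    case False
    then have "i = j + 1" using e unfolding edges_A by auto
    then show ?thesis by (intro cut_flip(1)[of j "{..j}"]) (auto simp: edges_A simp del: dynkin_edges.simps)
  qed
next
  have "\<bar>v i\<bar> \<le> 1 * cartan_form (TypeA n) v v" if v: "v \<in> root_lattice (TypeA n)" for v i
  proof (cases "i \<le> n")
    case True
    have "v 0 = 0" using v by (auto simp: root_lattice_def)
    then show ?thesis using chain_bound[of v i n] True form_A[OF v] zero_le_power2[of "v n"] by linarith
  next
    case False
    then have "v i = 0" using v by (auto simp: root_lattice_def)
    moreover have "cartan_form (TypeA n) v v \<ge> 0" unfolding form_A[OF v] by (intro add_nonneg_nonneg sum_nonneg zero_le_power2)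
    ultimately show ?thesis by simp
  qed
  then show "\<exists>D. \<forall>v\<in>root_lattice (TypeA n). \<forall>i. \<bar>v i\<bar> \<le> D * cartan_form (TypeA n) v v" by blast
next
  fix S i assume i: "i \<in> vertices (TypeA n)" "i \<in> S"
    and cl: "\<And>a b. {a, b} \<in> dynkin_edges (TypeA n) \<Longrightarrow> a \<in> S \<Longrightarrow> b \<in> S"
  have "x \<in> S \<longleftrightarrow> Suc x \<in> S" if "1 \<le> x" "x < n" for x
    using cl[of x "Suc x"] cl[of "Suc x" x] that unfolding edges_A by auto
  then have "x \<in> S \<longleftrightarrow> 1 \<in> S" if "1 \<le> x" "x \<le> n" for x using chain_connected[of 1 n S x] that by blast
  moreover have "x \<in> vertices (TypeA n) \<longleftrightarrow> 1 \<le> x \<and> x \<le> n" for x by simp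
  ultimately show "vertices (TypeA n) \<subseteq> S" using i by blast
qed

lemma coroot_D:
  assumes v: "v \<in> root_lattice (TypeD (m + 3))" and m: "m \<ge> 1"
  shows "i \<in> {1..m} \<Longrightarrow> coroot_pairing (TypeD (m + 3)) i v = 2 * v i - v (i - 1) - v (i + 1)"
    and "coroot_pairing (TypeD (m + 3)) (m + 1) v = 2 * v (m + 1) - v m - v (m + 2) - v (m + 3)"
    and "coroot_pairing (TypeD (m + 3)) (m + 2) v = 2 * v (m + 2) - v (m + 1)"
    and "coroot_pairing (TypeD (m + 3)) (m + 3) v = 2 * v (m + 3) - v (m + 1)"
proof -
  let ?T = "TypeD (m + 3)"
  note d = sum_delta_lattice[OF v]
  have lin: "(\<Sum>j\<in>vertices ?T. 2 * (if j = a then v j else 0) - (if j = b then v j else 0)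
     - (if j = c then v j else 0) - (if j = e then v j else 0)) = 2 * v a - v b - v c - v e" for a b c e
    unfolding sum_subtractf sum_distrib_left[symmetric] d ..
  have z: "v 0 = 0" using v by (auto simp: root_lattice_def)
  have pairing: "coroot_pairing ?T i v = 2 * v i - v b - v c - v e"
    if nb: "\<And>j. j \<in> vertices ?T \<Longrightarrow> {i, j} \<in> dynkin_edges ?T \<longleftrightarrow> j = b \<or> j = c \<or> j = e"
      and dist: "b \<noteq> c \<or> b = 0" "b \<noteq> e \<or> b = 0" "c \<noteq> e \<or> c = 0" "i \<noteq> b" "i \<noteq> c" "i \<noteq> e" for i b c e
  proof -
    have "coroot_pairing ?T i v = (\<Sum>j\<in>vertices ?T. 2 * (if j = i then v j else 0) - (if j = b then v j else 0)
     - (if j = c then v j else 0) - (if j = e then v j else 0))"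
      unfolding coroot_pairing_def
    proof (intro sum.cong refl)
      fix j assume j: "j \<in> vertices ?T"
      then have "j \<noteq> 0" by simp
      then show "cartan ?T i j * v j = 2 * (if j = i then v j else 0) - (if j = b then v j else 0)
        - (if j = c then v j else 0) - (if j = e then v j else 0)"
        unfolding cartan_def nb[OF j] using dist by auto
    qed
    then show ?thesis by (simp only: lin)
  qed
  show "coroot_pairing ?T i v = 2 * v i - v (i - 1) - v (i + 1)" if i: "i \<in> {1..m}"
  proof -
    have "{i, j} \<in> dynkin_edges ?T \<longleftrightarrow> j = i - 1 \<or> j = i + 1 \<or> j = 0" if "j \<in> vertices ?T" for j
      unfolding edges_D using i that by auto
    then show ?thesis using pairing[of i "i - 1" "i + 1" 0] i z by fastforce
  qed
  have nb1: "{m + 1, j} \<in> dynkin_edges ?T \<longleftrightarrow> j = m \<or> j = m + 2 \<or> j = m + 3"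
    and nb2: "{m + 2, j} \<in> dynkin_edges ?T \<longleftrightarrow> j = m + 1 \<or> j = 0 \<or> j = 0"
    and nb3: "{m + 3, j} \<in> dynkin_edges ?T \<longleftrightarrow> j = m + 1 \<or> j = 0 \<or> j = 0"
    if "j \<in> vertices ?T" for j
    unfolding edges_D using m that by auto
  show "coroot_pairing ?T (m + 1) v = 2 * v (m + 1) - v m - v (m + 2) - v (m + 3)"
    by (rule pairing[OF nb1]) (use m in auto)
  show "coroot_pairing ?T (m + 2) v = 2 * v (m + 2) - v (m + 1)"
    using pairing[OF nb2] z by simp
  show "coroot_pairing ?T (m + 3) v = 2 * v (m + 3) - v (m + 1)"
    using pairing[OF nb3] z by simp
qed

text \<open>
  These are the squares of the coordinates in the standard realization of the roots by the
  vectors \<open>\<plusminus>e\<^sub>i \<plusminus> e\<^sub>j\<close> of a Euclidean space.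
\<close>

lemma form_D:
  assumes v: "v \<in> root_lattice (TypeD (m + 3))" and m: "m \<ge> 1"
  shows "cartan_form (TypeD (m + 3)) v v =
     (\<Sum>i<m + 1. (v (Suc i) - v i) ^ 2) + (v (m + 1) - v (m + 2) - v (m + 3)) ^ 2 + (v (m + 2) - v (m + 3)) ^ 2"
proof -
  let ?T = "TypeD (m + 3)"
  have z: "v 0 = 0" using v by (auto simp: root_lattice_def)
  have set: "vertices ?T = {1..m} \<union> {m + 1, m + 2, m + 3}" by auto
  have "cartan_form ?T v v = (\<Sum>i\<in>{1..m}. v i * coroot_pairing ?T i v) +
     (\<Sum>i\<in>{m + 1, m + 2, m + 3}. v i * coroot_pairing ?T i v)"
    unfolding cartan_form_def set by (rule sum.union_disjoint) auto
  also have "(\<Sum>i\<in>{1..m}. v i * coroot_pairing ?T i v) = (\<Sum>i = 1..m. v i * (2 * v i - v (i - 1) - v (i + 1)))"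
    using coroot_D(1)[OF v m] by (intro sum.cong refl) simp
  also have "\<dots> = (\<Sum>i<m. (v (Suc i) - v i) ^ 2) + v m ^ 2 - v m * v (m + 1)" by (rule chain_form[where x = v and m = m, OF z])
  also have "(\<Sum>i\<in>{m + 1, m + 2, m + 3}. v i * coroot_pairing ?T i v) =
      v (m + 1) * (2 * v (m + 1) - v m - v (m + 2) - v (m + 3)) + v (m + 2) * (2 * v (m + 2) - v (m + 1))
      + v (m + 3) * (2 * v (m + 3) - v (m + 1))"
    unfolding coroot_D(2-4)[OF v m, symmetric] by simp
  finally show ?thesis by (simp add: power2_eq_square algebra_simps)
qed

lemma finite_type_D:
  assumes m: "m \<ge> 1"
  shows "finite_type (TypeD (m + 3))"
proof
  let ?T = "TypeD (m + 3)"
  fix i j assume e: "{i, j} \<in> dynkin_edges ?T"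
  then show "i \<in> vertices ?T \<and> j \<in> vertices ?T \<and> i \<noteq> j" unfolding edges_D using m by auto
  show "\<exists>S. j \<in> S \<and> i \<notin> S \<and> (\<forall>a b. {a, b} \<in> dynkin_edges ?T \<and> a \<in> S \<and> b \<notin> S \<longrightarrow> a = j \<and> b = i)"
  proof -
    have chain: "a = Suc k \<and> b = k"
      if "{a, b} \<in> dynkin_edges ?T" "a \<in> {x. Suc k \<le> x \<and> (k \<le> m \<or> x \<noteq> m + 3)}"
        "b \<notin> {x. Suc k \<le> x \<and> (k \<le> m \<or> x \<noteq> m + 3)}" "k \<le> m + 1" for a b k
      using that unfolding edges_D by auto
    have branch: "a = m + 3 \<and> b = m + 1" if "{a, b} \<in> dynkin_edges ?T" "a \<in> {m + 3}" "b \<notin> {m + 3}" for a b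
      using that unfolding edges_D by auto
    consider "j = Suc i" "i \<le> m + 1" | "i = Suc j" "j \<le> m + 1" | "i = m + 1" "j = m + 3" | "j = m + 1" "i = m + 3"
      using e unfolding edges_D by auto
    then show ?thesis
    proof cases
      case 1
      then show ?thesis
        using cut_flip(1)[of j "{x. Suc i \<le> x \<and> (i \<le> m \<or> x \<noteq> m + 3)}" i ?T] chain by auto
    next
      case 2
      then show ?thesis
        using cut_flip(2)[of i "{x. Suc j \<le> x \<and> (j \<le> m \<or> x \<noteq> m + 3)}" j ?T] chain by auto
    next
      case 3
      then show ?thesis using cut_flip(1)[of j "{m + 3}" i ?T] branch by auto
    next
      case 4
      then show ?thesis using cut_flip(2)[of i "{m + 3}" j ?T] branch by auto
    qed
  qed
next
  let ?T = "TypeD (m + 3)"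
  have "\<bar>v i\<bar> \<le> 3 * cartan_form ?T v v" if v: "v \<in> root_lattice ?T" for v i
  proof -
    let ?S = "\<Sum>i<m + 1. (v (Suc i) - v i) ^ 2" and ?f = "cartan_form ?T v v"
    have z: "v 0 = 0" using v by (auto simp: root_lattice_def)
    have pos: "?S \<ge> 0" by (intro sum_nonneg zero_le_power2)
    have x: "\<bar>v (m + 1) - v (m + 2) - v (m + 3)\<bar> \<le> (v (m + 1) - v (m + 2) - v (m + 3)) ^ 2"
      and y: "\<bar>v (m + 2) - v (m + 3)\<bar> \<le> (v (m + 2) - v (m + 3)) ^ 2" by (rule int_abs_le_square)+
    note f = form_D[OF v m]
    have c: "\<bar>v j\<bar> \<le> ?S" if "j \<le> m + 1" for j by (rule chain_bound) (use z that in auto)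
    consider "i \<le> m + 1" | "i = m + 2" | "i = m + 3" | "i > m + 3" by linarith
    then show ?thesis
    proof cases
      case 1
      then show ?thesis using c[of i] f x y pos by linarith
    next
      case 2
      show ?thesis unfolding 2 using c[OF order_refl] f x y pos by linarith
    next
      case 3
      show ?thesis unfolding 3 using c[OF order_refl] f x y pos by linarith
    next
      case 4
      then have "v i = 0" using v by (auto simp: root_lattice_def)
      then show ?thesis using f x y pos by linarith
    qed
  qed
  then show "\<exists>D. \<forall>v\<in>root_lattice ?T. \<forall>i. \<bar>v i\<bar> \<le> D * cartan_form ?T v v" by blast
next
  let ?T = "TypeD (m + 3)"
  fix S i assume i: "i \<in> vertices ?T" "i \<in> S"
    and cl: "\<And>a b. {a, b} \<in> dynkin_edges ?T \<Longrightarrow> a \<in> S \<Longrightarrow> b \<in> S"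
  have "x \<in> S \<longleftrightarrow> Suc x \<in> S" if "1 \<le> x" "x < m + 2" for x
    using cl[of x "Suc x"] cl[of "Suc x" x] that unfolding edges_D by auto
  then have c: "x \<in> S \<longleftrightarrow> 1 \<in> S" if "1 \<le> x" "x \<le> m + 2" for x using chain_connected[of 1 "m + 2" S x] that by blast
  have "m + 3 \<in> S \<longleftrightarrow> m + 1 \<in> S" using cl[of "m + 3" "m + 1"] cl[of "m + 1" "m + 3"] unfolding edges_D by auto
  then have "m + 3 \<in> S \<longleftrightarrow> 1 \<in> S" using c[of "m + 1"] by simp
  then have all: "x \<in> S \<longleftrightarrow> 1 \<in> S" if "1 \<le> x" "x \<le> m + 3" for x 
  proof (cases "x = m + 3")
    case True
    then show ?thesis using \<open>m + 3 \<in> S \<longleftrightarrow> 1 \<in> S\<close> by simp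
  next
    case False
    then show ?thesis using c[of x] that by simp
  qed
  have "x \<in> vertices ?T \<longleftrightarrow> 1 \<le> x \<and> x \<le> m + 3" for x by simp
  then show "vertices ?T \<subseteq> S" using i all by blast
qed

text \<open>
  The right-hand side consists of the squares of the doubled coordinates in the standard realization of \<open>E\<^sub>8\<close>
  in the eight-dimensional Euclidean space; \<open>E\<^sub>6\<close> and \<open>E\<^sub>7\<close> are the sublattices with \<open>v\<^sub>7 = v\<^sub>8 = 0\<close> and \<open>v\<^sub>8 = 0\<close>.
\<close>

lemma form_E:
  assumes "n \<in> {6, 7, 8}" "v \<in> root_lattice (TypeE n)"
  shows "4 * cartan_form (TypeE n) v v =
     (v 1 + 2 * v 2 - 2 * v 3) ^ 2 + (- v 1 + 2 * v 2 + 2 * v 3 - 2 * v 4) ^ 2 + (- v 1 + 2 * v 4 - 2 * v 5) ^ 2 +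
     (- v 1 + 2 * v 5 - 2 * v 6) ^ 2 + (- v 1 + 2 * v 6 - 2 * v 7) ^ 2 + (- v 1 + 2 * v 7 - 2 * v 8) ^ 2 +
     (- v 1 + 2 * v 8) ^ 2 + v 1 ^ 2"
proof -
  have set: "vertices (TypeE 6) = {1, 2, 3, 4, 5, 6}" "vertices (TypeE 7) = {1, 2, 3, 4, 5, 6, 7}"
    "vertices (TypeE 8) = {1, 2, 3, 4, 5, 6, 7, 8}"
    by auto
  consider "n = 6" "v 7 = 0" "v 8 = 0" | "n = 7" "v 8 = 0" | "n = 8"
    using assms by (auto simp: root_lattice_def)
  then show ?thesis
    by cases (simp_all add: cartan_form_def coroot_pairing_def cartan_def set edges_E power2_eq_square algebra_simps
        del: dynkin_edges.simps vertices.simps)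
qed

lemma abs_le_sum_of_eight_squares:
  fixes f :: int
  assumes "4 * f = a1\<^sup>2 + a2\<^sup>2 + a3\<^sup>2 + a4\<^sup>2 + a5\<^sup>2 + a6\<^sup>2 + a7\<^sup>2 + a8\<^sup>2"
  shows "\<bar>a1\<bar> \<le> 4 * f \<and> \<bar>a2\<bar> \<le> 4 * f \<and> \<bar>a3\<bar> \<le> 4 * f \<and> \<bar>a4\<bar> \<le> 4 * f \<and> \<bar>a5\<bar> \<le> 4 * f \<and> \<bar>a6\<bar> \<le> 4 * f \<and> \<bar>a7\<bar> \<le> 4 * f \<and> \<bar>a8\<bar> \<le> 4 * f"
proof -
  have sq: "y \<le> y\<^sup>2 \<and> - y \<le> y\<^sup>2 \<and> 0 \<le> y\<^sup>2" for y :: int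
    using int_abs_le_square[of y] by (simp add: abs_le_iff)
  show ?thesis
    unfolding abs_le_iff assms
    using sq[of a1] sq[of a2] sq[of a3] sq[of a4] sq[of a5] sq[of a6] sq[of a7] sq[of a8]
    by (intro conjI; linarith)
qed

text \<open>
  Each \<open>x\<^sub>i\<close> is a small rational combination of the eight linear forms; 20 is a generous common bound.
\<close>

lemma form_E_bound:
  fixes f :: int
  assumes "4 * f = (x1 + 2 * x2 - 2 * x3) ^ 2 +
     (- x1 + 2 * x2 + 2 * x3 - 2 * x4) ^ 2 +
     (- x1 + 2 * x4 - 2 * x5) ^ 2 +
     (- x1 + 2 * x5 - 2 * x6) ^ 2 +
     (- x1 + 2 * x6 - 2 * x7) ^ 2 +
     (- x1 + 2 * x7 - 2 * x8) ^ 2 +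
     (- x1 + 2 * x8) ^ 2 +
     (x1) ^ 2"
  shows "0 \<le> f \<and> \<bar>x1\<bar> \<le> 20 * f \<and> \<bar>x2\<bar> \<le> 20 * f \<and> \<bar>x3\<bar> \<le> 20 * f \<and> \<bar>x4\<bar> \<le> 20 * f \<and> \<bar>x5\<bar> \<le> 20 * f \<and> \<bar>x6\<bar> \<le> 20 * f \<and> \<bar>x7\<bar> \<le> 20 * f \<and> \<bar>x8\<bar> \<le> 20 * f"
proof -
  note y = abs_le_sum_of_eight_squares[OF assms, unfolded abs_le_iff]
  have "0 \<le> f" using y by linarith
  moreover have "x1 \<le> 20 * f \<and> - x1 \<le> 20 * f \<and> x2 \<le> 20 * f \<and> - x2 \<le> 20 * f \<and> x3 \<le> 20 * f \<and> - x3 \<le> 20 * f \<and> x4 \<le> 20 * f \<and> - x4 \<le> 20 * f \<and> x5 \<le> 20 * f \<and> - x5 \<le> 20 * f \<and> x6 \<le> 20 * f \<and> - x6 \<le> 20 * f \<and> x7 \<le> 20 * f \<and> - x7 \<le> 20 * f \<and> x8 \<le> 20 * f \<and> - x8 \<le> 20 * f"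
    using y by (intro conjI; linarith)
  ultimately show ?thesis by (simp add: abs_le_iff)
qed

lemma finite_type_E:
  assumes n: "n \<in> {6, 7, 8}"
  shows "finite_type (TypeE n)"
proof
  fix i j assume e: "{i, j} \<in> dynkin_edges (TypeE n)"
  then show "i \<in> vertices (TypeE n) \<and> j \<in> vertices (TypeE n) \<and> i \<noteq> j" unfolding edges_E using n by auto
  show "\<exists>S. j \<in> S \<and> i \<notin> S \<and> (\<forall>a b. {a, b} \<in> dynkin_edges (TypeE n) \<and> a \<in> S \<and> b \<notin> S \<longrightarrow> a = j \<and> b = i)"
  proof -
    have e1: "{a, b} \<in> dynkin_edges (TypeE n) \<Longrightarrow> a \<in> {1} \<Longrightarrow> b \<notin> {1} \<Longrightarrow> a = 1 \<and> b = 3" for a b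
      unfolding edges_E by auto
    have e2: "{a, b} \<in> dynkin_edges (TypeE n) \<Longrightarrow> a \<in> {2} \<Longrightarrow> b \<notin> {2} \<Longrightarrow> a = 2 \<and> b = 4" for a b
      unfolding edges_E by auto
    have e3: "{a, b} \<in> dynkin_edges (TypeE n) \<Longrightarrow> a \<in> {1, 3} \<Longrightarrow> b \<notin> {1, 3} \<Longrightarrow> a = 3 \<and> b = 4" for a b
      unfolding edges_E by auto
    have e4: "{a, b} \<in> dynkin_edges (TypeE n) \<Longrightarrow> a \<in> {Suc k..} \<Longrightarrow> b \<notin> {Suc k..} \<Longrightarrow> a = Suc k \<and> b = k" if "4 \<le> k" for a b k
      using that unfolding edges_E by auto
    from e consider "i = 1" "j = 3" | "i = 3" "j = 1" | "i = 2" "j = 4" | "i = 4" "j = 2"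
      | "3 \<le> i" "j = i + 1" | "3 \<le> j" "i = j + 1"
      unfolding edges_E by blast
    then show ?thesis
    proof cases
      case 1
      show ?thesis unfolding 1 by (rule cut_flip(2)[of 1 "{1}" 3, OF _ _ e1]) simp_all
    next
      case 2
      show ?thesis unfolding 2 by (rule cut_flip(1)[of 1 "{1}" 3, OF _ _ e1]) simp_all
    next
      case 3
      show ?thesis unfolding 3 by (rule cut_flip(2)[of 2 "{2}" 4, OF _ _ e2]) simp_all
    next
      case 4
      show ?thesis unfolding 4 by (rule cut_flip(1)[of 2 "{2}" 4, OF _ _ e2]) simp_all
    next
      case 5
      show ?thesis
      proof (cases "i = 3")
        case True
        then have j: "j = 4" using 5 by simp
        show ?thesis unfolding True j by (rule cut_flip(2)[of 3 "{1, 3}" 4, OF _ _ e3]) simp_all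
      next
        case False
        then have i: "4 \<le> i" "j = Suc i" using 5 by auto
        show ?thesis unfolding i(2) by (rule cut_flip(1)[of "Suc i" "{Suc i..}" i, OF _ _ e4[OF i(1)]]) simp_all
      qed
    next
      case 6
      show ?thesis
      proof (cases "j = 3")
        case True
        then have i: "i = 4" using 6 by simp
        show ?thesis unfolding True i by (rule cut_flip(1)[of 3 "{1, 3}" 4, OF _ _ e3]) simp_all
      next
        case False
        then have j: "4 \<le> j" "i = Suc j" using 6 by auto
        show ?thesis unfolding j(2) by (rule cut_flip(2)[of "Suc j" "{Suc j..}" j, OF _ _ e4[OF j(1)]]) simp_all
      qed
    qed
  qed
next
  have "\<bar>v i\<bar> \<le> 20 * cartan_form (TypeE n) v v" if v: "v \<in> root_lattice (TypeE n)" for v i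
  proof -
    let ?f = "cartan_form (TypeE n) v v"
    have "0 \<le> ?f \<and> \<bar>v 1\<bar> \<le> 20 * ?f \<and> \<bar>v 2\<bar> \<le> 20 * ?f \<and> \<bar>v 3\<bar> \<le> 20 * ?f \<and> \<bar>v 4\<bar> \<le> 20 * ?f \<and>
      \<bar>v 5\<bar> \<le> 20 * ?f \<and> \<bar>v 6\<bar> \<le> 20 * ?f \<and> \<bar>v 7\<bar> \<le> 20 * ?f \<and> \<bar>v 8\<bar> \<le> 20 * ?f"
      by (rule form_E_bound[OF form_E[OF n v]])
    moreover have "i = 1 \<or> i = 2 \<or> i = 3 \<or> i = 4 \<or> i = 5 \<or> i = 6 \<or> i = 7 \<or> i = 8 \<or> v i = 0"
    proof (cases "i \<in> vertices (TypeE n)")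
      case True
      then have "1 \<le> i" "i \<le> 8" using n by auto
      then have "i = 1 \<or> i = 2 \<or> i = 3 \<or> i = 4 \<or> i = 5 \<or> i = 6 \<or> i = 7 \<or> i = 8" by arith
      then show ?thesis by blast
    qed (use root_latticeD[OF v] in blast)
    ultimately show ?thesis by (elim conjE disjE) simp_all
  qed
  then show "\<exists>D. \<forall>v\<in>root_lattice (TypeE n). \<forall>i. \<bar>v i\<bar> \<le> D * cartan_form (TypeE n) v v" by blast
next
  fix S i assume i: "i \<in> vertices (TypeE n)" "i \<in> S"
    and cl: "\<And>a b. {a, b} \<in> dynkin_edges (TypeE n) \<Longrightarrow> a \<in> S \<Longrightarrow> b \<in> S"
  have "x \<in> S \<longleftrightarrow> Suc x \<in> S" if "3 \<le> x" "x < n" for x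
    using cl[of x "Suc x"] cl[of "Suc x" x] that unfolding edges_E by auto
  then have c: "x \<in> S \<longleftrightarrow> 3 \<in> S" if "3 \<le> x" "x \<le> n" for x using chain_connected[of 3 n S x] that by blast
  have "1 \<in> S \<longleftrightarrow> 3 \<in> S" using cl[of 1 3] cl[of 3 1] unfolding edges_E by auto
  moreover have "2 \<in> S \<longleftrightarrow> 4 \<in> S" using cl[of 2 4] cl[of 4 2] unfolding edges_E by auto
  moreover have "4 \<in> S \<longleftrightarrow> 3 \<in> S" using c[of 4] n by auto
  moreover have "x = 1 \<or> x = 2 \<or> 3 \<le> x" if "1 \<le> x" for x :: nat using that by auto
  ultimately have all: "x \<in> S \<longleftrightarrow> 3 \<in> S" if "1 \<le> x" "x \<le> n" for x using c[of x] that by metis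
  have "x \<in> vertices (TypeE n) \<longleftrightarrow> 1 \<le> x \<and> x \<le> n" for x by simp
  then show "vertices (TypeE n) \<subseteq> S" using i all by blast
qed

lemma dynkin_finite_type: "dynkin_type T \<Longrightarrow> finite_type T"
proof (cases T)
  case (TypeD n)
  assume "dynkin_type T"
  then have "n = (n - 3) + 3" "n - 3 \<ge> 1" using TypeD by auto
  then show ?thesis using finite_type_D[of "n - 3"] TypeD by simp
qed (use finite_type_A finite_type_E in auto)

theorem proposition6p18:
  fixes T :: dynkin
    and Q Q' :: quiver
    and \<xi> :: "quiver \<Rightarrow> nat \<Rightarrow> int"
    and k l :: nat
  assumes "dynkin_type T"
    and "dynkin_quiver T Q"
    and "dynkin_quiver T Q'"
    and "\<And>R. dynkin_quiver T R \<Longrightarrow> height_function R (\<xi> R)"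
    and "k \<in> vertices T"
    and "l \<in> vertices T"
  shows "distance_poly T \<xi> Q k l = distance_poly T \<xi> Q' k l"
  using finite_type.distance_poly_independent[OF dynkin_finite_type[OF assms(1)] assms(4,2,3)] .

end
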